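(* The elements $\mathsf{E}_{X_{\lambda^{(m)}}}$, where $X_{\lambda^{(m)}}$ runs over all standard $m$-tableaux of size $n$ (of all shapes), form a complete set of pairwise orthogonal primitive idempotents of the algebra $H(m,1,n)$. Moreover, there is a well-defined algebra homomorphism $\varrho\colon\mathfrak{T}\to H(m,1,n)$ which is identical on the generators $\tau,\sigma_1,\dots,\sigma_{n-1}$ and sends $\mathcal{X}_{\lambda^{(m)}}$ to $\mathsf{E}_{X_{\lambda^{(m)}}}$ for all standard $m$-tableaux $X_{\lambda^{(m)}}$ of size $n$.
   Context: Parameters. Let $m,n\ge 1$. Either $K=\mathbb{C}(q,v_1,\dots,v_m)$ with $q,v_1,\dots,v_m$ indeterminates, or $K=\mathbb{C}$ and $q,v_1,\dots,v_m\in\mathbb{C}$, $q\neq0$, satisfy: $1+q^2+\dots+q^{2N}\neq0$ for all non-negative integers $N<n$; $q^{2i}v_j-v_k\neq0$ for all $i,j,k$ with $j\neq k$ and $-n<i<n$; $v_j\neq0$ for all $j=1,\dots,m$. Cyclotomic Hecke algebra. $H(m,1,n)$ is the associative unital $K$-algebra generated by $\tau,\sigma_1,\dots,\sigma_{n-1}$ with defining relations $\sigma_i\sigma_{i+1}\sigma_i=\sigma_{i+1}\sigma_i\sigma_{i+1}$; $\sigma_i\sigma_j=\sigma_j\sigma_i$ if $|i-j|>1$; $\tau\sigma_1\tau\sigma_1=\sigma_1\tau\sigma_1\tau$; $\tau\sigma_i=\sigma_i\tau$ for $i>1$; $\sigma_i^2=(q-q^{-1})\sigma_i+1$; $(\tau-v_1)\cdots(\tau-v_m)=0$.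 For $n'<n$, $H(m,1,n')$ is regarded as the subalgebra of $H(m,1,n)$ generated by $\tau,\sigma_1,\dots,\sigma_{n'-1}$, with $H(m,1,0)=K$. Jucys--Murphy elements: $J_1=\tau$, $J_{i+1}=\sigma_iJ_i\sigma_i$. Tableaux. An $m$-partition of $n$ is an $m$-tuple $\lambda^{(m)}=(\lambda_1,\dots,\lambda_m)$ of partitions (Young diagrams) with $|\lambda_1|+\dots+|\lambda_m|=n$. Its $m$-nodes are the nodes of the diagrams together with the index $k$ of the diagram. The content $c(\alpha^{(m)})$ of the $m$-node $\alpha^{(m)}$ in row $r$ and column $s$ of the $k$-th diagram is $v_kq^{2(s-r)}$. A standard $m$-tableau of shape $\lambda^{(m)}$ is a bijective filling of the $m$-nodes with $1,\dots,n$ such that in every diagram the numbers increase along rows (to the right) and columns (downwards). $c(X_{\lambda^{(m)}}|i)$ is the content of the $m$-node carrying $i$ in $X_{\lambda^{(m)}}$. $X_{\lambda^{(m)}}^{s_i}$ is obtained by exchanging $i$ and $i+1$. $\mathcal{E}_+(\mu^{(m)})$ is the set of addable $m$-nodes of $\mu^{(m)}$, i.e. $m$-nodes not in $\mu^{(m)}$ whose addition to $\mu^{(m)}$ gives an $m$-partition. Elements $\mathsf{E}$. They are defined recursively by $\mathsf{E}_{\varnothing}=1$ and $$\mathsf{E}_{X_{\lambda^{(m)}}}:=\mathsf{E}_{X_{\mu^{(m)}}}\prod_{\beta^{(m)}\in\mathcal{E}_+(\mu^{(m)}),\ \beta^{(m)}\neq\alpha^{(m)}}\frac{J_n-c(\beta^{(m)})}{c(\alpha^{(m)})-c(\beta^{(m)})},$$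 where $\alpha^{(m)}$ is the $m$-node occupied by $n$ in $X_{\lambda^{(m)}}$, $\mu^{(m)}=\lambda^{(m)}\setminus\{\alpha^{(m)}\}$, and $X_{\mu^{(m)}}$ is the standard $m$-tableau with $1,\dots,n-1$ at the same $m$-nodes as in $X_{\lambda^{(m)}}$. The algebra $\mathfrak{T}$. Let $K[\mathcal{X}]$ be the free associative unital algebra with generators $\mathcal{X}_{\lambda^{(m)}}$ labeled by all standard $m$-tableaux $X_{\lambda^{(m)}}$ of all shapes of size $n$. $\mathfrak{T}$ is the vector space $K[\mathcal{X}]\otimes H(m,1,n)$ with the associative product for which $K[\mathcal{X}]$ and $H(m,1,n)$ are subalgebras, $(x\otimes1)(1\otimes\phi)=x\otimes\phi$, and, with $c^{(i)}=c(X_{\lambda^{(m)}}|i)$, $$\Bigl(\sigma_i+\frac{(q-q^{-1})c^{(i+1)}}{c^{(i)}-c^{(i+1)}}\Bigr)\mathcal{X}_{\lambda^{(m)}}=\mathcal{X}_{\lambda^{(m)}}^{s_i}\Bigl(\sigma_i+\frac{(q-q^{-1})c^{(i)}}{c^{(i+1)}-c^{(i)}}\Bigr),\qquad (\tau-c^{(1)})\mathcal{X}_{\lambda^{(m)}}=0,$$ where $\mathcal{X}_{\lambda^{(m)}}^{s_i}$ is the generator of $X_{\lambda^{(m)}}^{s_i}$ if this is standard and $0$ otherwise.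
   Formalization: In the case K = ℂ with n ≥ 2 it is additionally assumed that q² ≠ 1; for q² = 1 the listed parameter conditions can hold, but two addable nodes of one diagram then have equal content, so the definition of E divides by zero. *)

theory Defs
  imports
    Complex_Main
    "HOL-Library.Poly_Mapping"
    "HOL-Computational_Algebra.Fraction_Field"
    "HOL-Combinatorics.Transposition"
    "HOL-Algebra.QuotRing"
begin

section \<open>Free algebras\<close>

text \<open>The free monoid is written additively, so that the finitely supported functions
  from words to \<open>K\<close> with the convolution product of \<open>Poly_Mapping\<close> are the free
  associative unital \<open>K\<close>-algebra.\<close>

datatype 'g fword = FWord (letters: "'g list")

instantiation fword :: (type) monoid_add
begin

definition zero_fword :: "'a fword" where
  "zero_fword = FWord []"

definition plus_fword :: "'a fword \<Rightarrow> 'a fword \<Rightarrow> 'a fword" where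
  "plus_fword u w = FWord (letters u @ letters w)"

instance
  by standard (simp_all add: zero_fword_def plus_fword_def)

end

definition fgen :: "'g \<Rightarrow> ('g fword \<Rightarrow>\<^sub>0 'k::field)" where
  "fgen g = Poly_Mapping.single (FWord [g]) 1"

definition fconst :: "'k::field \<Rightarrow> ('g fword \<Rightarrow>\<^sub>0 'k)" where
  "fconst c = Poly_Mapping.single 0 c"

definition free_algebra :: "'g set \<Rightarrow> ('g fword \<Rightarrow>\<^sub>0 'k::field) ring" where
  "free_algebra G =
     \<lparr>carrier = {p. \<forall>w\<in>Poly_Mapping.keys p. set (letters w) \<subseteq> G},
      mult = (*), one = 1, zero = 0, add = (+)\<rparr>"

section \<open>Parameters\<close>

text \<open>Only the values \<open>v 1, \<dots>, v m\<close> matter here and below.\<close>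

definition admissible :: "nat \<Rightarrow> nat \<Rightarrow> complex \<Rightarrow> (nat \<Rightarrow> complex) \<Rightarrow> bool" where
  "admissible m n q v \<longleftrightarrow>
     q \<noteq> 0 \<and>
     (\<forall>N<n. (\<Sum>i\<le>N. q ^ (2 * i)) \<noteq> 0) \<and>
     (\<forall>i::int. \<forall>j\<in>{1..m}. \<forall>k\<in>{1..m}.
        j \<noteq> k \<longrightarrow> - int n < i \<longrightarrow> i < int n \<longrightarrow> q powi (2 * i) * v j - v k \<noteq> 0) \<and>
     (\<forall>j\<in>{1..m}. v j \<noteq> 0)"

text \<open>The field of rational functions over the complex numbers in the variables
  \<open>x :: 'x\<close>. The order on \<open>'x\<close> only serves the library's proof that the polynomials form
  an integral domain.\<close>

type_synonym 'x ratfun = "(('x \<Rightarrow>\<^sub>0 nat) \<Rightarrow>\<^sub>0 complex) fract"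

definition indeterminate :: "'x::{finite,linorder} \<Rightarrow> 'x ratfun" where
  "indeterminate x = Fract (Poly_Mapping.single (Poly_Mapping.single x 1) 1) 1"

section \<open>The cyclotomic Hecke algebra\<close>

datatype hgen = Tau | Sigma nat

definition hecke_gens :: "nat \<Rightarrow> hgen set" where
  "hecke_gens n = insert Tau (Sigma ` {1..<n})"

definition hecke_relators ::
    "nat \<Rightarrow> nat \<Rightarrow> 'k::field \<Rightarrow> (nat \<Rightarrow> 'k) \<Rightarrow> (hgen fword \<Rightarrow>\<^sub>0 'k) set" where
  "hecke_relators m n q v =
     (let \<tau> = fgen Tau; \<sigma> = (\<lambda>i. fgen (Sigma i)) in
       {\<sigma> i * \<sigma> (i + 1) * \<sigma> i - \<sigma> (i + 1) * \<sigma> i * \<sigma> (i + 1) | i. 1 \<le> i \<and> i + 1 < n}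
     \<union> {\<sigma> i * \<sigma> j - \<sigma> j * \<sigma> i | i j.
          i \<in> {1..<n} \<and> j \<in> {1..<n} \<and> \<bar>int i - int j\<bar> > 1}
     \<union> {\<tau> * \<sigma> 1 * \<tau> * \<sigma> 1 - \<sigma> 1 * \<tau> * \<sigma> 1 * \<tau> | i::nat. i = 1 \<and> i < n}
     \<union> {\<tau> * \<sigma> i - \<sigma> i * \<tau> | i. 1 < i \<and> i < n}
     \<union> {\<sigma> i * \<sigma> i - (fconst (q - inverse q) * \<sigma> i + 1) | i. 1 \<le> i \<and> i < n}
     \<union> {prod_list (map (\<lambda>j. \<tau> - fconst (v j)) [1..<Suc m])})"

definition hecke_ideal ::
    "nat \<Rightarrow> nat \<Rightarrow> 'k::field \<Rightarrow> (nat \<Rightarrow> 'k) \<Rightarrow> (hgen fword \<Rightarrow>\<^sub>0 'k) set" where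
  "hecke_ideal m n q v = Idl\<^bsub>free_algebra (hecke_gens n)\<^esub> (hecke_relators m n q v)"

definition hecke ::
    "nat \<Rightarrow> nat \<Rightarrow> 'k::field \<Rightarrow> (nat \<Rightarrow> 'k) \<Rightarrow> (hgen fword \<Rightarrow>\<^sub>0 'k) set ring" where
  "hecke m n q v = free_algebra (hecke_gens n) Quot hecke_ideal m n q v"

definition hecke_class ::
    "nat \<Rightarrow> nat \<Rightarrow> 'k::field \<Rightarrow> (nat \<Rightarrow> 'k) \<Rightarrow> (hgen fword \<Rightarrow>\<^sub>0 'k) \<Rightarrow>
     (hgen fword \<Rightarrow>\<^sub>0 'k) set" where
  "hecke_class m n q v p = hecke_ideal m n q v +>\<^bsub>free_algebra (hecke_gens n)\<^esub> p"

definition hconst ::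
    "nat \<Rightarrow> nat \<Rightarrow> 'k::field \<Rightarrow> (nat \<Rightarrow> 'k) \<Rightarrow> 'k \<Rightarrow> (hgen fword \<Rightarrow>\<^sub>0 'k) set" where
  "hconst m n q v c = hecke_class m n q v (fconst c)"

definition htau ::
    "nat \<Rightarrow> nat \<Rightarrow> 'k::field \<Rightarrow> (nat \<Rightarrow> 'k) \<Rightarrow> (hgen fword \<Rightarrow>\<^sub>0 'k) set" where
  "htau m n q v = hecke_class m n q v (fgen Tau)"

definition hsigma ::
    "nat \<Rightarrow> nat \<Rightarrow> 'k::field \<Rightarrow> (nat \<Rightarrow> 'k) \<Rightarrow> nat \<Rightarrow> (hgen fword \<Rightarrow>\<^sub>0 'k) set" where
  "hsigma m n q v i = hecke_class m n q v (fgen (Sigma i))"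

text \<open>Jucys--Murphy elements \<open>J 1, \<dots>, J n\<close> of \<open>H(m,1,n)\<close>; there is no \<open>J 0\<close>.\<close>

fun JM ::
    "nat \<Rightarrow> nat \<Rightarrow> 'k::field \<Rightarrow> (nat \<Rightarrow> 'k) \<Rightarrow> nat \<Rightarrow> (hgen fword \<Rightarrow>\<^sub>0 'k) set" where
  "JM m n q v 0 = undefined"
| "JM m n q v (Suc 0) = htau m n q v"
| "JM m n q v (Suc (Suc i)) =
     hsigma m n q v (Suc i) \<otimes>\<^bsub>hecke m n q v\<^esub> JM m n q v (Suc i)
       \<otimes>\<^bsub>hecke m n q v\<^esub> hsigma m n q v (Suc i)"

section \<open>Multipartitions and standard tableaux\<close>

text \<open>The node \<open>(k, r, s)\<close> lies in row \<open>r\<close> and column \<open>s\<close> of the \<open>k\<close>-th diagram, all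
  indices starting from 1.\<close>

type_synonym mnode = "nat \<times> nat \<times> nat"

definition is_partition :: "nat list \<Rightarrow> bool" where
  "is_partition p \<longleftrightarrow> sorted_wrt (\<ge>) p \<and> 0 \<notin> set p"

definition is_mpartition :: "nat \<Rightarrow> nat \<Rightarrow> nat list list \<Rightarrow> bool" where
  "is_mpartition m n ps \<longleftrightarrow>
     length ps = m \<and> (\<forall>p\<in>set ps. is_partition p) \<and> sum_list (map sum_list ps) = n"

definition mnodes :: "nat list list \<Rightarrow> mnode set" where
  "mnodes ps = {(k, r, s). k \<in> {1..length ps} \<and> r \<in> {1..length (ps ! (k - 1))} \<and>
                           s \<in> {1..ps ! (k - 1) ! (r - 1)}}"

text \<open>From here on an \<open>m\<close>-partition is given by its set of \<open>m\<close>-nodes.\<close>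

definition is_mdiagram :: "nat \<Rightarrow> mnode set \<Rightarrow> bool" where
  "is_mdiagram m D \<longleftrightarrow> (\<exists>n ps. is_mpartition m n ps \<and> D = mnodes ps)"

definition addable :: "nat \<Rightarrow> mnode set \<Rightarrow> mnode set" where
  "addable m D = {\<alpha>. \<alpha> \<notin> D \<and> is_mdiagram m (insert \<alpha> D)}"

definition content :: "'k::field \<Rightarrow> (nat \<Rightarrow> 'k) \<Rightarrow> mnode \<Rightarrow> 'k" where
  "content q v = (\<lambda>(k, r, s). v k * q powi (2 * (int s - int r)))"

text \<open>A tableau is its filling, extended by 0 outside the diagram, which is thus recovered
  as the support.\<close>

type_synonym mtableau = "mnode \<Rightarrow> nat"

definition shape :: "mtableau \<Rightarrow> mnode set" where
  "shape X = {\<alpha>. X \<alpha> \<noteq> 0}"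

definition standard_tableaux :: "nat \<Rightarrow> nat \<Rightarrow> mtableau set" where
  "standard_tableaux m n = {X.
     (\<exists>ps. is_mpartition m n ps \<and> shape X = mnodes ps) \<and>
     bij_betw X (shape X) {1..n} \<and>
     (\<forall>k r s s'. (k, r, s) \<in> shape X \<longrightarrow> (k, r, s') \<in> shape X \<longrightarrow> s < s' \<longrightarrow>
        X (k, r, s) < X (k, r, s')) \<and>
     (\<forall>k r r' s. (k, r, s) \<in> shape X \<longrightarrow> (k, r', s) \<in> shape X \<longrightarrow> r < r' \<longrightarrow>
        X (k, r, s) < X (k, r', s))}"

definition node_of :: "mtableau \<Rightarrow> nat \<Rightarrow> mnode" where
  "node_of X i = (THE \<alpha>. X \<alpha> = i)"

definition content_at :: "'k::field \<Rightarrow> (nat \<Rightarrow> 'k) \<Rightarrow> mtableau \<Rightarrow> nat \<Rightarrow> 'k" where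
  "content_at q v X i = content q v (node_of X i)"

definition swap_tableau :: "nat \<Rightarrow> mtableau \<Rightarrow> mtableau" where
  "swap_tableau i X = (\<lambda>\<alpha>. Transposition.transpose i (i + 1) (X \<alpha>))"

definition remove_entry :: "nat \<Rightarrow> mtableau \<Rightarrow> mtableau" where
  "remove_entry i X = (\<lambda>\<alpha>. if X \<alpha> = i then 0 else X \<alpha>)"

section \<open>The idempotents\<close>

text \<open>\<open>E_upto m n q v k X\<close> is the element of a standard tableau \<open>X\<close> of size \<open>k \<le> n\<close>,
  taken inside \<open>H(m,1,n)\<close>. The factors are polynomials in one Jucys--Murphy element, so
  they commute and \<open>finprod\<close> does not depend on their order although the ring is not
  commutative.\<close>

primrec E_upto ::
    "nat \<Rightarrow> nat \<Rightarrow> 'k::field \<Rightarrow> (nat \<Rightarrow> 'k) \<Rightarrow> nat \<Rightarrow> mtableau \<Rightarrow>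
     (hgen fword \<Rightarrow>\<^sub>0 'k) set" where
  "E_upto m n q v 0 X = \<one>\<^bsub>hecke m n q v\<^esub>"
| "E_upto m n q v (Suc k) X =
     (let H = hecke m n q v; \<alpha> = node_of X (Suc k); Y = remove_entry (Suc k) X in
        E_upto m n q v k Y \<otimes>\<^bsub>H\<^esub>
        (\<Otimes>\<^bsub>H\<^esub>\<beta> \<in> addable m (shape Y) - {\<alpha>}.
           hconst m n q v (1 / (content q v \<alpha> - content q v \<beta>)) \<otimes>\<^bsub>H\<^esub>
           (JM m n q v (Suc k) \<ominus>\<^bsub>H\<^esub> hconst m n q v (content q v \<beta>))))"

definition E_elt ::
    "nat \<Rightarrow> nat \<Rightarrow> 'k::field \<Rightarrow> (nat \<Rightarrow> 'k) \<Rightarrow> mtableau \<Rightarrow> (hgen fword \<Rightarrow>\<^sub>0 'k) set" where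
  "E_elt m n q v X = E_upto m n q v n X"

definition idempotent_in :: "('a, 'b) ring_scheme \<Rightarrow> 'a \<Rightarrow> bool" where
  "idempotent_in R e \<longleftrightarrow> e \<in> carrier R \<and> e \<otimes>\<^bsub>R\<^esub> e = e"

definition primitive_idempotent :: "('a, 'b) ring_scheme \<Rightarrow> 'a \<Rightarrow> bool" where
  "primitive_idempotent R e \<longleftrightarrow>
     idempotent_in R e \<and> e \<noteq> \<zero>\<^bsub>R\<^esub> \<and>
     (\<forall>f g. idempotent_in R f \<longrightarrow> idempotent_in R g \<longrightarrow>
        f \<otimes>\<^bsub>R\<^esub> g = \<zero>\<^bsub>R\<^esub> \<longrightarrow> g \<otimes>\<^bsub>R\<^esub> f = \<zero>\<^bsub>R\<^esub> \<longrightarrow> e = f \<oplus>\<^bsub>R\<^esub> g \<longrightarrow>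
        f = \<zero>\<^bsub>R\<^esub> \<or> g = \<zero>\<^bsub>R\<^esub>)"

definition complete_orthogonal_primitive_idempotents ::
    "('a, 'b) ring_scheme \<Rightarrow> 'i set \<Rightarrow> ('i \<Rightarrow> 'a) \<Rightarrow> bool" where
  "complete_orthogonal_primitive_idempotents R I e \<longleftrightarrow>
     finite I \<and>
     (\<forall>i\<in>I. primitive_idempotent R (e i)) \<and>
     (\<forall>i\<in>I. \<forall>j\<in>I. i \<noteq> j \<longrightarrow> e i \<otimes>\<^bsub>R\<^esub> e j = \<zero>\<^bsub>R\<^esub>) \<and>
     (\<Oplus>\<^bsub>R\<^esub>i\<in>I. e i) = \<one>\<^bsub>R\<^esub>"

section \<open>The algebra on \<open>K[\<X>] \<otimes> H(m,1,n)\<close>\<close>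

text \<open>The words in the standard tableaux are a basis of \<open>K[\<X>]\<close>, so \<open>K[\<X>] \<otimes> H(m,1,n)\<close> is the
  direct sum of copies of \<open>H(m,1,n)\<close> indexed by these words; \<open>x \<otimes> \<phi>\<close> is the family whose
  component at \<open>w\<close> is the coefficient of \<open>w\<close> in \<open>x\<close> times \<open>\<phi>\<close>.\<close>

definition tensor_space ::
    "nat \<Rightarrow> nat \<Rightarrow> 'k::field \<Rightarrow> (nat \<Rightarrow> 'k) \<Rightarrow>
     (mtableau fword \<Rightarrow> (hgen fword \<Rightarrow>\<^sub>0 'k) set) set" where
  "tensor_space m n q v = {f.
     (\<forall>w. f w \<in> carrier (hecke m n q v)) \<and>
     finite {w. f w \<noteq> \<zero>\<^bsub>hecke m n q v\<^esub>} \<and>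
     (\<forall>w. f w \<noteq> \<zero>\<^bsub>hecke m n q v\<^esub> \<longrightarrow> set (letters w) \<subseteq> standard_tableaux m n)}"

definition tens ::
    "nat \<Rightarrow> nat \<Rightarrow> 'k::field \<Rightarrow> (nat \<Rightarrow> 'k) \<Rightarrow> (mtableau fword \<Rightarrow>\<^sub>0 'k) \<Rightarrow>
     (hgen fword \<Rightarrow>\<^sub>0 'k) set \<Rightarrow> mtableau fword \<Rightarrow> (hgen fword \<Rightarrow>\<^sub>0 'k) set" where
  "tens m n q v x \<phi> =
     (\<lambda>w. hconst m n q v (Poly_Mapping.lookup x w) \<otimes>\<^bsub>hecke m n q v\<^esub> \<phi>)"

definition tensor_smult ::
    "nat \<Rightarrow> nat \<Rightarrow> 'k::field \<Rightarrow> (nat \<Rightarrow> 'k) \<Rightarrow> 'k \<Rightarrow>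
     (mtableau fword \<Rightarrow> (hgen fword \<Rightarrow>\<^sub>0 'k) set) \<Rightarrow>
     mtableau fword \<Rightarrow> (hgen fword \<Rightarrow>\<^sub>0 'k) set" where
  "tensor_smult m n q v c f = (\<lambda>w. hconst m n q v c \<otimes>\<^bsub>hecke m n q v\<^esub> f w)"

text \<open>\<open>\<X>\<^sup>s\<close> is the generator of the tableau with \<open>i\<close> and \<open>i + 1\<close> exchanged, or 0 if this
  tableau is not standard.\<close>

definition swapped_gen :: "nat \<Rightarrow> nat \<Rightarrow> nat \<Rightarrow> mtableau \<Rightarrow> (mtableau fword \<Rightarrow>\<^sub>0 'k::field)" where
  "swapped_gen m n i X =
     (if swap_tableau i X \<in> standard_tableaux m n then fgen (swap_tableau i X) else 0)"

definition is_frakT ::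
    "nat \<Rightarrow> nat \<Rightarrow> 'k::field \<Rightarrow> (nat \<Rightarrow> 'k) \<Rightarrow>
     (mtableau fword \<Rightarrow> (hgen fword \<Rightarrow>\<^sub>0 'k) set) ring \<Rightarrow> bool" where
  "is_frakT m n q v T \<longleftrightarrow>
     (let H = hecke m n q v; tens = tens m n q v; sm = tensor_smult m n q v;
          \<kappa> = hconst m n q v; \<sigma> = hsigma m n q v; \<tau> = htau m n q v;
          KX = free_algebra (standard_tableaux m n) in
      ring T \<and>
      carrier T = tensor_space m n q v \<and>
      (\<forall>f\<in>carrier T. \<forall>g\<in>carrier T. f \<oplus>\<^bsub>T\<^esub> g = (\<lambda>w. f w \<oplus>\<^bsub>H\<^esub> g w)) \<and>
      (\<forall>c. \<forall>f\<in>carrier T. \<forall>g\<in>carrier T.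
         sm c f \<otimes>\<^bsub>T\<^esub> g = sm c (f \<otimes>\<^bsub>T\<^esub> g) \<and> f \<otimes>\<^bsub>T\<^esub> sm c g = sm c (f \<otimes>\<^bsub>T\<^esub> g)) \<and>
      (\<lambda>x. tens x \<one>\<^bsub>H\<^esub>) \<in> ring_hom KX T \<and>
      (\<lambda>\<phi>. tens 1 \<phi>) \<in> ring_hom H T \<and>
      (\<forall>x\<in>carrier KX. \<forall>\<phi>\<in>carrier H. tens x \<one>\<^bsub>H\<^esub> \<otimes>\<^bsub>T\<^esub> tens 1 \<phi> = tens x \<phi>) \<and>
      (\<forall>X\<in>standard_tableaux m n. \<forall>i\<in>{1..<n}.
         let c = content_at q v X i; c' = content_at q v X (i + 1) in
         tens 1 (\<sigma> i \<oplus>\<^bsub>H\<^esub> \<kappa> ((q - inverse q) * c' / (c - c'))) \<otimes>\<^bsub>T\<^esub> tens (fgen X) \<one>\<^bsub>H\<^esub> =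
         tens (swapped_gen m n i X) \<one>\<^bsub>H\<^esub> \<otimes>\<^bsub>T\<^esub>
           tens 1 (\<sigma> i \<oplus>\<^bsub>H\<^esub> \<kappa> ((q - inverse q) * c / (c' - c)))) \<and>
      (\<forall>X\<in>standard_tableaux m n.
         tens 1 (\<tau> \<ominus>\<^bsub>H\<^esub> \<kappa> (content_at q v X 1)) \<otimes>\<^bsub>T\<^esub> tens (fgen X) \<one>\<^bsub>H\<^esub> = \<zero>\<^bsub>T\<^esub>))"

definition frakT_hom ::
    "nat \<Rightarrow> nat \<Rightarrow> 'k::field \<Rightarrow> (nat \<Rightarrow> 'k) \<Rightarrow>
     (mtableau fword \<Rightarrow> (hgen fword \<Rightarrow>\<^sub>0 'k) set) ring \<Rightarrow>
     ((mtableau fword \<Rightarrow> (hgen fword \<Rightarrow>\<^sub>0 'k) set) \<Rightarrow> (hgen fword \<Rightarrow>\<^sub>0 'k) set) \<Rightarrow> bool" where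
  "frakT_hom m n q v T \<rho> \<longleftrightarrow>
     \<rho> \<in> ring_hom T (hecke m n q v) \<and>
     (\<forall>c. \<forall>f\<in>carrier T.
        \<rho> (tensor_smult m n q v c f) = hconst m n q v c \<otimes>\<^bsub>hecke m n q v\<^esub> \<rho> f)"

end

theory Submission
  imports Defs "HOL-Computational_Algebra.Polynomial"
begin

text \<open>All computations take place in a ring with central scalars and elements \<open>\<tau>, \<sigma>\<^sub>i\<close> satisfying the
  Hecke relations. With \<open>x = J\<^sub>i\<close>, \<open>J = J\<^sub>i\<^sub>+\<^sub>1\<close>, \<open>p = q - q\<^sup>-\<^sup>1\<close>, the intertwiner
  \<open>\<Phi> = \<sigma>\<^sub>i (x - J) + p J\<close> exchanges \<open>x\<close> and \<open>J\<close>, and \<open>\<Phi>\<^sup>2\<close> is a polynomial in \<open>x\<close> and \<open>J\<close>. Hence, if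
  the eigenvalues of \<open>J\<^sub>i\<close> on \<open>E\<^sub>Y\<close> are the contents of the addable nodes, the next Jucys--Murphy element can
  only have these contents and \<open>q\<^sup>\<plusminus>\<^sup>2\<close> times the last content as eigenvalues; the superfluous ones are
  excluded by the diagonalizability of \<open>J\<^sub>i\<close> and by the braid relation. Lagrange interpolation then yields a
  complete orthogonal family of idempotents on which \<open>\<Phi>\<close> acts by exchanging \<open>i\<close> and \<open>i + 1\<close>; this is the
  relation needed for the homomorphism from the algebra \<open>\<TT>\<close>. The corner rings \<open>E\<^sub>X H E\<^sub>X\<close>
  consist of scalars by induction along the Mackey decomposition of \<open>H\<close>, and \<open>E\<^sub>X \<noteq> 0\<close> in the seminormal
  representation.\<close>

section \<open>Diagrams and standard tableaux\<close>

text \<open>The algebra is known only through its presentation; neither a basis nor a dimension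
  enters. The relations alone bound the spectra from above, in every ring where they hold, and the
  seminormal operators show that nothing collapses. Since the algebra might a priori be zero while
  \<open>ring_1\<close> forces 0 and 1 to differ, it is embedded in a product that is nonzero in any
  case. Spectra and idempotents have to grow together: the annihilating polynomial of
  \<open>J (k + 1)\<close> on \<open>E k Y\<close> is derived from eigenvalues, orthogonality and
  completeness at sizes up to \<open>k\<close>, and in turn yields these at size
  \<open>k + 1\<close>. On joint eigenvectors the square of the intertwiner vanishes exactly where
  consecutive contents have ratio \<open>q\<^sup>2\<close> or its inverse, and this is where the
  additional candidates for eigenvalues come from. Such a candidate is the content of the right or
  lower neighbour of the last node \<alpha>. If that neighbour is not addable, it is blocked by a
  corner \<rho> next to \<alpha>, and the candidate is the content of \<rho>. Reordering the tableau
  so that \<rho> comes just before \<alpha> produces the contents of \<rho>, \<alpha>, \<rho> in a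
  row, the pattern that the braid relation forbids.\<close>

definition is_diag :: "nat \<Rightarrow> mnode set \<Rightarrow> bool" where
  "is_diag m D \<longleftrightarrow> finite D \<and> (\<forall>k r s. (k, r, s) \<in> D \<longrightarrow> 1 \<le> k \<and> k \<le> m \<and> 1 \<le> r \<and> 1 \<le> s) \<and>
     (\<forall>k r s r' s'. (k, r, s) \<in> D \<longrightarrow> 1 \<le> r' \<longrightarrow> r' \<le> r \<longrightarrow> 1 \<le> s' \<longrightarrow> s' \<le> s \<longrightarrow> (k, r', s') \<in> D)"

lemma down_closed_eq_interval:
  fixes S :: "nat set"
  assumes "finite S" "0 \<notin> S" "\<And>s s'. s \<in> S \<Longrightarrow> 1 \<le> s' \<Longrightarrow> s' \<le> s \<Longrightarrow> s' \<in> S"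
  shows "S = {1..card S}"
proof (cases "S = {}")
  case False
  have "S = {1..Max S}"
  proof
    show "S \<subseteq> {1..Max S}"
    proof
      fix x assume "x \<in> S"
      then show "x \<in> {1..Max S}" using assms(1,2) by (cases x) auto
    qed
    show "{1..Max S} \<subseteq> S" using assms(3)[OF Max_in[OF assms(1) False]] by auto
  qed
  then show ?thesis by (metis card_atLeastAtMost diff_Suc_1 )
qed auto

lemma mnodes_eq_Sigma:
  "mnodes ps = Product_Type.Sigma {1..length ps} (\<lambda>k. Product_Type.Sigma {1..length (ps ! (k - 1))} (\<lambda>r. {1..ps ! (k - 1) ! (r - 1)}))"
  unfolding mnodes_def by auto

lemma sum_list_shift: "sum_list xs = (\<Sum>i\<in>{1..length xs}. xs ! (i - 1))" for xs :: "nat list"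
proof -
  have "(\<Sum>i\<in>{1..length xs}. xs ! (i - 1)) = (\<Sum>i\<in>{0..<length xs}. xs ! i)"
    by (rule sum.reindex_bij_witness[where i = Suc and j = "\<lambda>i. i - 1"]) auto
  then show ?thesis by (simp add: sum_list_sum_nth)
qed

lemma card_mnodes:
  assumes "is_mpartition m n ps"
  shows "card (mnodes ps) = n" "finite (mnodes ps)"
proof -
  have "card (mnodes ps) = (\<Sum>k\<in>{1..length ps}. \<Sum>r\<in>{1..length (ps ! (k - 1))}. ps ! (k - 1) ! (r - 1))"
    unfolding mnodes_eq_Sigma by (subst card_SigmaI) (auto simp: card_SigmaI)
  also have "\<dots> = sum_list (map sum_list ps)"
    unfolding sum_list_shift[of "map sum_list ps"] by (intro sum.cong) (auto simp: sum_list_shift)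
  finally show "card (mnodes ps) = n" using assms by (simp add: is_mpartition_def)
  show "finite (mnodes ps)" unfolding mnodes_eq_Sigma by auto
qed

lemma is_diag_mnodes:
  assumes "is_mpartition m n ps"
  shows "is_diag m (mnodes ps)"
  unfolding is_diag_def
proof (intro conjI allI impI)
  show "finite (mnodes ps)" using card_mnodes[OF assms] by simp
next
  fix k r s assume h: "(k, r, s) \<in> mnodes ps"
  show "1 \<le> k" "k \<le> m" "1 \<le> r" "1 \<le> s" using h assms by (auto simp: mnodes_def is_mpartition_def)
  fix r' s' assume h': "1 \<le> r'" "r' \<le> r" "1 \<le> s'" "s' \<le> s"
  have "ps ! (k - 1) \<in> set ps" using h by (auto simp: mnodes_def)
  then have "sorted_wrt (\<ge>) (ps ! (k - 1))" using assms by (auto simp: is_mpartition_def is_partition_def)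
  then have "ps ! (k - 1) ! (r - 1) \<le> ps ! (k - 1) ! (r' - 1)"
    using h h' by (cases "r = r'") (auto simp: mnodes_def sorted_wrt_iff_nth_less)
  then show "(k, r', s') \<in> mnodes ps" using h h' by (auto simp: mnodes_def)
qed

lemma diag_eq_mnodes:
  assumes D: "is_diag m D"
  shows "\<exists>ps. is_mpartition m (card D) ps \<and> D = mnodes ps"
proof -
  \<comment> \<open>Despite the names, \<open>col k r\<close> is the length of row \<open>r\<close>
    and \<open>row k\<close> the number of rows of the \<open>k\<close>-th diagram; both are read
    off as cardinalities because the sets concerned are initial intervals.\<close>
  define col where "col = (\<lambda>k r. card {s. (k, r, s) \<in> D})"
  define row where "row = (\<lambda>k. card {r. (k, r, 1) \<in> D})"
  define ps where "ps = map (\<lambda>k. map (col k) [1..<Suc (row k)]) [1..<Suc m]"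
  have fin: "finite D" using D by (simp add: is_diag_def)
  have finc: "finite {s. (k, r, s) \<in> D}" for k r
    by (rule finite_subset[of _ "(\<lambda>(k, r, s). s) ` D"]) (use fin in force)+
  have finr: "finite {r. (k, r, 1::nat) \<in> D}" for k
    by (rule finite_subset[of _ "(\<lambda>(k, r, s). r) ` D"]) (use fin in force)+
  have pos: "1 \<le> k \<and> k \<le> m \<and> 1 \<le> r \<and> 1 \<le> s" if "(k, r, s) \<in> D" for k r s
    using D that unfolding is_diag_def by blast
  have down: "(k, r', s') \<in> D" if "(k, r, s) \<in> D" "1 \<le> r'" "r' \<le> r" "1 \<le> s'" "s' \<le> s" for k r s r' s'
    using D that unfolding is_diag_def by blast
  have col: "{s. (k, r, s) \<in> D} = {1..col k r}" for k r
    unfolding col_def using pos[of k r 0] pos[of k r]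
    by (intro down_closed_eq_interval) (use finc in \<open>auto intro: down\<close>)
  have row: "{r. (k, r, 1) \<in> D} = {1..row k}" for k
    unfolding row_def using pos[of k 0 1] pos[of k _ 1]
    by (intro down_closed_eq_interval) (use finr in \<open>auto intro: down\<close>)
  have col': "(k, r, s) \<in> D \<longleftrightarrow> s \<in> {1..col k r}" for k r s using col[of k r] by blast
  have row': "(k, r, 1) \<in> D \<longleftrightarrow> r \<in> {1..row k}" for k r using row[of k] by blast
  have len: "length ps = m" by (simp add: ps_def)
  have nth: "ps ! (k - 1) = map (col k) [1..<Suc (row k)]" if "k \<in> {1..m}" for k
    using that unfolding ps_def by (subst nth_map) (auto simp del: upt_Suc)
  have nth2: "ps ! (k - 1) ! (r - 1) = col k r" if "k \<in> {1..m}" "r \<in> {1..row k}" for k r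
    using that unfolding nth[OF that(1)] by (subst nth_map) (auto simp del: upt_Suc)
  have D_eq: "D = mnodes ps"
  proof (intro Set.set_eqI iffI)
    fix a assume a: "a \<in> D"
    obtain k r s where krs: "a = (k, r, s)" by (cases a)
    have k: "k \<in> {1..m}" using pos a krs by auto
    have r: "r \<in> {1..row k}" using down[of k r s r 1] pos a krs row' by auto
    have "s \<in> {1..col k r}" using a krs col' by auto
    then show "a \<in> mnodes ps" using k r krs nth2[OF k r] nth[OF k] by (simp add: mnodes_def len del: upt_Suc)
  next
    fix a assume a: "a \<in> mnodes ps"
    obtain k r s where krs: "a = (k, r, s)" by (cases a)
    have k: "k \<in> {1..m}" using a krs by (auto simp: mnodes_def len)
    have r: "r \<in> {1..row k}" using a krs nth[OF k] by (auto simp: mnodes_def len simp del: upt_Suc)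
    have "s \<in> {1..col k r}" using a krs nth2[OF k r] by (auto simp: mnodes_def len)
    then show "a \<in> D" using krs col' by auto
  qed
  have part: "is_partition p" if p: "p \<in> set ps" for p
  proof -
    obtain k where k: "p = map (col k) [1..<Suc (row k)]" using p unfolding ps_def by auto
    have anti: "col k r' \<le> col k r" if "1 \<le> r" "r \<le> r'" for r r'
    proof -
      have "{s. (k, r', s) \<in> D} \<subseteq> {s. (k, r, s) \<in> D}" using down pos that by blast
      then show ?thesis unfolding col_def by (rule card_mono[OF finc])
    qed
    have "col k r \<noteq> 0" if "r \<in> {1..row k}" for r
      using row'[of k r] col'[of k r 1] that by auto
    then have "0 \<notin> set p" using k by force
    moreover have "sorted_wrt (\<ge>) p" unfolding k sorted_wrt_map sorted_wrt_iff_nth_less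
      by (auto simp del: upt_Suc intro!: anti)
    ultimately show ?thesis by (simp add: is_partition_def)
  qed
  have "is_mpartition m (sum_list (map sum_list ps)) ps" using part len by (simp add: is_mpartition_def)
  moreover from this have "card D = sum_list (map sum_list ps)" using card_mnodes(1) D_eq by simp
  ultimately show ?thesis using D_eq by auto
qed

text \<open>Together with \<open>standard_iff\<close> this replaces lists of partitions by finite
  down-closed sets, in which adding or removing one node is an operation on sets.\<close>

lemma is_mdiagram_iff: "is_mdiagram m D \<longleftrightarrow> is_diag m D"
  unfolding is_mdiagram_def using is_diag_mnodes diag_eq_mnodes by blast

text \<open>The bounds \<open>1 \<le> r\<close> and \<open>1 \<le> s\<close> keep down-closures
  among the genuine nodes; the relation is therefore reflexive only on nodes with positive
  coordinates.\<close>

definition nle :: "mnode \<Rightarrow> mnode \<Rightarrow> bool" where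
  "nle = (\<lambda>(k, r, s) (k', r', s'). k = k' \<and> 1 \<le> r \<and> r \<le> r' \<and> 1 \<le> s \<and> s \<le> s')"

lemma is_diag_alt: "is_diag m D \<longleftrightarrow> finite D \<and> D \<subseteq> {(k, r, s). 1 \<le> k \<and> k \<le> m \<and> 1 \<le> r \<and> 1 \<le> s} \<and>
    (\<forall>\<alpha>\<in>D. \<forall>\<beta>. nle \<beta> \<alpha> \<longrightarrow> \<beta> \<in> D)"
proof -
  have "(\<forall>\<alpha>\<in>D. \<forall>\<beta>. nle \<beta> \<alpha> \<longrightarrow> \<beta> \<in> D) \<longleftrightarrow> (\<forall>k r s r' s'. (k, r, s) \<in> D \<longrightarrow> 1 \<le> r' \<longrightarrow> r' \<le> r \<longrightarrow>
      1 \<le> s' \<longrightarrow> s' \<le> s \<longrightarrow> (k, r', s') \<in> D)"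
    unfolding Ball_def split_paired_All nle_def prod.case by metis
  moreover have "D \<subseteq> {(k, r, s). 1 \<le> k \<and> k \<le> m \<and> 1 \<le> r \<and> 1 \<le> s} \<longleftrightarrow>
      (\<forall>k r s. (k, r, s) \<in> D \<longrightarrow> 1 \<le> k \<and> k \<le> m \<and> 1 \<le> r \<and> 1 \<le> s)"
    by auto
  ultimately show ?thesis unfolding is_diag_def by simp
qed

text \<open>Comparable nodes are joined by a row step followed by a column step, and the
  intermediate node lies in the diagram by down-closure. The weak inequality on the right is enough
  because the filling is injective.\<close>

lemma standard_iff:
  "X \<in> standard_tableaux m n \<longleftrightarrow> is_diag m (shape X) \<and> bij_betw X (shape X) {1..n} \<and>
     (\<forall>\<alpha>\<in>shape X. \<forall>\<beta>\<in>shape X. nle \<alpha> \<beta> \<longrightarrow> X \<alpha> \<le> X \<beta>)" (is "?L = ?R")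
proof
  assume L: ?L
  then obtain ps where ps: "is_mpartition m n ps" "shape X = mnodes ps" by (auto simp: standard_tableaux_def)
  have d: "is_diag m (shape X)" using is_diag_mnodes ps by simp
  have "X \<alpha> \<le> X \<beta>" if h: "\<alpha> \<in> shape X" "\<beta> \<in> shape X" "nle \<alpha> \<beta>" for \<alpha> \<beta>
  proof -
    obtain k r s r' s' where ab: "\<alpha> = (k, r, s)" "\<beta> = (k, r', s')" "1 \<le> r" "1 \<le> s" "r \<le> r'" "s \<le> s'"
      using h(3) unfolding nle_def by (cases \<alpha>, cases \<beta>) auto
    have m: "(k, r, s') \<in> shape X" using d h ab unfolding is_diag_def by (meson order_refl order_trans)
    have "X (k, r, s) \<le> X (k, r, s')" using L m h ab
      by (cases "s = s'") (auto simp: standard_tableaux_def intro: less_imp_le)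
    also have "\<dots> \<le> X (k, r', s')" using L m h ab
      by (cases "r = r'") (auto simp: standard_tableaux_def intro: less_imp_le)
    finally show ?thesis using ab by simp
  qed
  then show ?R using d L by (auto simp: standard_tableaux_def)
next
  assume R: ?R
  have c: "card (shape X) = n" using R bij_betw_same_card by fastforce
  have inj: "inj_on X (shape X)" using R by (auto simp: bij_betw_def)
  have lt: "X \<alpha> < X \<beta>" if "\<alpha> \<in> shape X" "\<beta> \<in> shape X" "nle \<alpha> \<beta>" "\<alpha> \<noteq> \<beta>" for \<alpha> \<beta>
    using R inj that by (meson inj_onD le_neq_implies_less)
  have pos: "1 \<le> r \<and> 1 \<le> s" if "(k, r, s) \<in> shape X" for k r s
    using R that unfolding is_diag_def by blast
  show ?L unfolding standard_tableaux_def mem_Collect_eq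
  proof (intro conjI allI impI)
    show "\<exists>ps. is_mpartition m n ps \<and> shape X = mnodes ps" using diag_eq_mnodes R c by blast
    show "bij_betw X (shape X) {1..n}" using R by simp
  next
    fix k r s s' assume h: "(k, r, s) \<in> shape X" "(k, r, s') \<in> shape X" "s < s'"
    then show "X (k, r, s) < X (k, r, s')" using pos[OF h(1)] by (intro lt) (auto simp: nle_def)
  next
    fix k r r' s assume h: "(k, r, s) \<in> shape X" "(k, r', s) \<in> shape X" "r < r'"
    then show "X (k, r, s) < X (k, r', s)" using pos[OF h(1)] by (intro lt) (auto simp: nle_def)
  qed
qed

declare split_paired_All [simp del] split_paired_Ex [simp del]

definition vnode :: "nat \<Rightarrow> mnode \<Rightarrow> bool" where
  "vnode m = (\<lambda>(k, r, s). 1 \<le> k \<and> k \<le> m \<and> 1 \<le> r \<and> 1 \<le> s)"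

lemma is_diag_vnode: "is_diag m D \<longleftrightarrow> finite D \<and> (\<forall>\<alpha>\<in>D. vnode m \<alpha>) \<and> (\<forall>\<alpha>\<in>D. \<forall>\<beta>. nle \<beta> \<alpha> \<longrightarrow> \<beta> \<in> D)"
  unfolding is_diag_alt vnode_def by auto

section \<open>Addable nodes before and after the insertion of a node\<close>

definition rt :: "mnode \<Rightarrow> mnode" where "rt = (\<lambda>(k, r, s). (k, r, Suc s))"
definition dn :: "mnode \<Rightarrow> mnode" where "dn = (\<lambda>(k, r, s). (k, Suc r, s))"

lemma is_diag_finite: "is_diag m D \<Longrightarrow> finite D" by (simp add: is_diag_def)

lemma is_diag_down: "is_diag m D \<Longrightarrow> \<alpha> \<in> D \<Longrightarrow> nle \<beta> \<alpha> \<Longrightarrow> \<beta> \<in> D"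
  by (auto simp: is_diag_alt)

lemma addable_iff:
  assumes "is_diag m D"
  shows "\<alpha> \<in> addable m D \<longleftrightarrow> \<alpha> \<notin> D \<and> vnode m \<alpha> \<and>
     (\<forall>\<beta>. nle \<beta> \<alpha> \<longrightarrow> \<beta> \<noteq> \<alpha> \<longrightarrow> \<beta> \<in> D)"
  using assms unfolding addable_def is_mdiagram_iff is_diag_vnode by auto

lemma addable_diag: "\<alpha> \<in> addable m D \<Longrightarrow> is_diag m (insert \<alpha> D)"
  by (simp add: addable_def is_mdiagram_iff)

lemma addable_notin: "\<alpha> \<in> addable m D \<Longrightarrow> \<alpha> \<notin> D"
  by (simp add: addable_def)

lemma addable_below: "is_diag m D \<Longrightarrow> \<alpha> \<in> addable m D \<Longrightarrow> nle \<beta> \<alpha> \<Longrightarrow> \<beta> \<noteq> \<alpha> \<Longrightarrow> \<beta> \<in> D"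
  using addable_iff by blast

lemma nle_refl_addable: "is_diag m D \<Longrightarrow> \<alpha> \<in> addable m D \<Longrightarrow> nle \<alpha> \<alpha>"
  using addable_iff[of m D \<alpha>] by (auto simp: nle_def vnode_def)

lemma addable_commute:
  assumes "is_diag m D" "\<alpha> \<in> addable m D" "\<beta> \<in> addable m D" "\<alpha> \<noteq> \<beta>"
  shows "\<beta> \<in> addable m (insert \<alpha> D)"
  using assms addable_iff[OF assms(1)] addable_iff[OF addable_diag[OF assms(2)]] by auto

text \<open>A new addable node \<gamma> must lie above \<alpha>. A node strictly between them would
  belong to \<open>D\<close>, and then so would \<alpha> by down-closure; hence \<gamma> covers
  \<alpha>.\<close>

lemma addable_insert_cases:
  assumes D: "is_diag m D" and a: "\<alpha> \<in> addable m D" and g: "\<gamma> \<in> addable m (insert \<alpha> D)"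
  shows "\<gamma> \<in> addable m D \<or> \<gamma> = rt \<alpha> \<or> \<gamma> = dn \<alpha>"
proof (cases "nle \<alpha> \<gamma>")
  case False
  then show ?thesis using g addable_iff[OF D] addable_iff[OF addable_diag[OF a]] by auto
next
  case True
  have aD: "\<alpha> \<notin> D" using a by (rule addable_notin)
  have ne: "\<gamma> \<noteq> \<alpha>" using addable_notin[OF g] by auto
  obtain k r s r' s' where e: "\<alpha> = (k, r, s)" "\<gamma> = (k, r', s')" "1 \<le> r" "r \<le> r'" "1 \<le> s" "s \<le> s'"
    using True by (cases \<alpha>, cases \<gamma>) (auto simp: nle_def)
  have key: "\<beta> = \<alpha> \<or> \<beta> = \<gamma>" if "nle \<alpha> \<beta>" "nle \<beta> \<gamma>" for \<beta>
    using that addable_below[OF addable_diag[OF a] g] is_diag_down[OF D] aD by blast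
  have "s' > s \<Longrightarrow> rt \<alpha> = \<gamma>" using key[of "rt \<alpha>"] e by (auto simp: rt_def nle_def)
  moreover have "r' > r \<Longrightarrow> dn \<alpha> = \<gamma>" using key[of "dn \<alpha>"] e by (auto simp: dn_def nle_def)
  ultimately show ?thesis using ne e by fastforce
qed

lemma rt_dn_not_addable:
  assumes "is_diag m D" "\<alpha> \<in> addable m D"
  shows "rt \<alpha> \<notin> addable m D" "dn \<alpha> \<notin> addable m D"
  using addable_below[OF assms(1), of "rt \<alpha>" \<alpha>] addable_below[OF assms(1), of "dn \<alpha>" \<alpha>]
    addable_notin[OF assms(2)] nle_refl_addable[OF assms]
  by (cases \<alpha>; force simp: rt_def dn_def nle_def)+

text \<open>Since \<rho> is maximal in \<open>D\<close> it can be removed, and \<alpha> depends on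
  it.\<close>

lemma not_addable_removable:
  assumes D: "is_diag m D" and a: "\<alpha> \<in> addable m D"
    and \<rho>: "\<rho> \<in> D" "nle \<rho> \<alpha>" "\<And>\<beta>. \<beta> \<in> D \<Longrightarrow> nle \<rho> \<beta> \<Longrightarrow> \<beta> = \<rho>"
  shows "\<exists>D'. is_diag m D' \<and> \<rho> \<in> addable m D' \<and> D = insert \<rho> D' \<and> \<alpha> \<notin> addable m D'"
proof (intro exI conjI)
  show d': "is_diag m (D - {\<rho>})" using D \<rho>(3) unfolding is_diag_alt by blast
  show "\<rho> \<in> addable m (D - {\<rho>})" using D \<rho>(1) by (simp add: addable_def is_mdiagram_iff insert_absorb)
  show "D = insert \<rho> (D - {\<rho>})" using \<rho>(1) by auto
  show "\<alpha> \<notin> addable m (D - {\<rho>})"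
    using addable_below[OF d' _ \<rho>(2)] addable_notin[OF a] \<rho>(1) by blast
qed

text \<open>The right neighbour is blocked only if the row above ends in the column of \<alpha>. The
  node \<rho> directly above \<alpha> is then a corner of \<open>D\<close>, and its content equals
  that of \<open>rt \<alpha>\<close>; this is what makes the corresponding eigenvalue
  excludable.\<close>

lemma rt_not_addable:
  assumes D: "is_diag m D" and a: "\<alpha> \<in> addable m D" and n: "rt \<alpha> \<notin> addable m (insert \<alpha> D)"
  shows "\<exists>\<rho> D'. is_diag m D' \<and> \<rho> \<in> addable m D' \<and> D = insert \<rho> D' \<and> \<alpha> = dn \<rho> \<and> \<alpha> \<notin> addable m D'"
proof -
  obtain k r s where e: "\<alpha> = (k, r, s)" by (cases \<alpha>)
  have c: "1 \<le> k" "k \<le> m" "1 \<le> r" "1 \<le> s" using a e addable_iff[OF D] by (auto simp: vnode_def)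
  have nD: "(k, r, Suc s) \<notin> D" using is_diag_down[OF D, of "(k, r, Suc s)" \<alpha>] addable_notin[OF a] e c
    by (auto simp: nle_def)
  obtain \<beta> where b: "nle \<beta> (k, r, Suc s)" "\<beta> \<noteq> (k, r, Suc s)" "\<beta> \<notin> insert \<alpha> D"
  proof -
    have "(k, r, Suc s) \<notin> addable m (insert \<alpha> D)" "vnode m (k, r, Suc s)" "(k, r, Suc s) \<notin> insert \<alpha> D"
      using n nD c unfolding e rt_def vnode_def by auto
    then show ?thesis using that unfolding addable_iff[OF addable_diag[OF a]] by blast
  qed
  obtain r' s' where b': "\<beta> = (k, r', s')" "1 \<le> r'" "r' \<le> r" "1 \<le> s'" "s' \<le> Suc s"
    using b by (cases \<beta>) (auto simp: nle_def)
  \<comment> \<open>A missing node in an earlier column would already prevent \<alpha> from being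
    addable, so the obstruction sits in the column to the right.\<close>
  have "s' = Suc s" using addable_below[OF D a, of \<beta>] b(3) b' e by (force simp: nle_def)
  then have r': "r' < r" "(k, r', Suc s) \<notin> D" using b b' by force+
  define \<rho> where "\<rho> = (k, r - 1, s)"
  have \<rho>D: "\<rho> \<in> D" using addable_below[OF D a, of \<rho>] r' b' e c unfolding \<rho>_def by (force simp: nle_def)
  have \<rho>a: "nle \<rho> \<alpha>" "\<alpha> = dn \<rho>" using r' b' e c unfolding \<rho>_def dn_def by (auto simp: nle_def)
  have "\<beta> = \<rho>" if h: "\<beta> \<in> D" "nle \<rho> \<beta>" for \<beta>
  proof -
    obtain r2 s2 where b2: "\<beta> = (k, r2, s2)" "r - 1 \<le> r2" "s \<le> s2" "1 \<le> r - 1"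
      using h(2) unfolding \<rho>_def by (cases \<beta>) (auto simp: nle_def)
    have "\<not> nle \<alpha> \<beta>" using is_diag_down[OF D h(1)] addable_notin[OF a] by blast
    then have "r2 = r - 1" using b2 e c by (auto simp: nle_def)
    moreover have "\<not> nle (k, r', Suc s) \<beta>" using is_diag_down[OF D h(1)] r' by blast
    then have "s2 = s" using b2 r' b' \<open>r2 = r - 1\<close> by (auto simp: nle_def)
    ultimately show ?thesis using b2 \<rho>_def by simp
  qed
  then show ?thesis using not_addable_removable[OF D a \<rho>D \<rho>a(1)] \<rho>a(2) by blast
qed

text \<open>The transposed situation: the corner \<rho> is the left neighbour of \<alpha>, and its
  content equals that of \<open>dn \<alpha>\<close>.\<close>

lemma dn_not_addable:
  assumes D: "is_diag m D" and a: "\<alpha> \<in> addable m D" and n: "dn \<alpha> \<notin> addable m (insert \<alpha> D)"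
  shows "\<exists>\<rho> D'. is_diag m D' \<and> \<rho> \<in> addable m D' \<and> D = insert \<rho> D' \<and> \<alpha> = rt \<rho> \<and> \<alpha> \<notin> addable m D'"
proof -
  obtain k r s where e: "\<alpha> = (k, r, s)" by (cases \<alpha>)
  have c: "1 \<le> k" "k \<le> m" "1 \<le> r" "1 \<le> s" using a e addable_iff[OF D] by (auto simp: vnode_def)
  have nD: "(k, Suc r, s) \<notin> D" using is_diag_down[OF D, of "(k, Suc r, s)" \<alpha>] addable_notin[OF a] e c
    by (auto simp: nle_def)
  obtain \<beta> where b: "nle \<beta> (k, Suc r, s)" "\<beta> \<noteq> (k, Suc r, s)" "\<beta> \<notin> insert \<alpha> D"
  proof -
    have "(k, Suc r, s) \<notin> addable m (insert \<alpha> D)" "vnode m (k, Suc r, s)" "(k, Suc r, s) \<notin> insert \<alpha> D"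
      using n nD c unfolding e dn_def vnode_def by auto
    then show ?thesis using that unfolding addable_iff[OF addable_diag[OF a]] by blast
  qed
  obtain r' s' where b': "\<beta> = (k, r', s')" "1 \<le> r'" "r' \<le> Suc r" "1 \<le> s'" "s' \<le> s"
    using b by (cases \<beta>) (auto simp: nle_def)
  have "r' = Suc r" using addable_below[OF D a, of \<beta>] b(3) b' e by (force simp: nle_def)
  then have s': "s' < s" "(k, Suc r, s') \<notin> D" using b b' by force+
  define \<rho> where "\<rho> = (k, r, s - 1)"
  have \<rho>D: "\<rho> \<in> D" using addable_below[OF D a, of \<rho>] s' b' e c unfolding \<rho>_def by (force simp: nle_def)
  have \<rho>a: "nle \<rho> \<alpha>" "\<alpha> = rt \<rho>" using s' b' e c unfolding \<rho>_def rt_def by (auto simp: nle_def)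
  have "\<beta> = \<rho>" if h: "\<beta> \<in> D" "nle \<rho> \<beta>" for \<beta>
  proof -
    obtain r2 s2 where b2: "\<beta> = (k, r2, s2)" "r \<le> r2" "s - 1 \<le> s2" "1 \<le> s - 1"
      using h(2) unfolding \<rho>_def by (cases \<beta>) (auto simp: nle_def)
    have "\<not> nle \<alpha> \<beta>" using is_diag_down[OF D h(1)] addable_notin[OF a] by blast
    then have "s2 = s - 1" using b2 e c by (auto simp: nle_def)
    moreover have "\<not> nle (k, Suc r, s') \<beta>" using is_diag_down[OF D h(1)] s' by blast
    then have "r2 = r" using b2 s' b' \<open>s2 = s - 1\<close> by (auto simp: nle_def)
    ultimately show ?thesis using b2 \<rho>_def by simp
  qed
  then show ?thesis using not_addable_removable[OF D a \<rho>D \<rho>a(1)] \<rho>a(2) by blast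
qed

lemma addable_insert_eq:
  assumes D: "is_diag m D" and a: "\<alpha> \<in> addable m D"
  shows "addable m (insert \<alpha> D) = (addable m D - {\<alpha>}) \<union> ({rt \<alpha>, dn \<alpha>} \<inter> addable m (insert \<alpha> D))"
  using addable_insert_cases[OF D a] addable_commute[OF D a] addable_notin[of _ m "insert \<alpha> D"] by blast

lemma finite_addable:
  assumes D: "is_diag m D"
  shows "finite (addable m D)"
proof (rule finite_subset)
  show "addable m D \<subseteq> (\<lambda>k. (k, 1, 1)) ` {1..m} \<union> rt ` D \<union> dn ` D"
  proof
    fix \<alpha> assume a: "\<alpha> \<in> addable m D"
    obtain k r s where e: "\<alpha> = (k, r, s)" by (cases \<alpha>)
    have c: "1 \<le> k" "k \<le> m" "1 \<le> r" "1 \<le> s" using a e addable_iff[OF D] by (auto simp: vnode_def)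
    consider "r = 1" "s = 1" | "r > 1" | "s > 1" using c by linarith
    then show "\<alpha> \<in> (\<lambda>k. (k, 1, 1)) ` {1..m} \<union> rt ` D \<union> dn ` D"
    proof cases
      case 1 then show ?thesis using e c by auto
    next
      case 2
      then have "(k, r - 1, s) \<in> D" using addable_below[OF D a, of "(k, r - 1, s)"] e c by (auto simp: nle_def)
      then have "dn (k, r - 1, s) \<in> dn ` D" by blast
      then show ?thesis using e 2 by (auto simp: dn_def)
    next
      case 3
      then have "(k, r, s - 1) \<in> D" using addable_below[OF D a, of "(k, r, s - 1)"] e c by (auto simp: nle_def)
      then have "rt (k, r, s - 1) \<in> rt ` D" by blast
      then show ?thesis using e 3 by (auto simp: rt_def)
    qed
  qed
  show "finite ((\<lambda>k. (k, 1::nat, 1::nat)) ` {1..m} \<union> rt ` D \<union> dn ` D)" using is_diag_finite[OF D] by auto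
qed

text \<open>The form of the parameter conditions shared by the numerical and the generic case. For
  \<open>n = 1\<close> only the addable nodes of the empty diagram occur, with contents
  \<open>v j\<close>, so powers of \<open>q\<close> are restricted only from \<open>n = 2\<close>
  on.\<close>

locale hecke_params =
  fixes m n :: nat and q :: "'k::field" and v :: "nat \<Rightarrow> 'k"
  assumes q0: "q \<noteq> 0"
    and q_pow: "\<And>j. 2 \<le> n \<Longrightarrow> 1 \<le> j \<Longrightarrow> j \<le> n \<Longrightarrow> q ^ (2 * j) \<noteq> 1"
    and v_ne: "\<And>i j k. j \<in> {1..m} \<Longrightarrow> k \<in> {1..m} \<Longrightarrow> j \<noteq> k \<Longrightarrow> \<bar>i\<bar> < int n \<Longrightarrow> q powi (2 * i) * v j \<noteq> v k"
    and v0: "\<And>j. j \<in> {1..m} \<Longrightarrow> v j \<noteq> 0"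
begin

section \<open>Contents of addable nodes\<close>

abbreviation "ct \<equiv> Defs.content q v"

lemma ct_rt: "ct (rt \<alpha>) = q\<^sup>2 * ct \<alpha>"
proof -
  obtain k r s where e: "\<alpha> = (k, r, s)" by (cases \<alpha>)
  have "2 * (int (Suc s) - int r) = 2 + 2 * (int s - int r)" by simp
  then have "q powi (2 * (int (Suc s) - int r)) = q powi 2 * q powi (2 * (int s - int r))"
    using q0 by (metis power_int_add)
  then show ?thesis unfolding e Defs.content_def rt_def by (simp add: ac_simps)
qed

lemma ct_dn: "q\<^sup>2 * ct (dn \<alpha>) = ct \<alpha>"
proof -
  obtain k r s where e: "\<alpha> = (k, r, s)" by (cases \<alpha>)
  have "2 * (int s - int r) = 2 + 2 * (int s - int (Suc r))" by simp
  then have "q powi (2 * (int s - int r)) = q powi 2 * q powi (2 * (int s - int (Suc r)))"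
    using q0 by (metis power_int_add)
  then show ?thesis unfolding e Defs.content_def dn_def by (simp add: ac_simps)
qed

lemma addable_valid: "is_diag m D \<Longrightarrow> (k, r, s) \<in> addable m D \<Longrightarrow> k \<in> {1..m} \<and> 1 \<le> r \<and> 1 \<le> s"
  using addable_iff[of m D "(k, r, s)"] by (auto simp: vnode_def)

lemma ct_nz: "is_diag m D \<Longrightarrow> \<alpha> \<in> addable m D \<Longrightarrow> ct \<alpha> \<noteq> 0"
  using addable_valid[of D "fst \<alpha>" "fst (snd \<alpha>)" "snd (snd \<alpha>)"] q0 v0 by (cases \<alpha>) (auto simp: Defs.content_def)

text \<open>Counts the nodes of a horizontal and a vertical strip, which meet in at most one node;
  the sizes bound the exponents of \<open>q\<close> in quotients of contents.\<close>

lemma card_leg_arm: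
  fixes k :: nat
  shows "card ((\<lambda>t. (k, r, t)) ` {a..<b} \<union> (\<lambda>u. (k, u, s)) ` {c..<d} :: mnode set) \<ge> (b - a) + (d - c) - 1"
    and "r \<notin> {c..<d} \<Longrightarrow>
         card ((\<lambda>t. (k, r, t)) ` {a..<b} \<union> (\<lambda>u. (k, u, s)) ` {c..<d} :: mnode set) = (b - a) + (d - c)"
proof -
  let ?A = "(\<lambda>t. (k, r, t)) ` {a..<b} :: mnode set" and ?B = "(\<lambda>u. (k, u, s)) ` {c..<d} :: mnode set"
  have A: "card ?A = b - a" and B: "card ?B = d - c" by (subst card_image; auto simp: inj_on_def)+
  have "?A \<inter> ?B \<subseteq> {(k, r, s)}" by auto
  then have "card (?A \<inter> ?B) \<le> 1" by (metis card.empty card_insert_disjoint card_mono empty_iff finite.emptyI finite_insert One_nat_def)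
  then show "card (?A \<union> ?B) \<ge> (b - a) + (d - c) - 1" using A B card_Un_Int[of ?A ?B] by auto
  show "card (?A \<union> ?B) = (b - a) + (d - c)" if "r \<notin> {c..<d}"
    using that A B by (subst card_Un_disjoint) auto
qed

text \<open>Two addable nodes of one diagram span a hook inside \<open>D\<close> with corner
  \<open>(k, r', s)\<close>. It has one node less than the exponent \<open>j\<close> for which the
  contents differ by \<open>q ^ (2 * j)\<close>, so \<open>j \<le> n\<close>; this is why
  \<open>q_pow\<close> reaches up to \<open>n\<close>.\<close>

lemma ct_inj_aux:
  assumes D: "is_diag m D" "card D < n" and a: "(k, r, s) \<in> addable m D" and b: "(k, r', s') \<in> addable m D"
    and lt: "r' < r"
  shows "ct (k, r, s) \<noteq> ct (k, r', s')"
proof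
  assume eq: "ct (k, r, s) = ct (k, r', s')"
  have va: "k \<in> {1..m}" "1 \<le> r" "1 \<le> s" and vb: "1 \<le> r'" "1 \<le> s'"
    using addable_valid[OF D(1) a] addable_valid[OF D(1) b] by auto
  have ss: "s < s'"
  proof (rule ccontr)
    assume "\<not> s < s'"
    then have "nle (k, r', s') (k, r, s)" using lt vb by (auto simp: nle_def)
    then show False using addable_below[OF D(1) a] addable_notin[OF b] lt by blast
  qed
  have "(\<lambda>t. (k, r', t)) ` {s..<s'} \<union> (\<lambda>u. (k, u, s)) ` {r'..<r} \<subseteq> D"
    using addable_below[OF D(1) a] addable_below[OF D(1) b] va vb lt ss by (auto simp: nle_def)
  then have "(s' - s) + (r - r') - 1 \<le> card D"
    using card_leg_arm(1)[where k = k and r = r' and a = s and b = s' and s = s and c = r' and d = r]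
      card_mono[OF is_diag_finite[OF D(1)]] by (meson le_trans)
  then have jn: "(s' - s) + (r - r') \<le> n" using D(2) by linarith
  let ?j = "(s' - s) + (r - r')"
  have "q powi (2 * (int s - int r)) = q powi (2 * (int s' - int r'))"
    using eq v0[OF va(1)] by (simp add: Defs.content_def)
  also have "2 * (int s' - int r') = 2 * (int s - int r) + int (2 * ?j)" using ss lt by simp
  also have "q powi \<dots> = q powi (2 * (int s - int r)) * q powi int (2 * ?j)"
    using q0 by (intro power_int_add) auto
  finally have "q powi int (2 * ?j) = 1" using q0 by simp
  then have "q ^ (2 * ?j) = 1" by (simp only: power_int_of_nat)
  then show False using q_pow[of ?j] jn ss lt by linarith
qed

text \<open>Within one diagram the hook argument applies. For different diagrams the nodes to the
  left of and above each of the two addable nodes are disjoint parts of \<open>D\<close>, and their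
  number bounds the difference of the exponents below \<open>n\<close>, the range covered by
  \<open>v_ne\<close>.\<close>

lemma ct_inj:
  assumes D: "is_diag m D" "card D < n"
  shows "inj_on ct (addable m D)"
proof (rule inj_onI, rule ccontr)
  fix \<alpha> \<beta> assume a: "\<alpha> \<in> addable m D" and b: "\<beta> \<in> addable m D" and eq: "ct \<alpha> = ct \<beta>" and ne: "\<alpha> \<noteq> \<beta>"
  obtain k r s where ea: "\<alpha> = (k, r, s)" by (cases \<alpha>)
  obtain k' r' s' where eb: "\<beta> = (k', r', s')" by (cases \<beta>)
  have va: "k \<in> {1..m}" "1 \<le> r" "1 \<le> s" using addable_valid[OF D(1)] a ea by auto
  have vb: "k' \<in> {1..m}" "1 \<le> r'" "1 \<le> s'" using addable_valid[OF D(1)] b eb by auto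
  show False
  proof (cases "k = k'")
    case True
    have "r \<noteq> r'"
    proof
      assume "r = r'"
      then have "nle \<alpha> \<beta> \<or> nle \<beta> \<alpha>" using ea eb True va vb by (auto simp: nle_def)
      then show False using addable_below[OF D(1)] addable_notin a b ne by metis
    qed
    then consider "r' < r" | "r < r'" by linarith
    then show False
      using ct_inj_aux[OF D, of k r s r' s'] ct_inj_aux[OF D, of k r' s' r s] a b ea eb True eq by cases auto
  next
    case False
    let ?A = "(\<lambda>t. (k, r, t)) ` {1..<s} \<union> (\<lambda>u. (k, u, s)) ` {1..<r} :: mnode set"
    let ?B = "(\<lambda>t. (k', r', t)) ` {1..<s'} \<union> (\<lambda>u. (k', u, s')) ` {1..<r'} :: mnode set"
    have "?A \<subseteq> D" "?B \<subseteq> D" 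
      using addable_below[OF D(1) a] addable_below[OF D(1) b] va vb ea eb by (auto simp: nle_def)
    then have "card (?A \<union> ?B) \<le> card D" using card_mono[OF is_diag_finite[OF D(1)]] by (metis Un_least)
    moreover have "card (?A \<union> ?B) = card ?A + card ?B" using False by (intro card_Un_disjoint) auto
    moreover have "card ?A = (s - 1) + (r - 1)" "card ?B = (s' - 1) + (r' - 1)" 
      by (rule card_leg_arm(2); auto)+
    ultimately have bnd: "(s - 1) + (r - 1) + ((s' - 1) + (r' - 1)) < n" using D(2) by linarith
    define i where "i = (int s - int r) - (int s' - int r')"
    have i: "\<bar>i\<bar> < int n" using bnd va vb unfolding i_def by linarith
    have e: "2 * (int s - int r) = 2 * i + 2 * (int s' - int r')" by (simp add: i_def)
    have "v k * (q powi (2 * i) * q powi (2 * (int s' - int r'))) = v k' * q powi (2 * (int s' - int r'))"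
      using eq unfolding ea eb Defs.content_def prod.case e using q0 by (subst (asm) power_int_add) auto
    then have "q powi (2 * i) * v k = v k'" using q0 by (simp add: ac_simps)
    then show False using v_ne[OF va(1) vb(1) False i] by simp
  qed
qed

text \<open>Keeps the denominators \<open>c - c'\<close> in the relations for consecutive entries
  nonzero: the two nodes are either both addable to \<open>D\<close>, hence of different content, or
  neighbours, whose contents differ by the factor \<open>q\<^sup>2\<close>.\<close>

lemma ct_next_ne:
  assumes D: "is_diag m D" "card D + 1 < n" and a: "\<alpha> \<in> addable m D" and g: "\<gamma> \<in> addable m (insert \<alpha> D)"
  shows "ct \<gamma> \<noteq> ct \<alpha>"
proof -
  have n2: "2 \<le> n" "card D < n" using D(2) by linarith+
  have q2: "q\<^sup>2 \<noteq> 1" using q_pow[of 1] n2 by auto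
  have c0: "ct \<alpha> \<noteq> 0" using ct_nz[OF D(1) a] .
  have g0: "ct \<gamma> \<noteq> 0" using ct_nz[OF addable_diag[OF a] g] .
  from addable_insert_cases[OF D(1) a g] show ?thesis
  proof (elim disjE)
    assume g': "\<gamma> \<in> addable m D"
    have "\<gamma> \<noteq> \<alpha>" using addable_notin[OF g] by auto
    then show ?thesis using ct_inj[OF D(1) n2(2)] g' a by (meson inj_onD)
  next
    assume "\<gamma> = rt \<alpha>" then show ?thesis using ct_rt[of \<alpha>] q2 c0 by auto
  next
    assume "\<gamma> = dn \<alpha>" then show ?thesis using ct_dn[of \<alpha>] q2 g0 by auto
  qed
qed

lemma card_insert_addable: "is_diag m D \<Longrightarrow> \<alpha> \<in> addable m D \<Longrightarrow> card (insert \<alpha> D) = card D + 1"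
  using addable_notin is_diag_finite by auto

text \<open>The value \<open>q\<^sup>2 * ct \<alpha>\<close> is the content of
  \<open>rt \<alpha>\<close>. If that node becomes addable after \<alpha>, contents of addable nodes
  of the larger diagram separate it from \<beta>; otherwise it is the content of the corner above
  \<alpha>, which no node addable to \<open>D\<close> can repeat.\<close>

lemma ct_addables_not_q2:
  assumes D: "is_diag m D" "card D + 1 < n" and a: "\<alpha> \<in> addable m D" and b: "\<beta> \<in> addable m D"
  shows "ct \<beta> \<noteq> q\<^sup>2 * ct \<alpha>"
proof (cases "\<alpha> = \<beta>")
  case True
  then show ?thesis using q_pow[of 1] D(2) ct_nz[OF D(1) a] by auto
next
  case False
  have d1: "is_diag m (insert \<alpha> D)" "card (insert \<alpha> D) < n"
    using addable_diag[OF a] card_insert_addable[OF D(1) a] D(2) by auto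
  show ?thesis
  proof (cases "rt \<alpha> \<in> addable m (insert \<alpha> D)")
    case True
    have "\<beta> \<in> addable m (insert \<alpha> D)" "\<beta> \<noteq> rt \<alpha>"
      using addable_commute[OF D(1) a b False] rt_dn_not_addable[OF D(1) a] b by auto
    then show ?thesis using ct_inj[OF d1] True ct_rt[of \<alpha>] by (metis inj_onD)
  next
    case r: False
    from rt_not_addable[OF D(1) a r] obtain \<rho> D' where
      r: "is_diag m D'" "\<rho> \<in> addable m D'" "D = insert \<rho> D'" "\<alpha> = dn \<rho>" by blast
    have "card D' + 1 < n" using card_insert_addable[OF r(1,2)] r(3) D(2) by auto
    then have "ct \<beta> \<noteq> ct \<rho>" using ct_next_ne[OF r(1) _ r(2)] b r(3) by auto
    then show ?thesis using ct_dn[of \<rho>] r(4) by simp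
  qed
qed

text \<open>Forbids both exchanges in a content sequence \<rho>, \<alpha>, \<rho>: the content of
  \<rho> cannot directly follow \<rho>, and the content of \<alpha> cannot occur before \<rho> has
  been added.\<close>

lemma removable_contents:
  assumes D': "is_diag m D'" "card D' + 2 < n" and r: "\<rho> \<in> addable m D'" and a: "\<alpha> \<in> addable m (insert \<rho> D')"
    and na: "\<alpha> \<notin> addable m D'"
  shows "\<beta> \<in> addable m (insert \<rho> D') \<Longrightarrow> ct \<beta> \<noteq> ct \<rho>" "\<beta> \<in> addable m D' \<Longrightarrow> ct \<beta> \<noteq> ct \<alpha>"
proof -
  have d: "card D' + 1 < n" using D'(2) by simp
  show "\<beta> \<in> addable m (insert \<rho> D') \<Longrightarrow> ct \<beta> \<noteq> ct \<rho>" using ct_next_ne[OF D'(1) d r] .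
  assume b: "\<beta> \<in> addable m D'"
  show "ct \<beta> \<noteq> ct \<alpha>"
  proof
    assume eq: "ct \<beta> = ct \<alpha>"
    then have "\<beta> \<noteq> \<rho>" using ct_next_ne[OF D'(1) d r a] by auto
    then have "\<beta> \<in> addable m (insert \<rho> D')" using addable_commute[OF D'(1) r b] by auto
    moreover have "card (insert \<rho> D') < n" using card_insert_addable[OF D'(1) r] d by simp
    ultimately have "\<beta> = \<alpha>" using ct_inj[OF addable_diag[OF r]] a eq by (meson inj_onD)
    then show False using b na by simp
  qed
qed

end

section \<open>Standard tableaux as growing chains of diagrams\<close>

definition pre :: "mtableau \<Rightarrow> nat \<Rightarrow> mnode set" where
  "pre X k = {\<alpha>. 0 < X \<alpha> \<and> X \<alpha> \<le> k}"

lemma pre_0 [simp]: "pre X 0 = {}" by (auto simp: pre_def)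

lemma std_bij: "X \<in> standard_tableaux m n \<Longrightarrow> bij_betw X (shape X) {1..n}"
  by (simp add: standard_iff)

lemma std_le: "X \<in> standard_tableaux m n \<Longrightarrow> X \<alpha> \<le> n"
  using std_bij[of X m n] by (cases "X \<alpha> = 0") (auto simp: shape_def bij_betw_def)

lemma pre_n: "X \<in> standard_tableaux m n \<Longrightarrow> pre X n = shape X"
  using std_le[of X m n] by (auto simp: pre_def shape_def)

lemma std_ex1:
  assumes "X \<in> standard_tableaux m n" "i \<in> {1..n}"
  shows "\<exists>!\<alpha>. X \<alpha> = i"
proof -
  have b: "inj_on X (shape X)" "X ` shape X = {1..n}" using std_bij[OF assms(1)] by (auto simp: bij_betw_def)
  obtain \<alpha> where a: "X \<alpha> = i" using b(2) assms(2) by (metis imageE)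
  have "\<beta> = \<alpha>" if "X \<beta> = i" for \<beta>
    using b(1) a that assms(2) unfolding inj_on_def shape_def by auto
  then show ?thesis using a by blast
qed

lemma node_of_val:
  assumes "X \<in> standard_tableaux m n" "i \<in> {1..n}"
  shows "X (node_of X i) = i"
  unfolding node_of_def using theI'[OF std_ex1[OF assms]] .

lemma node_of_eq:
  assumes "X \<in> standard_tableaux m n" "i \<in> {1..n}" "X \<alpha> = i"
  shows "node_of X i = \<alpha>"
  unfolding node_of_def using std_ex1[OF assms(1,2)] assms(3) by (auto intro: the1_equality)

lemma pre_diag:
  assumes "X \<in> standard_tableaux m n"
  shows "is_diag m (pre X k)"
proof -
  have X: "is_diag m (shape X)" "\<forall>\<alpha>\<in>shape X. \<forall>\<beta>\<in>shape X. nle \<alpha> \<beta> \<longrightarrow> X \<alpha> \<le> X \<beta>"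
    using assms by (auto simp: standard_iff)
  have s: "pre X k \<subseteq> shape X" by (auto simp: pre_def shape_def)
  show ?thesis unfolding is_diag_alt
  proof (intro conjI ballI allI impI)
    show "finite (pre X k)" using s X(1) is_diag_finite finite_subset by blast
    show "pre X k \<subseteq> {(k, r, s). 1 \<le> k \<and> k \<le> m \<and> 1 \<le> r \<and> 1 \<le> s}" using s X(1) unfolding is_diag_alt by blast
    fix \<alpha> \<beta> assume h: "\<alpha> \<in> pre X k" "nle \<beta> \<alpha>"
    then have b: "\<beta> \<in> shape X" using is_diag_down[OF X(1)] s by blast
    then have "X \<beta> \<le> X \<alpha>" using X(2) h s by blast
    then show "\<beta> \<in> pre X k" using h b by (auto simp: pre_def shape_def)
  qed
qed

lemma pre_Suc:
  assumes "X \<in> standard_tableaux m n" "k < n"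
  shows "pre X (Suc k) = insert (node_of X (Suc k)) (pre X k)"
proof -
  have "Suc k \<in> {1..n}" using assms by auto
  note v = node_of_val[OF assms(1) this] and e = node_of_eq[OF assms(1) this]
  have "\<beta> \<in> pre X (Suc k) \<longleftrightarrow> \<beta> \<in> insert (node_of X (Suc k)) (pre X k)" for \<beta>
    using v e[of \<beta>] by (cases "\<beta> = node_of X (Suc k)") (simp_all add: pre_def le_Suc_eq, metis)
  then show ?thesis by blast
qed

lemma node_of_addable:
  assumes "X \<in> standard_tableaux m n" "k < n"
  shows "node_of X (Suc k) \<in> addable m (pre X k)"
proof -
  have "Suc k \<in> {1..n}" using assms by auto
  then have "node_of X (Suc k) \<notin> pre X k" using node_of_val[OF assms(1)] by (auto simp: pre_def)
  then show ?thesis using pre_diag[OF assms(1), of "Suc k"] pre_Suc[OF assms]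
    by (simp add: addable_def is_mdiagram_iff)
qed

lemma node_of_addable':
  assumes "X \<in> standard_tableaux m n" "k \<in> {1..n}"
  shows "node_of X k \<in> addable m (pre X (k - 1))"
  using node_of_addable[OF assms(1), of "k - 1"] assms(2) by auto

lemma card_pre:
  assumes "X \<in> standard_tableaux m n" "k \<le> n"
  shows "card (pre X k) = k"
  using assms(2)
proof (induction k)
  case (Suc k)
  then show ?case
    using pre_Suc[OF assms(1), of k] addable_notin[OF node_of_addable[OF assms(1), of k]]
      is_diag_finite[OF pre_diag[OF assms(1), of k]] by simp
qed auto

lemma card_shape: "X \<in> standard_tableaux m n \<Longrightarrow> card (shape X) = n"
  using card_pre[of X m n n] pre_n by simp

lemma shape_diag: "X \<in> standard_tableaux m n \<Longrightarrow> is_diag m (shape X)"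
  by (simp add: standard_iff)

text \<open>Monotonicity follows from down-closure of the initial segments: a node below \<beta>
  lies in the segment \<open>pre X (X \<beta>)\<close>, so its entry is at most
  \<open>X \<beta>\<close>.\<close>

lemma std_from_pre:
  assumes b: "bij_betw X (shape X) {1..n}" and d: "\<And>k. k \<le> n \<Longrightarrow> is_diag m (pre X k)"
  shows "X \<in> standard_tableaux m n"
  unfolding standard_iff
proof (intro conjI ballI impI)
  have le: "\<And>\<alpha>. X \<alpha> \<le> n" using b by (metis (mono_tags, lifting) atLeastAtMost_iff bij_betwE le0 mem_Collect_eq shape_def)
  then have "shape X = pre X n" by (auto simp: shape_def pre_def)
  then show "is_diag m (shape X)" using d by simp
  show "bij_betw X (shape X) {1..n}" by fact
  fix \<alpha> \<beta> assume h: "\<alpha> \<in> shape X" "\<beta> \<in> shape X" "nle \<alpha> \<beta>"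
  have "\<beta> \<in> pre X (X \<beta>)" using h by (auto simp: shape_def pre_def)
  then have "\<alpha> \<in> pre X (X \<beta>)" using is_diag_down[OF d[OF le]] h(3) by blast
  then show "X \<alpha> \<le> X \<beta>" by (simp add: pre_def)
qed

lemma pre_remove: "j \<le> k \<Longrightarrow> pre (remove_entry (Suc k) X) j = pre X j"
  by (auto simp: pre_def remove_entry_def)

lemma std_remove:
  assumes "X \<in> standard_tableaux m (Suc k)"
  shows "remove_entry (Suc k) X \<in> standard_tableaux m k" "shape (remove_entry (Suc k) X) = pre X k"
proof -
  show sh: "shape (remove_entry (Suc k) X) = pre X k"
    using std_le[OF assms] by (auto simp: shape_def pre_def remove_entry_def le_Suc_eq)
  show "remove_entry (Suc k) X \<in> standard_tableaux m k"
  proof (rule std_from_pre)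
    have "inj_on X (pre X k)" using std_bij[OF assms]
      by (auto simp: bij_betw_def pre_def shape_def inj_on_def)
    moreover have "X ` pre X k = {1..k}"
    proof (intro Set.set_eqI iffI)
      fix i assume "i \<in> {1..k}"
      then show "i \<in> X ` pre X k" using node_of_val[OF assms, of i]
        by (intro image_eqI[of _ _ "node_of X i"]) (auto simp: pre_def)
    qed (auto simp: pre_def)
    ultimately have "bij_betw X (pre X k) {1..k}" by (simp add: bij_betw_def)
    then show "bij_betw (remove_entry (Suc k) X) (shape (remove_entry (Suc k) X)) {1..k}"
      unfolding sh by (rule bij_betw_cong[THEN iffD1, rotated]) (auto simp: remove_entry_def pre_def)
    show "is_diag m (pre (remove_entry (Suc k) X) j)" if "j \<le> k" for j
      using pre_remove[OF that] pre_diag[OF assms] by simp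
  qed
qed

lemma node_of_remove:
  assumes "X \<in> standard_tableaux m (Suc k)" "i \<in> {1..k}"
  shows "node_of (remove_entry (Suc k) X) i = node_of X i"
proof -
  have "i \<in> {1..Suc k}" using assms by auto
  from node_of_val[OF assms(1) this] show ?thesis
    using assms(2) by (intro node_of_eq[OF std_remove(1)[OF assms(1)]]) (auto simp: remove_entry_def)
qed

lemma remove_update: 
  assumes "X \<in> standard_tableaux m (Suc k)"
  shows "(remove_entry (Suc k) X)(node_of X (Suc k) := Suc k) = X"
proof
  fix \<beta> show "((remove_entry (Suc k) X)(node_of X (Suc k) := Suc k)) \<beta> = X \<beta>"
  proof (cases "X \<beta> = Suc k")
    case True
    then have "node_of X (Suc k) = \<beta>" by (intro node_of_eq[OF assms]) auto
    then show ?thesis using True by simp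
  next
    case False
    then have "node_of X (Suc k) \<noteq> \<beta>" using node_of_val[OF assms, of "Suc k"] by auto
    then show ?thesis using False by (simp add: remove_entry_def)
  qed
qed

lemma std_extend:
  assumes Y: "Y \<in> standard_tableaux m k" and a: "\<alpha> \<in> addable m (shape Y)"
  shows "Y(\<alpha> := Suc k) \<in> standard_tableaux m (Suc k)" "remove_entry (Suc k) (Y(\<alpha> := Suc k)) = Y"
    "node_of (Y(\<alpha> := Suc k)) (Suc k) = \<alpha>" "shape (Y(\<alpha> := Suc k)) = insert \<alpha> (shape Y)"
proof -
  let ?X = "Y(\<alpha> := Suc k)"
  have Ya: "Y \<alpha> = 0" using addable_notin[OF a] by (simp add: shape_def)
  have lt: "Y \<beta> < Suc k" for \<beta> using std_le[OF Y] by (simp add: less_Suc_eq_le)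
  then have ne: "Y \<beta> \<noteq> Suc k" for \<beta> by (metis less_irrefl)
  show sh: "shape ?X = insert \<alpha> (shape Y)" by (auto simp: shape_def)
  show X: "?X \<in> standard_tableaux m (Suc k)"
  proof (rule std_from_pre)
    have "bij_betw ?X (shape Y) {1..k}" 
      by (rule bij_betw_cong[THEN iffD1, OF _ std_bij[OF Y]]) (use addable_notin[OF a] in auto)
    then have "bij_betw ?X (insert \<alpha> (shape Y)) (insert (?X \<alpha>) {1..k})"
      using notIn_Un_bij_betw[of \<alpha> "shape Y" ?X "{1..k}"] addable_notin[OF a] by simp
    then show "bij_betw ?X (shape ?X) {1..Suc k}" unfolding sh by (simp add: atLeastAtMostSuc_conv)
    fix j assume j: "j \<le> Suc k"
    show "is_diag m (pre ?X j)"
    proof (cases "j = Suc k")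
      case True
      have "pre ?X j = insert \<alpha> (shape Y)" using True lt std_le[OF Y] by (auto simp: pre_def shape_def less_imp_le le_SucI)
      then show ?thesis using addable_diag[OF a] by simp
    next
      case False
      then have "pre ?X j = pre Y j" using j Ya by (auto simp: pre_def)
      then show ?thesis using pre_diag[OF Y] by simp
    qed
  qed
  show "remove_entry (Suc k) ?X = Y" using ne Ya by (auto simp: remove_entry_def fun_eq_iff)
  show "node_of ?X (Suc k) = \<alpha>" by (rule node_of_eq[OF X]) auto
qed

lemma std_0: "standard_tableaux m 0 = {\<lambda>_. 0}"
proof (intro Set.set_eqI iffI)
  fix X assume X: "X \<in> standard_tableaux m 0"
  show "X \<in> {\<lambda>_. 0}" using std_le[OF X] by auto
next
  fix X :: mtableau assume "X \<in> {\<lambda>_. 0}"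
  then have "shape X = {}" by (simp add: shape_def)
  then show "X \<in> standard_tableaux m 0" by (simp add: standard_iff bij_betw_def is_diag_def)
qed

lemma std_Suc: "standard_tableaux m (Suc k) = (\<lambda>(Y, \<alpha>). Y(\<alpha> := Suc k)) ` (SIGMA Y:standard_tableaux m k. addable m (shape Y))"
proof (intro Set.set_eqI iffI)
  fix X assume X: "X \<in> standard_tableaux m (Suc k)"
  show "X \<in> (\<lambda>(Y, \<alpha>). Y(\<alpha> := Suc k)) ` (SIGMA Y:standard_tableaux m k. addable m (shape Y))"
    using std_remove[OF X] remove_update[OF X] node_of_addable[OF X, of k]
    by (intro image_eqI[of _ _ "(remove_entry (Suc k) X, node_of X (Suc k))"]) auto
next
  fix X assume "X \<in> (\<lambda>(Y, \<alpha>). Y(\<alpha> := Suc k)) ` (SIGMA Y:standard_tableaux m k. addable m (shape Y))"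
  then obtain Y \<alpha> where "X = Y(\<alpha> := Suc k)" "Y \<in> standard_tableaux m k" "\<alpha> \<in> addable m (shape Y)"
    by (elim imageE SigmaE) simp
  then show "X \<in> standard_tableaux m (Suc k)" using std_extend(1) by blast
qed

lemma inj_on_extend: "inj_on (\<lambda>(Y, \<alpha>). Y(\<alpha> := Suc k)) (SIGMA Y:standard_tableaux m k. addable m (shape Y))"
proof (rule inj_onI)
  fix a b assume a: "a \<in> (SIGMA Y:standard_tableaux m k. addable m (shape Y))"
    and b: "b \<in> (SIGMA Y:standard_tableaux m k. addable m (shape Y))"
    and e: "(\<lambda>(Y, \<alpha>). Y(\<alpha> := Suc k)) a = (\<lambda>(Y, \<alpha>). Y(\<alpha> := Suc k)) b"
  obtain Y \<alpha> Z \<beta> where ab: "a = (Y, \<alpha>)" "b = (Z, \<beta>)" by (cases a, cases b)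
  have "Y \<in> standard_tableaux m k" "\<alpha> \<in> addable m (shape Y)" "Z \<in> standard_tableaux m k" "\<beta> \<in> addable m (shape Z)"
    "Y(\<alpha> := Suc k) = Z(\<beta> := Suc k)" using a b e ab by auto
  then show "a = b" using std_extend(2,3)[of Y m k \<alpha>] std_extend(2,3)[of Z m k \<beta>] ab by simp
qed

lemma finite_std: "finite (standard_tableaux m k)"
proof (induction k)
  case (Suc k)
  then show ?case unfolding std_Suc by (intro finite_imageI finite_SigmaI finite_addable shape_diag)
qed (simp add: std_0)

lemma std_eqI:
  assumes Z: "Z \<in> standard_tableaux m n" and W: "W \<in> standard_tableaux m n"
    and e: "\<And>j. j \<in> {1..n} \<Longrightarrow> node_of Z j = node_of W j"
  shows "Z = W"
proof
  fix \<alpha>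
  have *: "Z' \<alpha> = W' \<alpha>" if "Z' \<alpha> \<noteq> 0" "Z' \<in> standard_tableaux m n" "W' \<in> standard_tableaux m n"
    "\<And>j. j \<in> {1..n} \<Longrightarrow> node_of Z' j = node_of W' j" for Z' W'
  proof -
    have j: "Z' \<alpha> \<in> {1..n}" using that(1) std_le[OF that(2), of \<alpha>] by auto
    then have "node_of W' (Z' \<alpha>) = \<alpha>" using node_of_eq[OF that(2) j] that(4)[OF j] by simp
    then show ?thesis using node_of_val[OF that(3) j] by simp
  qed
  have "Z \<alpha> \<noteq> 0 \<Longrightarrow> Z \<alpha> = W \<alpha>" "W \<alpha> \<noteq> 0 \<Longrightarrow> W \<alpha> = Z \<alpha>"
    by (rule *[OF _ Z W e]; assumption) (rule *[OF _ W Z e[symmetric]]; assumption)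
  then show "Z \<alpha> = W \<alpha>" by fastforce
qed

lemma swap_swap [simp]: "swap_tableau i (swap_tableau i X) = X"
  by (simp add: swap_tableau_def)

lemma shape_swap: "1 \<le> i \<Longrightarrow> shape (swap_tableau i X) = shape X"
  by (auto simp: shape_def swap_tableau_def transpose_def)

lemma pre_swap: "1 \<le> i \<Longrightarrow> j \<noteq> i \<Longrightarrow> pre (swap_tableau i X) j = pre X j"
  by (auto simp: pre_def swap_tableau_def transpose_def)

lemma node_of_swap:
  assumes X: "X \<in> standard_tableaux m n" and i: "1 \<le> i" "i < n" and j: "j \<in> {1..n}"
  shows "node_of (swap_tableau i X) j = node_of X (transpose i (i + 1) j)"
  unfolding node_of_def
proof (rule arg_cong[where f = The], rule ext)
  fix \<alpha> show "(swap_tableau i X \<alpha> = j) = (X \<alpha> = transpose i (i + 1) j)"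
    unfolding swap_tableau_def by (metis transpose_involutory)
qed

text \<open>The exchange alters a single initial segment, the one of size \<open>i\<close>, which
  becomes \<open>pre X (i - 1)\<close> together with the node of \<open>i + 1\<close>.\<close>

lemma swap_std_iff:
  assumes X: "X \<in> standard_tableaux m n" and i: "1 \<le> i" "i < n"
  shows "swap_tableau i X \<in> standard_tableaux m n \<longleftrightarrow> node_of X (i + 1) \<in> addable m (pre X (i - 1))"
proof
  assume "swap_tableau i X \<in> standard_tableaux m n"
  from node_of_addable'[OF this, of i] show "node_of X (i + 1) \<in> addable m (pre X (i - 1))"
    using i node_of_swap[OF X i, of i] pre_swap[of i "i - 1" X] by auto
next
  assume a: "node_of X (i + 1) \<in> addable m (pre X (i - 1))"
  show "swap_tableau i X \<in> standard_tableaux m n"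
  proof (rule std_from_pre)
    have "bij_betw (transpose i (i + 1)) {1..n} {1..n}"
      using i by (intro bij_betwI[of _ _ _ "transpose i (i + 1)"]) (auto simp: transpose_def)
    from bij_betw_trans[OF std_bij[OF X] this]
    show "bij_betw (swap_tableau i X) (shape (swap_tableau i X)) {1..n}"
      unfolding shape_swap[OF i(1)] by (simp add: swap_tableau_def comp_def)
    fix k assume "k \<le> n"
    show "is_diag m (pre (swap_tableau i X) k)"
    proof (cases "k = i")
      case False
      then show ?thesis using pre_swap[OF i(1)] pre_diag[OF X] by simp
    next
      case True
      have "pre (swap_tableau i X) i = insert (node_of X (i + 1)) (pre X (i - 1))"
      proof (intro Set.set_eqI iffI)
        fix \<beta> assume "\<beta> \<in> pre (swap_tableau i X) i"
        then have "X \<beta> = i + 1 \<or> \<beta> \<in> pre X (i - 1)"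
          by (auto simp: pre_def swap_tableau_def transpose_def split: if_splits)
        then show "\<beta> \<in> insert (node_of X (i + 1)) (pre X (i - 1))"
          using node_of_eq[OF X, of "i + 1" \<beta>] i by auto
      next
        fix \<beta> assume "\<beta> \<in> insert (node_of X (i + 1)) (pre X (i - 1))"
        then show "\<beta> \<in> pre (swap_tableau i X) i" using node_of_val[OF X, of "i + 1"] i
          by (auto simp: pre_def swap_tableau_def transpose_def split: if_splits)
      qed
      then show ?thesis using addable_diag[OF a] True by simp
    qed
  qed
qed

context hecke_params
begin

section \<open>Content sequences\<close>

abbreviation "cat \<equiv> content_at q v"

text \<open>The tableau is rebuilt entry by entry, since the addable nodes of each initial segment
  have distinct contents. Joint eigenvalues of the Jucys-Murphy elements therefore separate
  tableaux.\<close>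

lemma std_eq_contents:
  assumes Z: "Z \<in> standard_tableaux m N" and W: "W \<in> standard_tableaux m N" and N: "N \<le> n"
    and e: "\<And>j. j \<in> {1..N} \<Longrightarrow> cat Z j = cat W j"
  shows "Z = W"
proof -
  have *: "pre Z j = pre W j \<and> (\<forall>i\<in>{1..j}. node_of Z i = node_of W i)" if "j \<le> N" for j
    using that
  proof (induction j)
    case (Suc j)
    then have j: "j < N" and IH: "pre Z j = pre W j" "\<And>i. i\<in>{1..j} \<Longrightarrow> node_of Z i = node_of W i" by auto
    have "inj_on ct (addable m (pre W j))"
      using ct_inj[OF pre_diag[OF W]] card_pre[OF W, of j] j N by simp
    moreover have "ct (node_of Z (Suc j)) = ct (node_of W (Suc j))" using e[of "Suc j"] j by (simp add: content_at_def)
    ultimately have "node_of Z (Suc j) = node_of W (Suc j)"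
      using node_of_addable[OF Z j] node_of_addable[OF W j] IH by (metis inj_onD)
    then show ?case using IH pre_Suc[OF Z j] pre_Suc[OF W j] by (auto simp: le_Suc_eq)
  qed auto
  show ?thesis using *[of N] by (intro std_eqI[OF Z W]) auto
qed

lemma cat_swap:
  assumes "X \<in> standard_tableaux m N" "1 \<le> i" "i < N" "j \<in> {1..N}"
  shows "cat (swap_tableau i X) j = cat X (transpose i (i + 1) j)"
  using node_of_swap[OF assms] by (simp add: content_at_def)

lemma two_nodes:
  assumes X: "X \<in> standard_tableaux m N" and i: "1 \<le> i" "i < N"
  shows "is_diag m (pre X (i - 1))" "card (pre X (i - 1)) + 1 < N" "node_of X i \<in> addable m (pre X (i - 1))"
    "node_of X (i + 1) \<in> addable m (insert (node_of X i) (pre X (i - 1)))"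
    "pre X i = insert (node_of X i) (pre X (i - 1))" "node_of X i \<noteq> node_of X (i + 1)"
proof -
  show "is_diag m (pre X (i - 1))" using pre_diag[OF X] .
  show "card (pre X (i - 1)) + 1 < N" using card_pre[OF X, of "i - 1"] i by simp
  show "node_of X i \<in> addable m (pre X (i - 1))" using node_of_addable'[OF X] i by simp
  show p: "pre X i = insert (node_of X i) (pre X (i - 1))" using pre_Suc[OF X, of "i - 1"] i by simp
  show "node_of X (i + 1) \<in> addable m (insert (node_of X i) (pre X (i - 1)))"
    using node_of_addable[OF X i(2)] p by simp
  show "node_of X i \<noteq> node_of X (i + 1)" using node_of_val[OF X, of i] node_of_val[OF X, of "i + 1"] i by auto
qed

lemma cat_next_ne:
  assumes X: "X \<in> standard_tableaux m N" and N: "N \<le> n" and i: "1 \<le> i" "i < N"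
  shows "cat X (i + 1) \<noteq> cat X i"
  using ct_next_ne[OF two_nodes(1)[OF X i] _ two_nodes(3,4)[OF X i]] two_nodes(2)[OF X i] N
  by (simp add: content_at_def)

lemma cat_nz:
  assumes X: "X \<in> standard_tableaux m N" and i: "i \<in> {1..N}"
  shows "cat X i \<noteq> 0"
  using ct_nz[OF pre_diag[OF X] node_of_addable'[OF X i]] by (simp add: content_at_def)

text \<open>That the exchange is standard is a conclusion here. The two tableaux agree below
  \<open>i\<close>; the node of \<open>i\<close> in \<open>Z\<close> stays addable after the node of
  \<open>i\<close> in \<open>W\<close> is inserted, and its content then identifies it with the node
  of \<open>i + 1\<close> in \<open>W\<close>.\<close>

lemma std_swap_contents:
  assumes Z: "Z \<in> standard_tableaux m N" and W: "W \<in> standard_tableaux m N" and N: "N \<le> n"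
    and i: "1 \<le> i" "i < N"
    and e: "\<And>j. j \<in> {1..N} \<Longrightarrow> cat Z j = cat W (transpose i (i + 1) j)"
  shows "Z = swap_tableau i W" "swap_tableau i W \<in> standard_tableaux m N"
proof -
  have *: "pre Z j = pre W j" if "j < i" for j
    using that
  proof (induction j)
    case (Suc j)
    then have j: "j < N" using i by auto
    have "inj_on ct (addable m (pre W j))"
      using ct_inj[OF pre_diag[OF W]] card_pre[OF W, of j] j N by simp
    moreover have "ct (node_of Z (Suc j)) = ct (node_of W (Suc j))"
      using e[of "Suc j"] j Suc.prems by (simp add: content_at_def transpose_def)
    ultimately have "node_of Z (Suc j) = node_of W (Suc j)"
      using node_of_addable[OF Z j] node_of_addable[OF W j] Suc by (metis inj_onD Suc_lessD)
    then show ?case using Suc pre_Suc[OF Z j] pre_Suc[OF W j] by simp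
  qed auto
  note T = two_nodes[OF W i]
  have nu: "pre Z (i - 1) = pre W (i - 1)" using * i by simp
  have b: "node_of Z i \<in> addable m (pre W (i - 1))" using two_nodes(3)[OF Z i] nu by simp
  have ci: "ct (node_of Z i) = ct (node_of W (i + 1))" using e[of i] i by (simp add: content_at_def)
  have "cat W (i + 1) \<noteq> cat W i" by (rule cat_next_ne[OF W N i])
  then have "node_of Z i \<noteq> node_of W i" using ci by (auto simp: content_at_def)
  then have "node_of Z i \<in> addable m (insert (node_of W i) (pre W (i - 1)))"
    using addable_commute[OF T(1,3) b] by auto
  moreover have "inj_on ct (addable m (insert (node_of W i) (pre W (i - 1))))"
    using ct_inj[OF addable_diag[OF T(3)]] card_insert_addable[OF T(1,3)] T(2) N by simp
  ultimately have "node_of Z i = node_of W (i + 1)" using ci T(4) by (metis inj_onD)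
  then show sw: "swap_tableau i W \<in> standard_tableaux m N" using swap_std_iff[OF W i] b by simp
  have tr: "transpose i (i + 1) j \<in> {1..N}" if "j \<in> {1..N}" for j using that i by (auto simp: transpose_def)
  show "Z = swap_tableau i W" using e cat_swap[OF W i] by (intro std_eq_contents[OF Z sw N]) simp
qed

lemma not_swap_q2:
  assumes X: "X \<in> standard_tableaux m N" and i: "1 \<le> i" "i < N" and n: "swap_tableau i X \<notin> standard_tableaux m N"
  shows "cat X (i + 1) = q\<^sup>2 * cat X i \<or> q\<^sup>2 * cat X (i + 1) = cat X i"
  using addable_insert_cases[OF two_nodes(1,3,4)[OF X i]] n swap_std_iff[OF X i]
    ct_rt[of "node_of X i"] ct_dn[of "node_of X i"]
  by (auto simp: content_at_def)

text \<open>With \<open>Phi_sq_nonzero\<close> this makes the square of the intertwiner invertible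
  whenever the exchanged tableau is standard.\<close>

lemma swap_not_q2:
  assumes X: "X \<in> standard_tableaux m N" and N: "N \<le> n" and i: "1 \<le> i" "i < N"
    and s: "swap_tableau i X \<in> standard_tableaux m N"
  shows "cat X (i + 1) \<noteq> q\<^sup>2 * cat X i" "q\<^sup>2 * cat X (i + 1) \<noteq> cat X i"
proof -
  have c: "card (pre X (i - 1)) + 1 < n" using two_nodes(2)[OF X i] N by simp
  have a: "node_of X (i + 1) \<in> addable m (pre X (i - 1))" using s swap_std_iff[OF X i] by simp
  note T = two_nodes(1)[OF X i] c
  show "cat X (i + 1) \<noteq> q\<^sup>2 * cat X i"
    using ct_addables_not_q2[OF T two_nodes(3)[OF X i] a] by (simp add: content_at_def)
  show "q\<^sup>2 * cat X (i + 1) \<noteq> cat X i"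
    using ct_addables_not_q2[OF T a two_nodes(3)[OF X i]] by (metis content_at_def)
qed

end

section \<open>Polynomials in an algebra over a field\<close>

text \<open>An algebra over a field, presented as a ring type with a central ring homomorphism. The
  free algebra, the linear operators and the ring containing the Hecke algebra are all
  instances.\<close>

locale central_scalars =
  fixes \<kappa> :: "'k::field \<Rightarrow> 'a::ring_1"
  assumes \<kappa>_add: "\<kappa> (a + b) = \<kappa> a + \<kappa> b"
    and \<kappa>_mult: "\<kappa> (a * b) = \<kappa> a * \<kappa> b"
    and \<kappa>_1: "\<kappa> 1 = 1"
    and \<kappa>_comm: "\<kappa> c * x = x * \<kappa> c"
begin

lemma \<kappa>_0: "\<kappa> 0 = 0"
  using \<kappa>_add[of 0 0] by simp

lemma \<kappa>_minus: "\<kappa> (- a) = - \<kappa> a"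
  using \<kappa>_add[of a "- a"] by (simp add: \<kappa>_0 eq_neg_iff_add_eq_0 add.commute)

lemma \<kappa>_diff: "\<kappa> (a - b) = \<kappa> a - \<kappa> b"
  using \<kappa>_add[of a "- b"] by (simp add: \<kappa>_minus)

lemma \<kappa>_left: "x * (\<kappa> c * y) = \<kappa> c * (x * y)"
  by (metis \<kappa>_comm mult.assoc)

lemma \<kappa>_inverse: "c \<noteq> 0 \<Longrightarrow> \<kappa> (inverse c) * (\<kappa> c * x) = x"
  by (simp add: mult.assoc[symmetric] \<kappa>_mult[symmetric] \<kappa>_1)

lemma \<kappa>_cancel: "c \<noteq> 0 \<Longrightarrow> \<kappa> c * x = 0 \<Longrightarrow> x = 0"
  using \<kappa>_inverse[of c x] by simp

definition pev :: "'k poly \<Rightarrow> 'a \<Rightarrow> 'a" where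
  "pev p x = fold_coeffs (\<lambda>a b. \<kappa> a + x * b) p 0"

lemma pev_0 [simp]: "pev 0 x = 0" by (simp add: pev_def)

lemma pev_pCons [simp]: "pev (pCons a p) x = \<kappa> a + x * pev p x"
  by (cases "p = 0 \<and> a = 0") (auto simp: pev_def \<kappa>_0)

lemma pev_1 [simp]: "pev 1 x = 1"
  unfolding one_pCons by (simp add: \<kappa>_1)

lemma pev_add: "pev (p + r) x = pev p x + pev r x"
  by (induction p r rule: poly_induct2) (simp_all add: \<kappa>_add algebra_simps)

lemma pev_smult: "pev (smult c p) x = \<kappa> c * pev p x"
  by (induction p) (simp_all add: \<kappa>_mult distrib_left \<kappa>_left mult.assoc)

lemma pev_minus: "pev (- p) x = - pev p x"
  using pev_smult[of "-1" p x] by (simp add: \<kappa>_minus \<kappa>_1)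

lemma pev_diff: "pev (p - r) x = pev p x - pev r x"
  using pev_add[of p "- r" x] by (simp add: pev_minus)

lemma pev_mult: "pev (p * r) x = pev p x * pev r x"
  by (induction p) (simp_all add: pev_add pev_smult \<kappa>_0 distrib_right mult.assoc)

lemma pev_comm: "y * x = x * y \<Longrightarrow> y * pev p x = pev p x * y"
proof (induction p)
  case (pCons a p)
  then show ?case by (simp add: algebra_simps \<kappa>_comm) (metis mult.assoc)
qed simp

lemma pev_swap:
  assumes "y * x = x' * y"
  shows "y * pev p x = pev p x' * y"
proof (induction p)
  case (pCons a p)
  have "y * pev (pCons a p) x = \<kappa> a * y + x' * (y * pev p x)"
    using assms by (simp add: algebra_simps \<kappa>_comm) (metis mult.assoc)
  then show ?case by (simp add: pCons.IH algebra_simps)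
qed simp

lemma pev_eigen: 
  assumes "x * w = \<kappa> c * w"
  shows "pev p x * w = \<kappa> (poly p c) * w"
proof (induction p)
  case (pCons a p)
  have "pev (pCons a p) x * w = \<kappa> a * w + x * (pev p x * w)" by (simp add: distrib_right mult.assoc)
  also have "x * (pev p x * w) = \<kappa> (poly p c) * (x * w)" unfolding pCons.IH by (rule \<kappa>_left)
  also have "\<dots> = \<kappa> (c * poly p c) * w" unfolding assms
    by (simp only: mult.assoc[symmetric] \<kappa>_mult[symmetric] mult.commute)
  finally show ?case by (simp add: \<kappa>_add distrib_right)
qed (simp add: \<kappa>_0)

lemma pev_eigen_right: 
  assumes "w * x = \<kappa> c * w"
  shows "w * pev p x = \<kappa> (poly p c) * w"
proof (induction p)
  case (pCons a p)
  have "w * pev (pCons a p) x = \<kappa> a * w + (w * x) * pev p x" by (simp add: distrib_left \<kappa>_comm mult.assoc)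
  also have "(w * x) * pev p x = \<kappa> c * (w * pev p x)" unfolding assms by (rule mult.assoc)
  also have "\<dots> = \<kappa> (c * poly p c) * w" unfolding pCons.IH by (simp add: \<kappa>_mult mult.assoc)
  finally show ?case by (simp add: \<kappa>_add distrib_right)
qed (simp add: \<kappa>_0)

text \<open>Because \<open>C\<close> is a set, the annihilating polynomial has simple roots; it
  divides every polynomial vanishing on \<open>C\<close>, in particular
  \<open>p - r\<close>.\<close>

lemma pev_cong:
  assumes "finite C" "pev (\<Prod>c\<in>C. [:- c, 1:]) x * e = 0" "\<And>c. c \<in> C \<Longrightarrow> poly p c = poly r c"
  shows "pev p x * e = pev r x * e"
proof -
  have "(\<Prod>c\<in>C. [:- c, 1:]) dvd p - r"
    using assms(1,3)
  proof (induction C arbitrary: p r rule: finite_induct)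
    case (insert c C)
    then have "[:- c, 1:] dvd p - r" by (simp add: poly_eq_0_iff_dvd[symmetric])
    then obtain s where s: "p - r = [:- c, 1:] * s" by (elim dvdE)
    have "poly s d = poly 0 d" if d: "d \<in> C" for d
    proof -
      have "poly (p - r) d = 0" using insert.prems d by simp
      moreover have "d \<noteq> c" using d insert.hyps by auto
      ultimately show ?thesis unfolding s by simp
    qed
    then have "(\<Prod>c\<in>C. [:- c, 1:]) dvd s" using insert.IH[of s 0] by simp
    then have "[:- c, 1:] * (\<Prod>c\<in>C. [:- c, 1:]) dvd [:- c, 1:] * s" by (rule mult_dvd_mono[OF dvd_refl])
    then show ?case unfolding s prod.insert[OF insert.hyps] .
  qed simp
  then obtain s where s: "p - r = s * (\<Prod>c\<in>C. [:- c, 1:])" by (metis dvd_def mult.commute)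
  have "pev (p - r) x * e = pev s x * (pev (\<Prod>c\<in>C. [:- c, 1:]) x * e)"
    unfolding s pev_mult by (simp add: mult.assoc)
  then show ?thesis using assms(2) by (simp add: pev_diff left_diff_distrib)
qed

end

section \<open>The Hecke relations in a ring\<close>

text \<open>Only the relations are assumed, no universal property: the results apply both to the
  algebra itself and to its representations.\<close>

locale hecke_alg = central_scalars \<kappa> + hecke_params m n q v
  for \<kappa> :: "'k::field \<Rightarrow> 'a::ring_1" and m n :: nat and q :: 'k and v :: "nat \<Rightarrow> 'k" +
  fixes t :: 'a and s :: "nat \<Rightarrow> 'a"
  assumes braid: "\<And>i. 1 \<le> i \<Longrightarrow> i + 1 < n \<Longrightarrow> s i * s (i + 1) * s i = s (i + 1) * s i * s (i + 1)"
    and s_far: "\<And>i j. 1 \<le> i \<Longrightarrow> i + 1 < j \<Longrightarrow> j < n \<Longrightarrow> s i * s j = s j * s i"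
    and t_braid: "1 < n \<Longrightarrow> t * s 1 * t * s 1 = s 1 * t * s 1 * t"
    and t_s: "\<And>i. 1 < i \<Longrightarrow> i < n \<Longrightarrow> t * s i = s i * t"
    and quad: "\<And>i. 1 \<le> i \<Longrightarrow> i < n \<Longrightarrow> s i * s i = \<kappa> (q - inverse q) * s i + 1"
    and cyc: "pev (\<Prod>j\<in>{1..m}. [:- v j, 1:]) t = 0"
begin

lemma \<kappa>_2: "\<kappa> 2 = 2"
  using \<kappa>_add[of 1 1] by (simp add: \<kappa>_1)

abbreviation "p \<equiv> q - inverse q"

section \<open>Jucys-Murphy elements and intertwiners\<close>

fun J :: "nat \<Rightarrow> 'a" where
  "J 0 = 1"
| "J (Suc 0) = t"
| "J (Suc (Suc i)) = s (Suc i) * J (Suc i) * s (Suc i)"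

lemma J_Suc: "1 \<le> i \<Longrightarrow> J (i + 1) = s i * J i * s i"
  by (cases i) auto

text \<open>The image of \<open>H(m,1,k)\<close>. The side condition on \<open>t\<close> makes
  \<open>Alg 0\<close> consist of scalars, in agreement with \<open>H(m,1,0) = K\<close>.\<close>

inductive_set Alg :: "nat \<Rightarrow> 'a set" for k where
  Alg_scalar: "\<kappa> c \<in> Alg k"
| Alg_t: "1 \<le> k \<Longrightarrow> t \<in> Alg k"
| Alg_s: "1 \<le> i \<Longrightarrow> i < k \<Longrightarrow> s i \<in> Alg k"
| Alg_add: "x \<in> Alg k \<Longrightarrow> y \<in> Alg k \<Longrightarrow> x + y \<in> Alg k"
| Alg_mult: "x \<in> Alg k \<Longrightarrow> y \<in> Alg k \<Longrightarrow> x * y \<in> Alg k"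

lemma Alg_1: "1 \<in> Alg k"
  using Alg_scalar[of 1] by (simp add: \<kappa>_1)

lemma Alg_0: "0 \<in> Alg k"
  using Alg_scalar[of 0] by (simp add: \<kappa>_0)

lemma Alg_minus: "x \<in> Alg k \<Longrightarrow> - x \<in> Alg k"
  using Alg_mult[OF Alg_scalar[of "-1"], of x k] by (simp add: \<kappa>_minus \<kappa>_1)

lemma Alg_diff: "x \<in> Alg k \<Longrightarrow> y \<in> Alg k \<Longrightarrow> x - y \<in> Alg k"
  using Alg_add[OF _ Alg_minus] by (metis diff_conv_add_uminus)

lemma Alg_power: "x \<in> Alg k \<Longrightarrow> x ^ i \<in> Alg k"
  by (induction i) (auto intro: Alg_1 Alg_mult)

lemma Alg_mono: "k \<le> l \<Longrightarrow> x \<in> Alg k \<Longrightarrow> x \<in> Alg l"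
  by (rotate_tac 1, induction rule: Alg.induct) (auto intro: Alg.intros)

lemma Alg_J: "1 \<le> j \<Longrightarrow> j \<le> k \<Longrightarrow> J j \<in> Alg k"
proof (induction j rule: J.induct)
  case 2 then show ?case by (auto intro: Alg_t)
next
  case (3 i) then show ?case by (auto intro!: Alg_mult Alg_s)
qed simp

lemma Alg_pev: "x \<in> Alg k \<Longrightarrow> pev r x \<in> Alg k"
  by (induction r) (auto intro: Alg_0 Alg_add Alg_mult Alg_scalar)

lemma commute_Alg:
  assumes "1 \<le> k \<Longrightarrow> x * t = t * x" "\<And>i. 1 \<le> i \<Longrightarrow> i < k \<Longrightarrow> x * s i = s i * x" "y \<in> Alg k"
  shows "x * y = y * x"
  using assms(3)
proof (induction rule: Alg.induct)
  case (Alg_mult a b) then show ?case by (metis mult.assoc)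
qed (auto simp: \<kappa>_comm algebra_simps assms)

lemma s_Alg: "k < i \<Longrightarrow> i < n \<Longrightarrow> y \<in> Alg k \<Longrightarrow> s i * y = y * s i"
  by (rule commute_Alg) (use t_s[of i] s_far[of _ i] in auto)

lemma J_t: "1 \<le> j \<Longrightarrow> j \<le> n \<Longrightarrow> J j * t = t * J j"
proof (induction j rule: J.induct)
  case (3 i)
  show ?case
  proof (cases "i = 0")
    case True
    then show ?thesis using t_braid 3 by (simp add: mult.assoc)
  next
    case False
    have "s (Suc i) * t = t * s (Suc i)" using t_s[of "Suc i"] 3 False by simp
    moreover have "J (Suc i) * t = t * J (Suc i)" using 3 by simp
    ultimately show ?thesis by simp (metis mult.assoc)
  qed
qed auto

text \<open>The essential case is the generator two places below: \<open>J (j + 2)\<close> is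
  \<open>a * b * x * b * a\<close> with \<open>a = s (j + 1)\<close>, \<open>b = s j\<close>,
  \<open>x = J j\<close>. Two applications of the braid relation carry \<open>b\<close> through,
  because \<open>a\<close> commutes with \<open>x\<close>.\<close>

lemma J_s_low: "1 \<le> i \<Longrightarrow> i + 2 \<le> j \<Longrightarrow> j \<le> n \<Longrightarrow> J j * s i = s i * J j"
proof (induction j rule: J.induct)
  case (3 j)
  let ?a = "s (Suc j)" and ?b = "s i"
  show ?case
  proof (cases "i = j")
    case True
    then obtain x where x: "J (Suc j) = ?b * x * ?b" "x = J j" using J_Suc[of j] 3 by auto
    have br: "?b * ?a * ?b = ?a * ?b * ?a" using braid[of i] 3 True by simp
    have c: "?a * x = x * ?a" using s_Alg[of j "Suc j" "J j"] Alg_J[of j j] 3 True x by auto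
    have "J (Suc (Suc j)) * ?b = ?a * (?b * (x * (?b * (?a * ?b))))" by (simp add: x mult.assoc)
    also have "\<dots> = ?a * (?b * (x * (?a * (?b * ?a))))" using br by (simp add: mult.assoc)
    also have "\<dots> = (?a * ?b * ?a) * (x * (?b * ?a))" using c by (simp add: mult.assoc) (metis mult.assoc)
    also have "\<dots> = ?b * (?a * (?b * (x * (?b * ?a))))" unfolding br[symmetric] by (simp add: mult.assoc)
    also have "\<dots> = ?b * J (Suc (Suc j))" by (simp add: x mult.assoc)
    finally show ?thesis .
  next
    case False
    then have "J (Suc j) * ?b = ?b * J (Suc j)" "?a * ?b = ?b * ?a" using 3 s_far[of i "Suc j"] by auto
    then show ?thesis by simp (metis mult.assoc)
  qed
qed auto

lemma J_Alg: "k < n \<Longrightarrow> y \<in> Alg k \<Longrightarrow> J (Suc k) * y = y * J (Suc k)"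
  by (rule commute_Alg) (use J_t[of "Suc k"] J_s_low[of _ "Suc k"] in auto)

lemma J_J: "1 \<le> i \<Longrightarrow> i \<le> n \<Longrightarrow> 1 \<le> j \<Longrightarrow> j \<le> n \<Longrightarrow> J i * J j = J j * J i"
proof (induction i j rule: linorder_wlog)
  case (le i j)
  then show ?case using J_Alg[of "j - 1" "J i"] Alg_J[of i "j - 1"] by (cases "i = j") auto
qed auto

lemma s_J_far: "1 \<le> i \<Longrightarrow> i < n \<Longrightarrow> 1 \<le> j \<Longrightarrow> j \<le> n \<Longrightarrow> j \<noteq> i \<Longrightarrow> j \<noteq> i + 1 \<Longrightarrow> s i * J j = J j * s i"
  using s_Alg[of j i "J j"] Alg_J[of j j] J_s_low[of i j] by (cases "j < i") auto

text \<open>By \<open>s_J1\<close> this is the commutator \<open>s i * J i - J i * s i\<close>.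
  Unlike the usual intertwiner it has no denominators, so it makes sense before anything is known
  about the spectrum.\<close>

definition Phi :: "nat \<Rightarrow> 'a" where
  "Phi i = s i * (J i - J (i + 1)) + \<kappa> p * J (i + 1)"

lemma Alg_Phi: "1 \<le> i \<Longrightarrow> i < k \<Longrightarrow> Phi i \<in> Alg k"
  unfolding Phi_def by (auto intro!: Alg_add Alg_mult Alg_diff Alg_s Alg_J Alg_scalar)

lemma assoc_rule: "x * y = z \<Longrightarrow> x * (y * w) = z * w" for x y z w :: 'a
  by (simp add: mult.assoc[symmetric])

lemma rank_two:
  assumes i: "1 \<le> i" "i < n"
  shows s_J: "s i * J i = J (i + 1) * s i - \<kappa> p * J (i + 1)"
    and s_J1: "s i * J (i + 1) = J i * s i + \<kappa> p * J (i + 1)"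
    and Phi_J: "Phi i * J i = J (i + 1) * Phi i"
    and Phi_J1: "Phi i * J (i + 1) = J i * Phi i"
    and Phi_alt: "Phi i = (J (i + 1) - J i) * s i - \<kappa> p * J (i + 1)"
    and Phi_sq: "Phi i * Phi i = \<kappa> (p * p + 2) * (J i * J (i + 1)) - J i * J i - J (i + 1) * J (i + 1)"
proof -
  define x y a where d: "x = J i" "y = J (i + 1)" "a = s i"
  have y: "y = a * x * a" using J_Suc i d by simp
  have xy: "y * x = x * y" using J_J[of i "i + 1"] i d by simp
  have q: "a * a = \<kappa> p * a + 1" using quad i d by simp
  have k: "z * \<kappa> c = \<kappa> c * z" for z c by (simp add: \<kappa>_comm)
  have "y * a = a * (x * (a * a))" by (simp add: y mult.assoc)
  then have ya: "a * x = y * a - \<kappa> p * y" unfolding q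
    by (simp add: distrib_left y k mult.assoc) (simp add: mult.assoc[symmetric] k)
  have "a * y = (a * a) * (x * a)" by (simp add: y mult.assoc)
  then have ay: "a * y = x * a + \<kappa> p * y" unfolding q by (simp add: distrib_right y mult.assoc)
  show "s i * J i = J (i + 1) * s i - \<kappa> p * J (i + 1)" "s i * J (i + 1) = J i * s i + \<kappa> p * J (i + 1)"
    using ya ay d by auto
  \<comment> \<open>Read from left to right these are rewrite rules that move \<open>a\<close> to
    the right of \<open>x\<close> and \<open>y\<close>, order \<open>x\<close> before
    \<open>y\<close> and remove squares of \<open>a\<close>. The versions by
    \<open>assoc_rule\<close> apply them inside right-nested products, so each remaining identity
    follows by normalization.\<close>
  note R = ya ay xy q assoc_rule[OF ya] assoc_rule[OF ay] assoc_rule[OF xy] assoc_rule[OF q]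
  have kl: "x * (\<kappa> c * z) = \<kappa> c * (x * z)" "y * (\<kappa> c * z) = \<kappa> c * (y * z)" "a * (\<kappa> c * z) = \<kappa> c * (a * z)" for c z
    by (rule \<kappa>_left)+
  have kk: "x * \<kappa> c = \<kappa> c * x" "y * \<kappa> c = \<kappa> c * y" "a * \<kappa> c = \<kappa> c * a" for c
    by (rule \<kappa>_comm[symmetric])+
  define f where "f = \<kappa> p"
  have k2: "\<kappa> (p * p + 2) = f * f + 2" unfolding f_def
    unfolding \<kappa>_add \<kappa>_mult \<kappa>_2 ..
  note kl' = kl[of p, folded f_def] and kk' = kk[of p, folded f_def]
  note R' = R[folded f_def] kl' kk'
  have P: "Phi i = a * (x - y) + f * y" unfolding Phi_def d f_def ..
  show "Phi i * J i = J (i + 1) * Phi i" unfolding P d(1,2)[symmetric] by (simp add: algebra_simps R')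
  show "Phi i * J (i + 1) = J i * Phi i" unfolding P d(1,2)[symmetric] by (simp add: algebra_simps R')
  show "Phi i = (J (i + 1) - J i) * s i - \<kappa> p * J (i + 1)"
    unfolding P d[symmetric] f_def[symmetric] by (simp add: algebra_simps R')
  show "Phi i * Phi i = \<kappa> (p * p + 2) * (J i * J (i + 1)) - J i * J i - J (i + 1) * J (i + 1)"
    unfolding P d[symmetric] k2 by (simp add: algebra_simps R' mult_2)
qed

lemma Phi_J_swap:
  assumes i: "1 \<le> i" "i < n" and j: "1 \<le> j" "j \<le> n"
  shows "J j * Phi i = Phi i * J (transpose i (i + 1) j)"
proof -
  consider "j = i" | "j = i + 1" | "j \<noteq> i" "j \<noteq> i + 1" by blast
  then show ?thesis
  proof cases
    case 3
    have "J j * J i = J i * J j" "J j * J (i + 1) = J (i + 1) * J j" "J j * s i = s i * J j"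
      using J_J i j s_J_far[OF i j] 3 by auto
    then have "J j * Phi i = Phi i * J j" unfolding Phi_def
      by (simp add: algebra_simps \<kappa>_left) (metis mult.assoc)
    then show ?thesis using 3 by simp
  qed (use Phi_J[OF i] Phi_J1[OF i] in auto)
qed

lemma Phi_sq_eigen:
  assumes i: "1 \<le> i" "i < n" and w: "J i * w = \<kappa> a * w" "J (i + 1) * w = \<kappa> b * w"
  shows "Phi i * (Phi i * w) = \<kappa> ((p * p + 2) * a * b - a * a - b * b) * w"
proof -
  have e: "J i * (J i * w) = \<kappa> (a * a) * w" "J (i + 1) * (J (i + 1) * w) = \<kappa> (b * b) * w"
    "J i * (J (i + 1) * w) = \<kappa> (b * a) * w"
    by (simp_all only: w \<kappa>_left[of "J i"] \<kappa>_left[of "J (i + 1)"] \<kappa>_mult mult.assoc)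
  have "Phi i * (Phi i * w) = (Phi i * Phi i) * w" by (simp add: mult.assoc)
  also have "\<dots> = \<kappa> (p * p + 2) * (\<kappa> (b * a) * w) - \<kappa> (a * a) * w - \<kappa> (b * b) * w"
    unfolding Phi_sq[OF i] by (simp only: left_diff_distrib mult.assoc e)
  also have "\<dots> = \<kappa> ((p * p + 2) * a * b - a * a - b * b) * w"
    by (simp add: \<kappa>_diff \<kappa>_mult[symmetric] left_diff_distrib mult.assoc[symmetric] mult.commute[of b a])
  finally show ?thesis .
qed

text \<open>The square of the intertwiner, evaluated at contents \<open>a\<close> and
  \<open>b\<close>, vanishes exactly when their ratio is \<open>q\<^sup>2\<close> or its inverse,
  that is, at the ratios of neighbouring nodes.\<close>

lemma Phi_sq_factor: "(p * p + 2) * a * b - a * a - b * b = - (a - q\<^sup>2 * b) * (a - inverse q ^ 2 * b)"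
  using q0 by (simp add: field_simps power2_eq_square)

lemma Phi_sq_nonzero:
  assumes "b \<noteq> q\<^sup>2 * a" "q\<^sup>2 * b \<noteq> a"
  shows "(p * p + 2) * a * b - a * a - b * b \<noteq> 0"
proof -
  have "a - inverse q ^ 2 * b \<noteq> 0" using assms(1) q0 by (auto simp: field_simps)
  then show ?thesis unfolding Phi_sq_factor using assms(2) by auto
qed

end

section \<open>Interpolation at the contents of addable nodes\<close>

context hecke_params
begin

text \<open>The Lagrange basis polynomial at the node \<alpha>: evaluated at the next Jucys-Murphy
  element it is the factor in the recursion for the idempotents.\<close>

definition Lag :: "mnode set \<Rightarrow> mnode \<Rightarrow> 'k poly" where
  "Lag D \<alpha> = (\<Prod>\<beta>\<in>addable m D - {\<alpha>}. smult (1 / (ct \<alpha> - ct \<beta>)) [:- ct \<beta>, 1:])"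

definition Qp :: "mnode set \<Rightarrow> 'k poly" where
  "Qp D = (\<Prod>\<beta>\<in>addable m D. [:- ct \<beta>, 1:])"

lemma Lag_at:
  assumes D: "is_diag m D" "card D < n" and a: "\<alpha> \<in> addable m D" and g: "\<gamma> \<in> addable m D"
  shows "poly (Lag D \<alpha>) (ct \<gamma>) = (if \<gamma> = \<alpha> then 1 else 0)"
proof (cases "\<gamma> = \<alpha>")
  case True
  have "ct \<alpha> - ct \<beta> \<noteq> 0" if "\<beta> \<in> addable m D - {\<alpha>}" for \<beta>
    using ct_inj[OF D] a that by (auto dest: inj_onD)
  then show ?thesis using True unfolding Lag_def poly_prod by (intro trans[OF prod.neutral]) (auto simp: diff_divide_distrib[symmetric] split_paired_all)
next
  case False
  then show ?thesis unfolding Lag_def poly_prod using finite_addable[OF D(1)] g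
    by (auto intro!: prod_zero)
qed

lemma Qp_at: "is_diag m D \<Longrightarrow> poly (Qp D) c = 0 \<longleftrightarrow> (\<exists>\<beta>\<in>addable m D. ct \<beta> = c)"
  unfolding Qp_def poly_prod using finite_addable[of m D] by auto

end

context hecke_alg
begin

primrec E :: "nat \<Rightarrow> mtableau \<Rightarrow> 'a" where
  "E 0 X = 1"
| "E (Suc k) X = E k (remove_entry (Suc k) X) *
     pev (Lag (shape (remove_entry (Suc k) X)) (node_of X (Suc k))) (J (Suc k))"

text \<open>The hinge of the whole induction: on \<open>E k Y\<close> the next Jucys-Murphy element
  has no eigenvalues besides the contents of addable nodes, and it is diagonalizable, since
  \<open>Qp\<close> has simple roots for \<open>k < n\<close>.\<close>

definition spectral :: "nat \<Rightarrow> bool" where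
  "spectral k \<longleftrightarrow> (\<forall>Y\<in>standard_tableaux m k. pev (Qp (shape Y)) (J (Suc k)) * E k Y = 0)"

abbreviation "std \<equiv> standard_tableaux m"

lemma Alg_E: "E k X \<in> Alg k"
proof (induction k arbitrary: X)
  case (Suc k)
  show ?case unfolding E.simps by (intro Alg_mult Alg_pev Alg_J Alg_mono[OF _ Suc]) auto
qed (simp add: Alg_1)

lemma J_E: "1 \<le> j \<Longrightarrow> j \<le> n \<Longrightarrow> k \<le> n \<Longrightarrow> J j * E k X = E k X * J j"
proof (induction k arbitrary: X)
  case (Suc k)
  let ?L = "pev (Lag (shape (remove_entry (Suc k) X)) (node_of X (Suc k))) (J (Suc k))"
  have "J j * ?L = ?L * J j" using Suc.prems by (intro pev_comm J_J) auto
  moreover have "J j * E k (remove_entry (Suc k) X) = E k (remove_entry (Suc k) X) * J j"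
    using Suc by simp
  ultimately show ?case unfolding E.simps by (metis mult.assoc)
qed simp

lemma pev_J_E: "1 \<le> j \<Longrightarrow> j \<le> n \<Longrightarrow> k \<le> n \<Longrightarrow> pev r (J j) * E k X = E k X * pev r (J j)"
  using pev_comm[of "E k X" "J j" r] J_E[of j k X] by simp

lemma E_extend:
  assumes "Y \<in> std k" "\<alpha> \<in> addable m (shape Y)" "k < n"
  shows "E (Suc k) (Y(\<alpha> := Suc k)) = pev (Lag (shape Y) \<alpha>) (J (Suc k)) * E k Y"
  using std_extend[OF assms(1,2)] pev_J_E[of "Suc k" k] assms(3) by simp

lemma E_Suc:
  assumes "X \<in> std (Suc k)" "k < n"
  shows "E (Suc k) X = pev (Lag (pre X k) (node_of X (Suc k))) (J (Suc k)) * E k (remove_entry (Suc k) X)"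
  using std_remove[OF assms(1)] pev_J_E[of "Suc k" k] assms(2) by simp

text \<open>Polynomials in the next Jucys-Murphy element, applied to \<open>E k Y\<close>, may be
  compared by their values at the addable contents; this is how interpolation identities become
  identities of idempotents.\<close>

lemma spectral_cong:
  assumes sp: "spectral k" and k: "k < n" and Y: "Y \<in> std k"
    and eq: "\<And>\<beta>. \<beta> \<in> addable m (shape Y) \<Longrightarrow> poly r1 (ct \<beta>) = poly r2 (ct \<beta>)"
  shows "pev r1 (J (Suc k)) * E k Y = pev r2 (J (Suc k)) * E k Y"
proof (rule pev_cong)
  have inj: "inj_on ct (addable m (shape Y))" using ct_inj[OF shape_diag[OF Y]] card_shape[OF Y] k by simp
  show "finite (ct ` addable m (shape Y))" using finite_addable[OF shape_diag[OF Y]] by simp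
  have "(\<Prod>c\<in>ct ` addable m (shape Y). [:- c, 1:]) = Qp (shape Y)"
    unfolding Qp_def by (subst prod.reindex[OF inj]) simp
  then show "pev (\<Prod>c\<in>ct ` addable m (shape Y). [:- c, 1:]) (J (Suc k)) * E k Y = 0"
    using sp Y unfolding spectral_def by simp
  show "poly r1 c = poly r2 c" if "c \<in> ct ` addable m (shape Y)" for c using eq that by auto
qed

text \<open>Both claims are interpolation identities: the polynomials \<open>z * Lag\<close> and
  \<open>ct \<alpha> * Lag\<close> agree at all addable contents, and the Lagrange polynomials add
  up to 1 there.\<close>

lemma level:
  assumes "k \<le> n" "\<And>j. j < k \<Longrightarrow> spectral j"
  shows "(\<forall>X\<in>std k. \<forall>i\<in>{1..k}. J i * E k X = \<kappa> (cat X i) * E k X) \<and> (\<Sum>X\<in>std k. E k X) = 1"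
  using assms
proof (induction k)
  case 0
  then show ?case by (simp add: std_0)
next
  case (Suc k)
  have k: "k < n" and sp: "spectral k" using Suc.prems by auto
  have IH: "\<And>X i. X \<in> std k \<Longrightarrow> i \<in> {1..k} \<Longrightarrow> J i * E k X = \<kappa> (cat X i) * E k X" "(\<Sum>X\<in>std k. E k X) = 1"
    using Suc by auto
  show ?case
  proof (intro conjI ballI)
    fix X i assume X: "X \<in> std (Suc k)" and i: "i \<in> {1..Suc k}"
    let ?Y = "remove_entry (Suc k) X" and ?a = "node_of X (Suc k)"
    let ?L = "Lag (pre X k) ?a"
    note Y = std_remove[OF X]
    show "J i * E (Suc k) X = \<kappa> (cat X i) * E (Suc k) X"
    proof (cases "i \<le> k")
      case True
      then have c: "cat ?Y i = cat X i" using node_of_remove[OF X, of i] i by (simp add: content_at_def)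
      have "J i * pev ?L (J (Suc k)) = pev ?L (J (Suc k)) * J i" using i k by (intro pev_comm J_J) auto
      then have "J i * E (Suc k) X = pev ?L (J (Suc k)) * (J i * E k ?Y)"
        unfolding E_Suc[OF X k] by (simp add: mult.assoc[symmetric])
      also have "\<dots> = \<kappa> (cat X i) * E (Suc k) X"
        using IH(1)[OF Y(1), of i] True i c \<kappa>_left unfolding E_Suc[OF X k] by simp
      finally show ?thesis .
    next
      case False
      then have i': "i = Suc k" using i by simp
      have a: "?a \<in> addable m (pre X k)" using node_of_addable[OF X, of k] by simp
      have D: "is_diag m (pre X k)" "card (pre X k) < n" using pre_diag[OF X] card_pre[OF X, of k] k by auto
      have "pev ([:0, 1:] * ?L) (J (Suc k)) * E k ?Y = pev (smult (ct ?a) ?L) (J (Suc k)) * E k ?Y"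
        by (rule spectral_cong[OF sp k Y(1)]) (use Lag_at[OF D a] Y(2) in auto)
      then show ?thesis unfolding i' E_Suc[OF X k] content_at_def
        by (simp add: pev_mult pev_smult \<kappa>_0 \<kappa>_1 mult.assoc)
    qed
  next
    have "(\<Sum>X\<in>std (Suc k). E (Suc k) X) = (\<Sum>a\<in>(SIGMA Y:std k. addable m (shape Y)). E (Suc k) (case a of (Y, \<alpha>) \<Rightarrow> Y(\<alpha> := Suc k)))"
      unfolding std_Suc by (subst sum.reindex[OF inj_on_extend]) simp
    also have "\<dots> = (\<Sum>Y\<in>std k. \<Sum>\<alpha>\<in>addable m (shape Y). E (Suc k) (Y(\<alpha> := Suc k)))"
      by (subst sum.Sigma[OF finite_std]) (auto intro!: finite_addable[OF shape_diag] sum.cong)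
    also have "\<dots> = (\<Sum>Y\<in>std k. E k Y)"
    proof (rule sum.cong[OF refl])
      fix Y assume Y: "Y \<in> std k"
      have D: "is_diag m (shape Y)" "card (shape Y) < n" using shape_diag[OF Y] card_shape[OF Y] k by auto
      let ?A = "addable m (shape Y)"
      have fin: "finite ?A" using finite_addable[OF D(1)] .
      have pev_sum: "pev (\<Sum>\<alpha>\<in>S. f \<alpha>) x = (\<Sum>\<alpha>\<in>S. pev (f \<alpha>) x)" if "finite S" for S x and f :: "mnode \<Rightarrow> 'k poly"
        using that by induction (auto simp: pev_add)
      have "(\<Sum>\<alpha>\<in>?A. E (Suc k) (Y(\<alpha> := Suc k))) = pev (\<Sum>\<alpha>\<in>?A. Lag (shape Y) \<alpha>) (J (Suc k)) * E k Y"
        by (simp add: pev_sum[OF fin] sum_distrib_right E_extend[OF Y _ k] del: E.simps)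
      also have "\<dots> = pev 1 (J (Suc k)) * E k Y"
      proof (rule spectral_cong[OF sp k Y])
        fix \<beta> assume b: "\<beta> \<in> ?A"
        have "poly (\<Sum>\<alpha>\<in>?A. Lag (shape Y) \<alpha>) (ct \<beta>) = (\<Sum>\<alpha>\<in>?A. if \<beta> = \<alpha> then 1 else 0)"
          unfolding poly_sum by (intro sum.cong refl Lag_at[OF D _ b])
        then show "poly (\<Sum>\<alpha>\<in>?A. Lag (shape Y) \<alpha>) (ct \<beta>) = poly 1 (ct \<beta>)" using b fin by simp
      qed
      finally show "(\<Sum>\<alpha>\<in>?A. E (Suc k) (Y(\<alpha> := Suc k))) = E k Y" by simp
    qed
    finally show "(\<Sum>X\<in>std (Suc k). E (Suc k) X) = 1" using IH(2) by simp
  qed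
qed

end

text \<open>One stage of the induction: the spectrum is controlled below \<open>k\<close>, which
  makes the idempotents of size \<open>k\<close> available. The locale is later seen to hold for all
  \<open>k \<le> n\<close>.\<close>

locale hecke_level = hecke_alg \<kappa> m n q v t s
  for \<kappa> :: "'k::field \<Rightarrow> 'a::ring_1" and m n :: nat and q :: 'k and v :: "nat \<Rightarrow> 'k" and t s +
  fixes k :: nat
  assumes kn: "k \<le> n" and spec: "\<And>j. j < k \<Longrightarrow> spectral j"
begin

lemma E_eigen: "X \<in> std k \<Longrightarrow> i \<in> {1..k} \<Longrightarrow> J i * E k X = \<kappa> (cat X i) * E k X"
  using level[OF kn spec] by blast

lemma E_sum: "(\<Sum>X\<in>std k. E k X) = 1"
  using level[OF kn spec] by blast

lemma E_eigen_right: "X \<in> std k \<Longrightarrow> i \<in> {1..k} \<Longrightarrow> E k X * J i = \<kappa> (cat X i) * E k X"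
  using E_eigen J_E[of i k X] kn by simp

lemma eq_of_scaled: "\<kappa> a * y = \<kappa> b * y \<Longrightarrow> y \<noteq> 0 \<Longrightarrow> a = b"
  using \<kappa>_cancel[of "a - b" y] by (auto simp: \<kappa>_diff left_diff_distrib)

text \<open>Two distinct tableaux have different contents at some place \<open>j\<close>, and
  \<open>J j\<close> can be moved from one idempotent to the other.\<close>

lemma E_orth:
  assumes "X \<in> std k" "Y \<in> std k" "X \<noteq> Y"
  shows "E k X * E k Y = 0"
proof -
  obtain j where j: "j \<in> {1..k}" "cat X j \<noteq> cat Y j" using std_eq_contents[OF assms(1,2) kn] assms(3) by blast
  have "\<kappa> (cat X j) * (E k X * E k Y) = E k X * J j * E k Y"
    using E_eigen_right[OF assms(1) j(1)] by (simp add: mult.assoc)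
  also have "\<dots> = \<kappa> (cat Y j) * (E k X * E k Y)"
    using E_eigen[OF assms(2) j(1)] by (simp add: mult.assoc \<kappa>_left)
  finally show ?thesis using eq_of_scaled j(2) by blast
qed

lemma E_expand_left: "(\<Sum>X\<in>std k. E k X * x) = x"
  by (simp add: sum_distrib_right[symmetric] E_sum)

lemma E_expand_right: "(\<Sum>X\<in>std k. x * E k X) = x"
  by (simp add: sum_distrib_left[symmetric] E_sum)

lemma sum_single:
  assumes "finite S" "a \<in> S" "\<And>b. b \<in> S \<Longrightarrow> b \<noteq> a \<Longrightarrow> f b = (0::'a)"
  shows "sum f S = f a"
  using assms by (subst sum.mono_neutral_right[of S "{a}"]) auto

text \<open>Multiplying the completeness relation by \<open>E k X\<close> leaves only one term, by
  orthogonality.\<close>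

lemma E_idem:
  assumes "X \<in> std k"
  shows "E k X * E k X = E k X"
proof -
  have "E k X = (\<Sum>Y\<in>std k. E k X * E k Y)" by (rule E_expand_right[symmetric])
  also have "\<dots> = E k X * E k X" using E_orth[OF assms] by (intro sum_single finite_std assms) auto
  finally show ?thesis by simp
qed

lemma E_idem': "X \<in> std k \<Longrightarrow> E k X * (E k X * y) = E k X * y"
  by (simp add: mult.assoc[symmetric] E_idem)

text \<open>A nonzero matrix entry of the intertwiner forces the content sequences of
  \<open>Z\<close> and \<open>W\<close> to be exchanges of each other, and contents determine
  tableaux.\<close>

lemma E_Phi_E:
  assumes Z: "Z \<in> std k" and W: "W \<in> std k" and i: "1 \<le> i" "i < k" and nz: "E k Z * Phi i * E k W \<noteq> 0"
  shows "Z = swap_tableau i W" "swap_tableau i W \<in> std k"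
proof -
  have "cat Z j = cat W (transpose i (i + 1) j)" if j: "j \<in> {1..k}" for j
  proof -
    let ?j = "transpose i (i + 1) j" and ?y = "E k Z * Phi i * E k W"
    have tr: "?j \<in> {1..k}" using i j by (auto simp: transpose_def)
    have "\<kappa> (cat Z j) * ?y = E k Z * J j * Phi i * E k W"
      using E_eigen_right[OF Z j] by (simp add: mult.assoc)
    also have "\<dots> = E k Z * Phi i * (J ?j * E k W)"
      using Phi_J_swap[of i j] i j kn by (simp add: mult.assoc)
    also have "\<dots> = \<kappa> (cat W ?j) * ?y"
      unfolding E_eigen[OF W tr] by (simp add: \<kappa>_left mult.assoc)
    finally show ?thesis using eq_of_scaled nz by blast
  qed
  from std_swap_contents[OF Z W kn i this] show "Z = swap_tableau i W" "swap_tableau i W \<in> std k" by auto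
qed

lemma Phi_E:
  assumes W: "W \<in> std k" and i: "1 \<le> i" "i < k"
  shows "Phi i * E k W = (if swap_tableau i W \<in> std k then E k (swap_tableau i W) * Phi i * E k W else 0)"
proof -
  have "Phi i * E k W = (\<Sum>Z\<in>std k. E k Z * Phi i * E k W)"
    using E_expand_left[of "Phi i * E k W"] by (simp add: mult.assoc)
  also have "\<dots> = (if swap_tableau i W \<in> std k then E k (swap_tableau i W) * Phi i * E k W else 0)"
    using E_Phi_E[OF _ W i] by (auto intro!: sum_single finite_std sum.neutral)
  finally show ?thesis .
qed

lemma E_Phi:
  assumes Z: "Z \<in> std k" and i: "1 \<le> i" "i < k"
  shows "E k Z * Phi i = (if swap_tableau i Z \<in> std k then E k Z * Phi i * E k (swap_tableau i Z) else 0)"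
proof -
  have "E k Z * Phi i = (\<Sum>W\<in>std k. E k Z * Phi i * E k W)"
    using E_expand_right[of "E k Z * Phi i"] by simp
  also have "\<dots> = (if swap_tableau i Z \<in> std k then E k Z * Phi i * E k (swap_tableau i Z) else 0)"
  proof -
    have "E k Z * Phi i * E k W = 0" if "W \<in> std k" "W \<noteq> swap_tableau i Z" for W
      using E_Phi_E[OF Z that(1) i] that(2) by force
    then show ?thesis by (auto intro!: sum_single finite_std sum.neutral)
  qed
  finally show ?thesis .
qed

text \<open>On \<open>E k X\<close> from the left the intertwiner is \<open>c - c'\<close> times one
  bracket, and on the idempotent of the exchange from the right it is \<open>c - c'\<close> times
  the other; both products are the same matrix entry. If the exchange is not standard, the entry is
  zero.\<close>

lemma intertwine:
  assumes X: "X \<in> std k" and i: "1 \<le> i" "i < k"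
  defines "c \<equiv> cat X i" and "c' \<equiv> cat X (i + 1)"
  shows "(s i + \<kappa> (p * c' / (c - c'))) * E k X =
    (if swap_tableau i X \<in> std k then E k (swap_tableau i X) else 0) * (s i + \<kappa> (p * c / (c' - c)))"
proof -
  have ne: "c - c' \<noteq> 0" "c' - c \<noteq> 0" using cat_next_ne[OF X kn i] by (auto simp: c_def c'_def)
  have "Phi i * E k X = s i * (J i * E k X) - s i * (J (i + 1) * E k X) + \<kappa> p * (J (i + 1) * E k X)"
    unfolding Phi_def by (simp add: algebra_simps)
  also have "\<dots> = (s i * \<kappa> (c - c') + \<kappa> (p * c')) * E k X"
    using E_eigen[OF X, of i] E_eigen[OF X, of "i + 1"] i unfolding c_def c'_def
    by (simp add: algebra_simps \<kappa>_diff \<kappa>_mult)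
  also have "s i * \<kappa> (c - c') + \<kappa> (p * c') = \<kappa> (c - c') * (s i + \<kappa> (p * c' / (c - c')))"
    using ne by (simp add: distrib_left \<kappa>_mult[symmetric]) (simp add: \<kappa>_comm)
  finally have 1: "Phi i * E k X = \<kappa> (c - c') * ((s i + \<kappa> (p * c' / (c - c'))) * E k X)" by (simp add: mult.assoc)
  show ?thesis
  proof (cases "swap_tableau i X \<in> std k")
    case False
    then show ?thesis using 1 Phi_E[OF X i] \<kappa>_cancel[OF ne(1)] by auto
  next
    case True
    let ?S = "swap_tableau i X"
    have c: "cat ?S i = c'" "cat ?S (i + 1) = c" using cat_swap[OF X i] i by (auto simp: c_def c'_def)
    have "E k ?S * Phi i = E k ?S * J (i + 1) * s i - E k ?S * J i * s i - \<kappa> p * (E k ?S * J (i + 1))"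
      using i kn by (simp add: Phi_alt algebra_simps \<kappa>_left)
    also have "\<dots> = E k ?S * (\<kappa> (c - c') * s i - \<kappa> (p * c))"
    proof -
      have e: "E k ?S * J i = \<kappa> c' * E k ?S" "E k ?S * J (i + 1) = \<kappa> c * E k ?S"
        using E_eigen_right[OF True, of i] E_eigen_right[OF True, of "i + 1"] i c by auto
      have "E k ?S * (\<kappa> (c - c') * s i - \<kappa> (p * c)) = \<kappa> (c - c') * (E k ?S * s i) - \<kappa> (p * c) * E k ?S"
        by (simp only: right_diff_distrib \<kappa>_left \<kappa>_comm[of "p * c" "E k ?S"])
      then show ?thesis unfolding e by (simp only: \<kappa>_diff \<kappa>_mult left_diff_distrib mult.assoc)
    qed
    also have "\<kappa> (c - c') * s i - \<kappa> (p * c) = \<kappa> (c - c') * (s i + \<kappa> (p * c / (c' - c)))"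
    proof -
      have "(c - c') * (p * c / (c' - c)) = - (p * c)" proof -
        have "(c - c') * (a / (c' - c)) = - a" for a using ne(2) by (simp add: divide_simps) (simp add: algebra_simps)
        then show ?thesis .
      qed
      then show ?thesis by (simp only: distrib_left \<kappa>_mult[symmetric] \<kappa>_minus diff_conv_add_uminus)
    qed
    finally have 2: "E k ?S * Phi i = \<kappa> (c - c') * (E k ?S * (s i + \<kappa> (p * c / (c' - c))))" by (simp add: \<kappa>_left)
    have "E k ?S * Phi i = Phi i * E k X"
      using Phi_E[OF X i] E_Phi[OF True i] True X by simp
    then have "\<kappa> (c - c') * ((s i + \<kappa> (p * c' / (c - c'))) * E k X - E k ?S * (s i + \<kappa> (p * c / (c' - c)))) = 0"
      using 1 2 by (simp add: right_diff_distrib)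
    then show ?thesis using \<kappa>_cancel[OF ne(1)] True by fastforce
  qed
qed

end

section \<open>The spectrum of the Jucys--Murphy elements\<close>

declare (in hecke_alg) E.simps [simp del]

context hecke_level
begin

lemma level_below: "j \<le> k \<Longrightarrow> hecke_level \<kappa> m n q v t s j"
  using kn spec by unfold_locales auto

text \<open>Any corner \<rho> can be brought to the last place inside the two-sided ideal generated
  by the idempotent. By induction \<rho> is moved to the last place but one; the final exchange is
  invertible because \<rho> and the last node are both addable to the remaining diagram.\<close>

lemma E_ideal_removable:
  assumes Y: "Y \<in> std k" and D: "is_diag m D" and r: "\<rho> \<in> addable m D" and sh: "shape Y = insert \<rho> D"
  shows "\<exists>Y1 h h'. Y1 \<in> std k \<and> shape Y1 = shape Y \<and> node_of Y1 k = \<rho> \<and> h \<in> Alg k \<and> h' \<in> Alg k \<and>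
    E k Y = h * E k Y1 * h'"
  using hecke_level_axioms Y D r sh
proof (induction k arbitrary: Y D)
  case 0
  then show ?case by (simp add: std_0 shape_def)
next
  case (Suc k)
  interpret L: hecke_level \<kappa> m n q v t s "Suc k" by fact
  interpret L0: hecke_level \<kappa> m n q v t s k by (rule L.level_below) simp
  note Y = Suc.prems(2) and D = Suc.prems(3) and r = Suc.prems(4) and sh = Suc.prems(5)
  have k: "k < n" using L.kn by simp
  let ?\<alpha> = "node_of Y (Suc k)" and ?Y' = "remove_entry (Suc k) Y"
  note Y' = std_remove[OF Y]
  have shY: "shape Y = insert ?\<alpha> (pre Y k)" using pre_n[OF Y] pre_Suc[OF Y, of k] by simp
  have a: "?\<alpha> \<in> addable m (pre Y k)" using node_of_addable[OF Y, of k] by simp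
  show ?case
  proof (cases "?\<alpha> = \<rho>")
    case True
    then show ?thesis using Y Alg_1[of "Suc k"] by (intro exI[of _ Y] exI[of _ 1]) auto
  next
    case False
    \<comment> \<open>The diagram with both corners removed, \<rho> and the node of the largest
      entry.\<close>
    define D2 where "D2 = D \<inter> pre Y k"
    have D2: "is_diag m D2" unfolding D2_def using D pre_diag[OF Y, of k] by (auto simp: is_diag_vnode)
    have aux: "P = insert y (D \<inter> P) \<and> D = insert x (D \<inter> P)"
      if "insert y D = insert x P" "x \<noteq> y" "x \<notin> P" "y \<notin> D" for P and x y :: mnode
      using that unfolding Set.set_eq_iff insert_iff Int_iff by metis
    have "insert \<rho> D = insert ?\<alpha> (pre Y k)" using sh shY by simp
    from aux[OF this False addable_notin[OF a] addable_notin[OF r]]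
    have nu: "pre Y k = insert \<rho> D2" and DD: "D = insert ?\<alpha> D2" unfolding D2_def by blast+
    have r2: "\<rho> \<in> addable m D2" using addable_notin[OF r] nu pre_diag[OF Y, of k]
      unfolding addable_def is_mdiagram_iff D2_def by auto
    have a2: "?\<alpha> \<in> addable m D2" using addable_notin[OF a] DD D
      unfolding addable_def is_mdiagram_iff D2_def by auto
    have "shape ?Y' = insert \<rho> D2" using Y'(2) nu by simp
    from Suc.IH[OF L0.hecke_level_axioms Y'(1) D2 r2 this] obtain Y1 h h' where
      Y1: "Y1 \<in> std k" "shape Y1 = shape ?Y'" "node_of Y1 k = \<rho>" and h: "h \<in> Alg k" "h' \<in> Alg k"
      "E k ?Y' = h * E k Y1 * h'" by blast
    have k1: "1 \<le> k"
    proof (rule ccontr)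
      assume "\<not> 1 \<le> k"
      then show False using nu by (simp add: not_le)
    qed
    have aY1: "?\<alpha> \<in> addable m (shape Y1)" using a Y1(2) Y'(2) by simp
    define X1 where "X1 = Y1(?\<alpha> := Suc k)"
    note X1 = std_extend[OF Y1(1) aY1, folded X1_def]
    define e where "e = pev (Lag (shape Y1) ?\<alpha>) (J (Suc k))"
    have "E (Suc k) Y = e * (h * E k Y1 * h')"
      unfolding E_Suc[OF Y k] h(3)[symmetric] e_def Y1(2) Y'(2) ..
    also have "\<dots> = h * (e * E k Y1) * h'"
    proof -
      have "e * h = h * e" unfolding e_def using pev_comm[OF J_Alg[OF k h(1), symmetric], symmetric] .
      then show ?thesis by (metis mult.assoc)
    qed
    also have "e * E k Y1 = E (Suc k) X1" unfolding e_def X1_def using E_extend[OF Y1(1) aY1 k] by simp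
    finally have EY: "E (Suc k) Y = h * E (Suc k) X1 * h'" .
    have i: "1 \<le> k" "k < Suc k" using k1 by auto
    have n1: "node_of X1 k = \<rho>" using node_of_remove[OF X1(1), of k] k1 Y1(3) X1(2) by simp
    have p1: "pre X1 (k - 1) = D2"
    proof -
      have "pre X1 k = pre Y k" using pre_n[OF Y1(1)] Y1(2) Y'(2) pre_remove[of k k X1] X1(2) by simp
      moreover have "pre X1 k = insert \<rho> (pre X1 (k - 1))" using two_nodes(5)[OF X1(1) i] n1 by simp
      moreover have "\<rho> \<notin> pre X1 (k - 1)" using two_nodes(3)[OF X1(1) i] n1 addable_notin by auto
      ultimately show ?thesis using nu addable_notin[OF r2] by auto
    qed
    have sw: "swap_tableau k X1 \<in> std (Suc k)" using swap_std_iff[OF X1(1) i] p1 X1(3) a2 by simp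
    let ?S = "swap_tableau k X1"
    \<comment> \<open>The scalar by which the square of \<open>Phi k\<close> acts on
      \<open>E (Suc k) X1\<close>; being nonzero, it lets the idempotent be recovered from the one
      of the exchanged tableau.\<close>
    define g where "g = (p * p + 2) * cat X1 k * cat X1 (k + 1) - cat X1 k * cat X1 k - cat X1 (k + 1) * cat X1 (k + 1)"
    have g: "g \<noteq> 0" unfolding g_def
      by (rule Phi_sq_nonzero; rule swap_not_q2[OF X1(1) L.kn i sw])
    have "\<kappa> g * E (Suc k) X1 = Phi k * (Phi k * E (Suc k) X1)" unfolding g_def
      by (rule Phi_sq_eigen[symmetric]) (use i k L.E_eigen[OF X1(1)] in auto)
    also have "Phi k * E (Suc k) X1 = E (Suc k) ?S * Phi k * E (Suc k) X1" using L.Phi_E[OF X1(1) i] sw by simp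
    finally have eq: "\<kappa> (inverse g) * (Phi k * (E (Suc k) ?S * Phi k * E (Suc k) X1)) = E (Suc k) X1"
      using \<kappa>_inverse[OF g] by metis
    have "E (Suc k) Y = h * (\<kappa> (inverse g) * (Phi k * (E (Suc k) ?S * Phi k * E (Suc k) X1))) * h'"
      unfolding eq by (rule EY)
    then have "E (Suc k) Y = (h * \<kappa> (inverse g) * Phi k) * E (Suc k) ?S * (Phi k * E (Suc k) X1 * h')"
      by (simp only: mult.assoc)
    moreover have "h * \<kappa> (inverse g) * Phi k \<in> Alg (Suc k)" "Phi k * E (Suc k) X1 * h' \<in> Alg (Suc k)"
      using h i by (auto intro!: Alg_mult Alg_scalar Alg_Phi Alg_E intro: Alg_mono[of k])
    moreover have "shape ?S = shape Y" using shape_swap[OF k1] X1(4) Y1(2) Y'(2) shY by simp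
    moreover have "node_of ?S (Suc k) = \<rho>" using node_of_swap[OF X1(1) i, of "Suc k"] n1 by simp
    ultimately show ?thesis using sw by blast
  qed
qed

lemma E_last_ne:
  assumes w: "E k Y * w = w" "Y \<in> std k" "k < n" and sp: "spectral k" and c: "J (Suc k) * w = \<kappa> c * w"
    and nz: "\<And>\<beta>. \<beta> \<in> addable m (shape Y) \<Longrightarrow> ct \<beta> \<noteq> c"
  shows "w = 0"
proof -
  have "\<kappa> (poly (Qp (shape Y)) c) * w = pev (Qp (shape Y)) (J (Suc k)) * (E k Y * w)"
    unfolding w(1) using pev_eigen[OF c] by simp
  also have "\<dots> = 0" using sp w(2) unfolding spectral_def by (simp add: mult.assoc[symmetric])
  finally show ?thesis using \<kappa>_cancel Qp_at[OF shape_diag[OF w(2)]] nz by blast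
qed

end

lemma (in hecke_alg) Phi_eigen:
  assumes i: "1 \<le> i" "i < n" and w: "J i * w = \<kappa> a * w" "J (i + 1) * w = \<kappa> b * w"
  shows "J i * (Phi i * w) = \<kappa> b * (Phi i * w)" "J (i + 1) * (Phi i * w) = \<kappa> a * (Phi i * w)"
    "Phi i * w = \<kappa> (a - b) * (s i * w) + \<kappa> (p * b) * w"
proof -
  have "J i * (Phi i * w) = Phi i * (J (i + 1) * w)" using Phi_J1[OF i] by (simp add: mult.assoc[symmetric])
  then show "J i * (Phi i * w) = \<kappa> b * (Phi i * w)" unfolding w by (simp add: \<kappa>_left)
  have "J (i + 1) * (Phi i * w) = Phi i * (J i * w)" using Phi_J[OF i] by (simp add: mult.assoc[symmetric])
  then show "J (i + 1) * (Phi i * w) = \<kappa> a * (Phi i * w)" unfolding w by (simp add: \<kappa>_left)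
  have "Phi i * w = s i * (J i * w) - s i * (J (i + 1) * w) + \<kappa> p * (J (i + 1) * w)"
    unfolding Phi_def by (simp add: algebra_simps)
  then show "Phi i * w = \<kappa> (a - b) * (s i * w) + \<kappa> (p * b) * w"
    by (simp only: w \<kappa>_left[of "s i"] \<kappa>_diff left_diff_distrib \<kappa>_mult mult.assoc)
qed

lemma (in hecke_alg) s_scalar_of_Phi_0:
  assumes i: "1 \<le> i" "i < n" and w: "J i * w = \<kappa> a * w" "J (i + 1) * w = \<kappa> b * w" and ab: "a \<noteq> b"
    and z: "Phi i * w = 0"
  shows "s i * w = \<kappa> (p * b / (b - a)) * w"
proof -
  have "\<kappa> (a - b) * (s i * w) = - (\<kappa> (p * b) * w)"
    using Phi_eigen(3)[OF i w] z by (metis eq_neg_iff_add_eq_0)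
  then have "\<kappa> (inverse (a - b)) * (\<kappa> (a - b) * (s i * w)) = \<kappa> (inverse (a - b)) * (\<kappa> (- (p * b)) * w)"
    by (simp add: \<kappa>_minus)
  then have "s i * w = \<kappa> (inverse (a - b) * (- (p * b))) * w"
    using ab by (simp only: \<kappa>_inverse right_minus_eq not_False_eq_True \<kappa>_mult mult.assoc)
  also have "inverse (a - b) * (- (p * b)) = p * b / (b - a)"
    using ab by (simp add: divide_inverse) (metis inverse_minus_eq minus_diff_eq minus_mult_minus mult.commute mult_minus_right)
  finally show ?thesis .
qed

text \<open>A vector with contents \<open>b, a, b\<close> at three consecutive places, both of whose exchanges are forbidden,
  would let both generators act by scalars, against the braid relation.\<close>

lemma (in hecke_alg) no_aba:
  assumes i: "1 \<le> i" "i + 1 < n" and w: "s i * w = \<kappa> (p * a / (a - b)) * w" "s (i + 1) * w = \<kappa> (p * b / (b - a)) * w"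
    and ab: "a \<noteq> b" "a + b \<noteq> 0" "a \<noteq> 0" "b \<noteq> 0"
  shows "w = 0"
proof -
  define x y where xy: "x = p * a / (a - b)" "y = p * b / (b - a)"
  have "q\<^sup>2 \<noteq> 1" using q_pow[of 1] i by simp
  then have p0: "p \<noteq> 0" using q0 by (auto simp: field_simps power2_eq_square)
  have S: "s i * (s (i + 1) * (s i * w)) = \<kappa> (x * y * x) * w" "s (i + 1) * (s i * (s (i + 1) * w)) = \<kappa> (y * x * y) * w"
    using w[folded xy] by (simp_all only: \<kappa>_left[of "s i"] \<kappa>_left[of "s (i + 1)"] \<kappa>_mult mult.assoc)
  \<comment> \<open>For two generators acting by scalars \<open>x\<close> and \<open>y\<close> the
    braid relation reads \<open>x * y * (x - y) = 0\<close>; here \<open>x - y\<close> is a multiple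
    of \<open>a + b\<close>.\<close>
  have "\<kappa> (x * y * x) * w = \<kappa> (y * x * y) * w"
    using braid[OF i] S by (metis mult.assoc)
  then have "\<kappa> (x * y * x - y * x * y) * w = 0" by (simp add: \<kappa>_diff left_diff_distrib)
  moreover have "x * y * x - y * x * y = x * y * (x - y)" by (simp add: algebra_simps)
  moreover have "x - y = p * (a + b) / (a - b)" unfolding xy using ab by (simp add: divide_simps) (simp add: algebra_simps)
  moreover have "x * y * (p * (a + b) / (a - b)) \<noteq> 0" unfolding xy using ab p0 by simp
  ultimately show ?thesis using \<kappa>_cancel[of "x * y * (p * (a + b) / (a - b))" w] by metis
qed

lemma commute_fixed: "b * a = a * b \<Longrightarrow> a * u = u \<Longrightarrow> a * (b * u) = b * u" for a b u :: "'a::semigroup_mult"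
  by (metis mult.assoc)

lemma (in hecke_alg) Phi_commute:
  assumes "J i * y = y * J i" "J (i + 1) * y = y * J (i + 1)" "s i * y = y * s i"
  shows "Phi i * y = y * Phi i"
  unfolding Phi_def using assms by (simp add: algebra_simps \<kappa>_left) (metis mult.assoc)

context hecke_level
begin

text \<open>The tableau can be exchanged for one whose last node is the removable node \<open>\<rho>\<close>; then the contents
  \<open>ct \<rho>, ct \<alpha>, ct \<rho>\<close> occur consecutively and \<open>no_aba\<close> applies. This excludes the eigenvalues of the
  neighbours of \<open>\<alpha>\<close> that are not addable.\<close>

lemma cancel_removable:
  assumes k: "1 \<le> k" "k < n" and Y': "Y' \<in> std (k - 1)"
    and D: "is_diag m D" and r: "\<rho> \<in> addable m D" and sh: "shape Y' = insert \<rho> D"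
    and a: "\<alpha> \<in> addable m (shape Y')" and na: "\<alpha> \<notin> addable m D"
    and w: "E (k - 1) Y' * w = w" "J k * w = \<kappa> (ct \<alpha>) * w" "J (k + 1) * w = \<kappa> (ct \<rho>) * w"
    and ab: "ct \<alpha> + ct \<rho> \<noteq> 0"
  shows "w = 0"
proof -
  interpret L: hecke_level \<kappa> m n q v t s "k - 1" by (rule level_below) simp
  obtain Y1 h h' where Y1: "Y1 \<in> std (k - 1)" "shape Y1 = shape Y'" "node_of Y1 (k - 1) = \<rho>"
    and h: "h \<in> Alg (k - 1)" "h' \<in> Alg (k - 1)" "E (k - 1) Y' = h * E (k - 1) Y1 * h'"
    using L.E_ideal_removable[OF Y' D r sh] by blast
  have card: "card (shape Y') = k - 1" using card_shape[OF Y'] .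
  have card2: "card D + 1 = k - 1" using card sh card_insert_addable[OF D r] by simp
  then have k2: "2 \<le> k" by simp
  \<comment> \<open>The original vector is \<open>h * u\<close>, so it suffices to kill
    \<open>u\<close>. This vector has the same contents at the places \<open>k\<close> and
    \<open>k + 1\<close>, but now \<rho> also occupies the place \<open>k - 1\<close>.\<close>
  define u where "u = E (k - 1) Y1 * (h' * w)"
  have hw: "w = h * u" unfolding u_def using w(1) h(3) by (metis mult.assoc)
  let ?a = "ct \<alpha>" and ?b = "ct \<rho>"
  have comm: "J k * y = y * J k" "J (k + 1) * y = y * J (k + 1)" if "y \<in> Alg (k - 1)" for y
    using J_Alg[of "k - 1" y] J_Alg[of k y] Alg_mono[of "k - 1" k y] that k by auto
  have uE: "E (k - 1) Y1 * u = u" unfolding u_def using L.E_idem'[OF Y1(1)] .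
  have pull: "x * u = \<kappa> c * u" if "x * E (k - 1) Y1 = E (k - 1) Y1 * x" "x * h' = h' * x" "x * w = \<kappa> c * w" for x c
  proof -
    have "x * u = (x * E (k - 1) Y1) * (h' * w)" by (simp only: u_def mult.assoc)
    also have "\<dots> = E (k - 1) Y1 * ((x * h') * w)" unfolding that(1) by (simp only: mult.assoc)
    also have "\<dots> = E (k - 1) Y1 * (h' * (x * w))" unfolding that(2) by (simp only: mult.assoc)
    finally show ?thesis unfolding that(3) u_def by (simp only: \<kappa>_left[of h'] \<kappa>_left[of "E (k - 1) Y1"])
  qed
  have ua: "J k * u = \<kappa> ?a * u" using pull[OF comm(1)[OF Alg_E] comm(1)[OF h(2)] w(2)] .
  have ub: "J (k + 1) * u = \<kappa> ?b * u" using pull[OF comm(2)[OF Alg_E] comm(2)[OF h(2)] w(3)] .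
  have "J (k - 1) * E (k - 1) Y1 = \<kappa> ?b * E (k - 1) Y1"
    using L.E_eigen[OF Y1(1), of "k - 1"] k2 Y1(3) by (simp add: content_at_def)
  then have uc: "J (k - 1) * u = \<kappa> ?b * u" unfolding u_def mult.assoc[symmetric] by (simp add: mult.assoc)
  have ne: "?a \<noteq> ?b" using ct_next_ne[OF D _ r, of \<alpha>] a sh card2 k by simp
  have cD: "card D + 2 < n" using card2 k by simp
  have aI: "\<alpha> \<in> addable m (insert \<rho> D)" using a sh by simp
  note RC = removable_contents[OF D cD r aI na]
  have e1: "k - 1 + 1 = k" using k by simp
  have i0: "1 \<le> k - 1" "k - 1 < n" and i1: "1 \<le> k" "k < n" using k k2 by auto
  have ua': "J (k - 1 + 1) * u = \<kappa> ?a * u" unfolding e1 by (rule ua)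
  \<comment> \<open>The exchange would put the content of \<rho> at place \<open>k\<close>,
    immediately after \<rho> itself.\<close>
  have P1: "Phi k * u = 0"
  proof (rule L.E_last_ne[where Y = Y1 and c = ?b])
    show "E (k - 1) Y1 * (Phi k * u) = Phi k * u"
    proof -
      have "Phi k * E (k - 1) Y1 = E (k - 1) Y1 * Phi k"
      proof -
        have c: "J k * E (k - 1) Y1 = E (k - 1) Y1 * J k" "J (k + 1) * E (k - 1) Y1 = E (k - 1) Y1 * J (k + 1)"
          "s k * E (k - 1) Y1 = E (k - 1) Y1 * s k"
          using comm[OF Alg_E] s_Alg[OF _ _ Alg_E, of "k - 1" k] k by auto
        then show ?thesis by (rule Phi_commute)
      qed
      then show ?thesis using uE by (metis mult.assoc)
    qed
    show "spectral (k - 1)" using spec[of "k - 1"] k by simp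
    show "J (Suc (k - 1)) * (Phi k * u) = \<kappa> ?b * (Phi k * u)"
      using Phi_eigen(1)[OF i1 ua ub] e1 by simp
    show "\<And>\<beta>. \<beta> \<in> addable m (shape Y1) \<Longrightarrow> ct \<beta> \<noteq> ?b" using RC(1) Y1(2) sh by simp
  qed (use Y1(1) k in auto)
  \<comment> \<open>The exchange would put the content of \<alpha> at place \<open>k - 1\<close>,
    where only the nodes of \<open>D\<close> are present.\<close>
  have P0: "Phi (k - 1) * u = 0"
  proof -
    interpret L2: hecke_level \<kappa> m n q v t s "k - 2" by (rule level_below) simp
    have e2: "k - 1 = Suc (k - 2)" using k2 by simp
    have Y1S: "Y1 \<in> std (Suc (k - 2))" using Y1(1) e2 by simp
    let ?Y2 = "remove_entry (Suc (k - 2)) Y1"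
    note Y2 = std_remove[OF Y1S]
    have EE: "E (k - 2) ?Y2 * E (k - 1) Y1 = E (k - 1) Y1"
      unfolding e2 E.simps(2) by (simp only: L2.E_idem'[OF Y2(1)])
    show ?thesis
    proof (rule L2.E_last_ne[where Y = ?Y2 and c = ?a])
      have "Phi (k - 1) * E (k - 2) ?Y2 = E (k - 2) ?Y2 * Phi (k - 1)"
      proof -
        have c: "J (k - 1) * E (k - 2) ?Y2 = E (k - 2) ?Y2 * J (k - 1)" "J k * E (k - 2) ?Y2 = E (k - 2) ?Y2 * J k"
          "s (k - 1) * E (k - 2) ?Y2 = E (k - 2) ?Y2 * s (k - 1)"
          using J_E[of "k - 1" "k - 2"] J_E[of k "k - 2"] s_Alg[OF _ _ Alg_E, of "k - 2" "k - 1"] k k2 by auto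
        show ?thesis by (rule Phi_commute) (use c e1 in simp_all)
      qed
      moreover have "E (k - 2) ?Y2 * u = u"
      proof -
        have "E (k - 2) ?Y2 * u = (E (k - 2) ?Y2 * E (k - 1) Y1) * u" by (simp only: mult.assoc uE)
        then show ?thesis unfolding EE uE .
      qed
      ultimately show "E (k - 2) ?Y2 * (Phi (k - 1) * u) = Phi (k - 1) * u"
        by (rule commute_fixed)
      show "spectral (k - 2)" using spec[of "k - 2"] k2 by simp
      show "J (Suc (k - 2)) * (Phi (k - 1) * u) = \<kappa> ?a * (Phi (k - 1) * u)"
        using Phi_eigen(1)[OF i0 uc ua'] e2 by simp
      have "pre Y1 (k - 2) = D"
      proof -
        have "insert \<rho> (pre Y1 (k - 2)) = insert \<rho> D"
          using pre_n[OF Y1S] pre_Suc[OF Y1S, of "k - 2"] Y1(2,3) sh e2 by simp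
        moreover have "\<rho> \<notin> pre Y1 (k - 2)" using node_of_addable[OF Y1S, of "k - 2"] Y1(3) e2 addable_notin by auto
        ultimately show ?thesis using addable_notin[OF r] by (metis insert_ident)
      qed
      then show "\<And>\<beta>. \<beta> \<in> addable m (shape ?Y2) \<Longrightarrow> ct \<beta> \<noteq> ?a" using RC(2) Y2(2) by simp
    qed (use Y2(1) k in auto)
  qed
  have "s (k - 1) * u = \<kappa> (p * ?a / (?a - ?b)) * u"
    using s_scalar_of_Phi_0[OF i0 uc ua' ne[symmetric] P0] .
  moreover have "s (k - 1 + 1) * u = \<kappa> (p * ?b / (?b - ?a)) * u"
    using s_scalar_of_Phi_0[OF i1 ua ub ne P1] e1 by simp
  moreover have "?a \<noteq> 0" "?b \<noteq> 0" using ct_nz[OF D r] ct_nz[OF addable_diag[OF r] aI] by auto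
  ultimately have "u = 0" using no_aba[OF i0(1) _ _ _ ne ab] k e1 by simp
  then show ?thesis using hw by simp
qed

text \<open>A repeated content would make \<open>w\<close> and \<open>s k * w\<close> span a Jordan
  block of \<open>J k\<close>: subtracting the eigenvalue sends \<open>s k * w\<close> to a nonzero
  scalar times \<open>w\<close>. The simple roots of the annihilating polynomial of
  \<open>J k\<close> on \<open>E (k - 1) Y'\<close> exclude this unless
  \<open>w = 0\<close>.\<close>

lemma cancel_equal:
  assumes k: "1 \<le> k" "k < n" and Y': "Y' \<in> std (k - 1)" and a: "\<alpha> \<in> addable m (shape Y')"
    and w: "E (k - 1) Y' * w = w" "J k * w = \<kappa> (ct \<alpha>) * w" "J (k + 1) * w = \<kappa> (ct \<alpha>) * w"
  shows "w = 0"
proof -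
  let ?c = "ct \<alpha>" and ?M = "\<Prod>\<beta>\<in>addable m (shape Y') - {\<alpha>}. [:- ct \<beta>, 1:]"
  have D: "is_diag m (shape Y')" "card (shape Y') < n" using shape_diag[OF Y'] card_shape[OF Y'] k by auto
  have Q: "Qp (shape Y') = ?M * [:- ?c, 1:]"
    unfolding Qp_def using finite_addable[OF D(1)] a by (subst prod.remove[of _ \<alpha>]) (auto simp: mult.commute)
  have nz: "poly ?M ?c \<noteq> 0" unfolding poly_prod using ct_inj[OF D] a finite_addable[OF D(1)]
    by (auto dest: inj_onD)
  have sp: "spectral (k - 1)" using spec[of "k - 1"] k by simp
  have s1: "s k * E (k - 1) Y' = E (k - 1) Y' * s k" using s_Alg[OF _ _ Alg_E, of "k - 1" k] k by auto
  define y where "y = s k * w"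
  have y: "E (k - 1) Y' * y = y" unfolding y_def using s1 w(1) by (metis mult.assoc)
  have i: "1 \<le> k" "k < n" using k by auto
  define z where "z = J k * y - \<kappa> ?c * y"
  have "J k * s k = s k * J (k + 1) - \<kappa> p * J (k + 1)" using s_J1[OF i] by simp
  then have "J k * y = s k * (J (k + 1) * w) - \<kappa> p * (J (k + 1) * w)"
    unfolding y_def by (metis mult.assoc left_diff_distrib)
  then have z: "z = - (\<kappa> (p * ?c) * w)" unfolding z_def y_def w(3)
    by (simp only: \<kappa>_left[of "s k"] \<kappa>_mult mult.assoc) simp
  have "J k * z = \<kappa> ?c * z" unfolding z mult_minus_right \<kappa>_left[of "J k"] w(2)
    by (simp only: mult_minus_right \<kappa>_left[of "\<kappa> ?c" "p * ?c"])
  then have "\<kappa> (poly ?M ?c) * z = pev ?M (J k) * z" by (rule pev_eigen[symmetric])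
  also have zz: "z = pev [:- ?c, 1:] (J k) * y" unfolding z_def by (simp add: \<kappa>_minus \<kappa>_1 \<kappa>_0 distrib_right left_diff_distrib)
  also have "pev ?M (J k) * (pev [:- ?c, 1:] (J k) * y) = pev (Qp (shape Y')) (J k) * (E (k - 1) Y' * y)"
    unfolding Q pev_mult y by (simp only: mult.assoc)
  also have "\<dots> = 0" using sp Y' k unfolding spectral_def by (simp add: mult.assoc[symmetric])
  finally have "z = 0" unfolding zz by (rule \<kappa>_cancel[OF nz])
  moreover have "p \<noteq> 0" using q_pow[of 1] q0 k by (auto simp: field_simps power2_eq_square)
  ultimately show ?thesis using z ct_nz[OF D(1) a] \<kappa>_cancel[of "p * ?c" w] by simp
qed

end

lemma (in central_scalars) pev_linear: "pev [:- c, 1:] y = y - \<kappa> c"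
  by (simp add: \<kappa>_minus \<kappa>_1 \<kappa>_0)

context hecke_level
begin

text \<open>The product that remains after removing the factor is itself an eigenvector for
  \<open>c\<close>, to which the hypothesis on eigenvectors applies.\<close>

lemma pev_cancel_factor:
  assumes Y: "Y \<in> std k" and k: "k < n" and z: "pev ([:- c, 1:] * F) (J (k + 1)) * E k Y = 0"
    and c: "\<And>w. E k Y * w = w \<Longrightarrow> J (k + 1) * w = \<kappa> c * w \<Longrightarrow> w = 0"
  shows "pev F (J (k + 1)) * E k Y = 0"
proof (rule c)
  show "E k Y * (pev F (J (k + 1)) * E k Y) = pev F (J (k + 1)) * E k Y"
    using pev_J_E[of "k + 1" k F Y] k by (intro commute_fixed E_idem Y) simp
  have "J (k + 1) * (pev F (J (k + 1)) * E k Y) - \<kappa> c * (pev F (J (k + 1)) * E k Y) = 0"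
    using z unfolding pev_mult pev_linear by (simp only: left_diff_distrib mult.assoc)
  then show "J (k + 1) * (pev F (J (k + 1)) * E k Y) = \<kappa> c * (pev F (J (k + 1)) * E k Y)" by simp
qed

lemma spectral_0:
  assumes "k = 0" shows "spectral k"
proof -
  have sh: "shape (\<lambda>_. 0) = {}" by (simp add: shape_def)
  have D: "is_diag m {}" by (simp add: is_diag_def)
  have "addable m {} = (\<lambda>j. (j, 1, 1)) ` {1..m}"
  proof (intro Set.set_eqI iffI)
    fix \<alpha> assume a: "\<alpha> \<in> addable m {}"
    obtain i r s where e: "\<alpha> = (i, r, s)" by (cases \<alpha>)
    have val: "i \<in> {1..m}" "1 \<le> r" "1 \<le> s" using addable_valid[OF D] a e by auto
    have "nle (i, 1, 1) \<alpha>" using e val by (simp add: nle_def)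
    then have "\<alpha> = (i, 1, 1)" using addable_below[OF D a] by blast
    then show "\<alpha> \<in> (\<lambda>j. (j, 1, 1)) ` {1..m}" using val by blast
  next
    fix \<alpha> :: mnode assume "\<alpha> \<in> (\<lambda>j. (j, 1, 1)) ` {1..m}"
    then show "\<alpha> \<in> addable m {}" unfolding addable_iff[OF D] by (auto simp: vnode_def nle_def)
  qed
  then have "Qp {} = (\<Prod>j\<in>{1..m}. [:- v j, 1:])"
  proof -
    assume *: "addable m {} = (\<lambda>j. (j, 1, 1)) ` {1..m}"
    have "ct (j, 1, 1) = v j" for j unfolding Defs.content_def by simp
    then show ?thesis unfolding Qp_def * by (subst prod.reindex) (auto simp: inj_on_def)
  qed
  then show ?thesis using cyc assms unfolding spectral_def by (simp add: std_0 sh E.simps)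
qed

lemma spectral_step:
  assumes k: "1 \<le> k" "k < n"
  shows "spectral k"
  unfolding spectral_def
proof
  fix Y assume Y: "Y \<in> std k"
  define \<alpha> where "\<alpha> = node_of Y k"
  define \<nu> where "\<nu> = pre Y (k - 1)"
  have kS: "k = Suc (k - 1)" using k by simp
  have YS: "Y \<in> std (Suc (k - 1))" using Y kS by simp
  define Y' where "Y' = remove_entry k Y"
  have Y': "Y' \<in> std (k - 1)" "shape Y' = \<nu>" using std_remove[OF YS] kS unfolding Y'_def \<nu>_def by auto
  have a: "\<alpha> \<in> addable m \<nu>" unfolding \<alpha>_def \<nu>_def using node_of_addable'[OF Y] k by simp
  have D: "is_diag m \<nu>" "card \<nu> = k - 1" using shape_diag[OF Y'(1)] card_shape[OF Y'(1)] Y'(2) by auto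
  have shY: "shape Y = insert \<alpha> \<nu>" unfolding \<alpha>_def \<nu>_def using pre_n[OF YS] pre_Suc[OF YS, of "k - 1"] kS by simp
  define e e' x y f where d: "e = E k Y" "e' = E (k - 1) Y'" "x = J k" "y = J (k + 1)" "f = Phi k"
  define M R where MR: "M = Qp \<nu>" "R = (\<Prod>\<beta>\<in>addable m \<nu> - {\<alpha>}. [:- ct \<beta>, 1:])"
  let ?a = "ct \<alpha>" and ?b = "ct (rt \<alpha>)" and ?c = "ct (dn \<alpha>)"
  interpret L: hecke_level \<kappa> m n q v t s "k - 1" by (rule level_below) simp
  have i: "1 \<le> k" "k < n" using k by auto
  have M: "M = [:- ?a, 1:] * R"
    unfolding MR Qp_def using finite_addable[OF D(1)] a by (subst prod.remove[of _ \<alpha>]) auto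
  have e'e: "e' * e = e"
  proof -
    have "e = e' * pev (Lag (shape Y') \<alpha>) (J k)" unfolding d \<alpha>_def Y'_def using E.simps(2)[of "k - 1" Y] kS by simp
    then show ?thesis using L.E_idem'[OF Y'(1)] d by simp
  qed
  have xe: "x * e = \<kappa> ?a * e" using E_eigen[OF Y, of k] k unfolding d \<alpha>_def content_at_def by simp
  have fE: "f * e' = e' * f" unfolding d
    using J_E[of k "k - 1" Y'] J_E[of "k + 1" "k - 1" Y'] s_Alg[OF _ _ Alg_E, of "k - 1" k Y'] k
    by (intro Phi_commute) auto
  have Mx: "pev M x * e' = 0" 
  proof -
    have "spectral (k - 1)" using spec[of "k - 1"] k by simp
    then have "pev (Qp (shape Y')) (J (Suc (k - 1))) * E (k - 1) Y' = 0"
      using Y'(1) unfolding spectral_def by blast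
    then show ?thesis unfolding MR d Y'(2) kS[symmetric] .
  qed
  have fM: "f * pev M y = pev M x * f" unfolding d using Phi_J1[OF i] by (intro pev_swap) simp
  \<comment> \<open>The polynomial \<open>M\<close> annihilates \<open>x\<close> on
    \<open>e'\<close>, and \<open>f\<close> turns \<open>y\<close> into \<open>x\<close>, so
    \<open>f\<close> kills this vector. Applying \<open>f\<close> again gives an equation of degree
    two in \<open>y\<close>, because \<open>x\<close> acts on \<open>w\<close> by a scalar.\<close>
  define w where "w = pev M y * e"
  have "f * w = pev M x * (f * (e' * e))" unfolding w_def e'e by (metis fM mult.assoc)
  also have "\<dots> = (pev M x * e') * (f * e)" by (metis fE mult.assoc)
  finally have fw: "f * w = 0" using Mx by simp
  have xy: "x * y = y * x" unfolding d using J_J[of k "k + 1"] k by simp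
  have "x * pev M y = pev M y * x" by (rule pev_comm) (rule xy)
  then have xw: "x * w = \<kappa> ?a * w" unfolding w_def using xe by (metis \<kappa>_left mult.assoc)
  have "(f * f) * w = \<kappa> (p * p + 2) * (y * (x * w)) - x * (x * w) - y * (y * w)"
    unfolding d Phi_sq[OF i] using xy[unfolded d] by (simp add: left_diff_distrib mult.assoc)
  also have "\<dots> = pev [:- (?a * ?a), (p * p + 2) * ?a, - 1:] y * w"
  proof -
    have 1: "\<kappa> (p * p + 2) * (y * (x * w)) = y * (\<kappa> ((p * p + 2) * ?a) * w)" 
      unfolding xw \<kappa>_left[of y] by (simp only: \<kappa>_mult mult.assoc)
    have 2: "x * (x * w) = \<kappa> (?a * ?a) * w" unfolding xw \<kappa>_left[of x] by (simp only: \<kappa>_mult mult.assoc)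
    show ?thesis unfolding 1 2 by (simp add: \<kappa>_minus \<kappa>_0 \<kappa>_1 algebra_simps)
  qed
  finally have "pev [:- (?a * ?a), (p * p + 2) * ?a, - 1:] y * w = 0" using fw by (simp add: mult.assoc)
  \<comment> \<open>The roots are the contents of the right and the lower neighbour: their product
    is \<open>?a * ?a\<close> and their sum is \<open>(p * p + 2) * ?a\<close>.\<close>
  moreover have "[:- (?a * ?a), (p * p + 2) * ?a, - 1:] = - ([:- ?b, 1:] * [:- ?c, 1:])"
  proof -
    have bc: "?b = q\<^sup>2 * ?a" "?c = ?a / q\<^sup>2" using ct_rt[of \<alpha>] ct_dn[of \<alpha>] q0 by (auto simp: field_simps)
    show ?thesis unfolding bc using q0 by (simp add: field_simps power2_eq_square)
  qed
  ultimately have z0: "pev ([:- ?a, 1:] * ([:- ?b, 1:] * ([:- ?c, 1:] * R))) (J (k + 1)) * E k Y = 0"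
  proof -
    assume "pev [:- (?a * ?a), (p * p + 2) * ?a, - 1:] y * w = 0"
      "[:- (?a * ?a), (p * p + 2) * ?a, - 1:] = - ([:- ?b, 1:] * [:- ?c, 1:])"
    then have "pev ([:- ?b, 1:] * [:- ?c, 1:]) y * (pev ([:- ?a, 1:] * R) y * e) = 0"
      unfolding w_def M by (simp only: pev_minus mult_minus_left neg_equal_0_iff_equal)
    then have "pev ([:- ?b, 1:] * [:- ?c, 1:] * ([:- ?a, 1:] * R)) y * e = 0"
      unfolding pev_mult[of "[:- ?b, 1:] * [:- ?c, 1:]"] by (simp only: mult.assoc[of "pev _ _" "pev _ _" e])
    then show ?thesis unfolding d by (simp only: mult.assoc mult.left_commute[of "[:- ?a, 1:]"])
  qed
  have eE: "e' * w = w" "x * w = \<kappa> ?a * w" if "e * w = w" for w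
    using that e'e xe by (metis mult.assoc)+
  have z1: "pev ([:- ?b, 1:] * ([:- ?c, 1:] * R)) (J (k + 1)) * E k Y = 0"
    by (rule pev_cancel_factor[OF Y k(2) z0], rule cancel_equal[OF k Y'(1), of \<alpha>])
      (use eE a Y'(2) in \<open>auto simp: d\<close>)
  \<comment> \<open>Contents of neighbouring nodes differ by the factor \<open>q\<^sup>2\<close>, so
    this makes their sum nonzero, as \<open>cancel_removable\<close> requires. It uses
    \<open>q_pow\<close> at the exponent 4, available because \<open>1 \<le> k < n\<close>.\<close>
  have q4: "1 + q\<^sup>2 \<noteq> 0"
  proof
    assume "1 + q\<^sup>2 = 0"
    then have "q\<^sup>2 = - 1" by (metis add_eq_0_iff)
    then have "q ^ (2 * 2) = 1" by (simp only: power_mult) simp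
    then show False using q_pow[of 2] k by linarith
  qed
  have cz: "?a \<noteq> 0" using ct_nz[OF D(1) a] .
  let ?A = "addable m (insert \<alpha> \<nu>)"
  define r1 r2 where r: "r1 = (if rt \<alpha> \<in> ?A then [:- ?b, 1:] else 1)" "r2 = (if dn \<alpha> \<in> ?A then [:- ?c, 1:] else 1)"
  \<comment> \<open>The factor at \<open>?b\<close> is kept if the right neighbour is addable;
    otherwise \<open>?b\<close> is the content of the corner that blocks it.\<close>
  have z2: "pev ([:- ?c, 1:] * (r1 * R)) (J (k + 1)) * E k Y = 0"
  proof (cases "rt \<alpha> \<in> ?A")
    case True
    then show ?thesis using z1 by (simp only: r if_True mult.left_commute)
  next
    case False
    from rt_not_addable[OF D(1) a False] obtain \<rho> D' where \<rho>: "is_diag m D'" "\<rho> \<in> addable m D'"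
      "\<nu> = insert \<rho> D'" "\<alpha> = dn \<rho>" "\<alpha> \<notin> addable m D'" by blast
    have b: "?b = ct \<rho>" using ct_rt[of \<alpha>] ct_dn[of \<rho>] \<rho>(4) by simp
    have "?a + ct \<rho> = (1 + q\<^sup>2) * ?a" using ct_dn[of \<rho>] \<rho>(4) by (simp add: algebra_simps)
    then have ne: "?a + ct \<rho> \<noteq> 0" using q4 cz by simp
    have "pev ([:- ?c, 1:] * R) (J (k + 1)) * E k Y = 0"
    proof (rule pev_cancel_factor[OF Y k(2) z1])
      fix w assume w: "E k Y * w = w" "J (k + 1) * w = \<kappa> ?b * w"
      show "w = 0"
        by (rule cancel_removable[OF k Y'(1) \<rho>(1,2) _ _ \<rho>(5) _ _ _ ne])
          (use a Y'(2) \<rho>(3) eE[of w] w b in \<open>auto simp: d\<close>)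
    qed
    then show ?thesis using False by (simp add: r)
  qed
  have z3: "pev (r2 * (r1 * R)) (J (k + 1)) * E k Y = 0"
  proof (cases "dn \<alpha> \<in> ?A")
    case True
    then show ?thesis using z2 by (simp only: r if_True)
  next
    case False
    from dn_not_addable[OF D(1) a False] obtain \<rho> D' where \<rho>: "is_diag m D'" "\<rho> \<in> addable m D'"
      "\<nu> = insert \<rho> D'" "\<alpha> = rt \<rho>" "\<alpha> \<notin> addable m D'" by blast
    have b: "?c = ct \<rho>" using ct_rt[of \<rho>] ct_dn[of \<alpha>] \<rho>(4) q0 by simp
    have "?a + ct \<rho> = (1 + q\<^sup>2) * ct \<rho>" using ct_rt[of \<rho>] \<rho>(4) by (simp add: algebra_simps)
    then have ne: "?a + ct \<rho> \<noteq> 0" using q4 ct_nz[OF \<rho>(1,2)] by simp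
    have "pev (r1 * R) (J (k + 1)) * E k Y = 0"
    proof (rule pev_cancel_factor[OF Y k(2) z2])
      fix w assume w: "E k Y * w = w" "J (k + 1) * w = \<kappa> ?c * w"
      show "w = 0"
        by (rule cancel_removable[OF k Y'(1) \<rho>(1,2) _ _ \<rho>(5) _ _ _ ne])
          (use a Y'(2) \<rho>(3) eE[of w] w b in \<open>auto simp: d\<close>)
    qed
    then show ?thesis using False by (simp add: r)
  qed
  have "Qp (shape Y) = (\<Prod>\<beta>\<in>{rt \<alpha>, dn \<alpha>} \<inter> ?A. [:- ct \<beta>, 1:]) * R"
  proof -
    have A: "?A = ({rt \<alpha>, dn \<alpha>} \<inter> ?A) \<union> (addable m \<nu> - {\<alpha>})" using addable_insert_eq[OF D(1) a] by blast
    show ?thesis unfolding Qp_def MR shY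
      by (subst A, rule prod.union_disjoint) (use rt_dn_not_addable[OF D(1) a] finite_addable[OF D(1)] in auto)
  qed
  also have "(\<Prod>\<beta>\<in>{rt \<alpha>, dn \<alpha>} \<inter> ?A. [:- ct \<beta>, 1:]) = r2 * r1"
  proof -
    have "rt \<alpha> \<noteq> dn \<alpha>" by (cases \<alpha>) (simp add: rt_def dn_def)
    then show ?thesis unfolding r Int_insert_left by (simp add: mult.commute)
  qed
  finally have "Qp (shape Y) = r2 * (r1 * R)" by (simp only: mult.assoc)
  then show "pev (Qp (shape Y)) (J (Suc k)) * E k Y = 0" using z3 by simp
qed

end

section \<open>Primitivity\<close>

context hecke_alg
begin

text \<open>Closes the mutual induction: the spectral claims below \<open>k\<close> give the
  idempotents of size \<open>k\<close>, and these give the claim at \<open>k\<close>.\<close>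

lemma spectral_all: "k < n \<Longrightarrow> spectral k"
proof (induction k rule: less_induct)
  case (less k)
  interpret L: hecke_level \<kappa> m n q v t s k by unfold_locales (use less in auto)
  show ?case using L.spectral_0 L.spectral_step less.prems by (cases "k = 0") auto
qed

lemma level_at: "k \<le> n \<Longrightarrow> hecke_level \<kappa> m n q v t s k"
  by unfold_locales (auto intro: spectral_all)

text \<open>Mackey decomposition: \<open>Alg (k + 1) = Alg k \<sigma>\<^sub>k Alg k + \<Sum>\<^sub>j J\<^sub>k\<^sub>+\<^sub>1\<^sup>j Alg k\<close>.\<close>

inductive_set Mack :: "nat \<Rightarrow> 'a set" for k where
  Mack_0: "0 \<in> Mack k"
| Mack_add: "x \<in> Mack k \<Longrightarrow> y \<in> Mack k \<Longrightarrow> x + y \<in> Mack k"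
| Mack_s: "1 \<le> k \<Longrightarrow> a \<in> Alg k \<Longrightarrow> b \<in> Alg k \<Longrightarrow> a * s k * b \<in> Mack k"
| Mack_J: "a \<in> Alg k \<Longrightarrow> J (Suc k) ^ j * a \<in> Mack k"

lemma J_pow_Alg: "k < n \<Longrightarrow> y \<in> Alg k \<Longrightarrow> y * J (Suc k) ^ j = J (Suc k) ^ j * y"
  using J_Alg[of k y] by (induction j) (simp_all, metis mult.assoc)

lemma Mack_left:
  assumes k: "k < n" and a: "a \<in> Alg k" and y: "y \<in> Mack k"
  shows "a * y \<in> Mack k"
  using y
proof induction
  case (Mack_s b c)
  then have "(a * b) * s k * c \<in> Mack k" using a by (intro Mack.Mack_s Alg_mult)
  then show ?case by (simp add: mult.assoc)
next
  case (Mack_J b j)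
  then have "J (Suc k) ^ j * (a * b) \<in> Mack k" using a by (intro Mack.Mack_J Alg_mult)
  then show ?case using J_pow_Alg[OF k a, of j] by (simp add: mult.assoc[symmetric])
qed (auto simp: distrib_left intro: Mack.intros)

lemma Mack_right:
  assumes a: "a \<in> Alg k" and y: "y \<in> Mack k"
  shows "y * a \<in> Mack k"
  using y
proof induction
  case (Mack_s b c)
  then show ?case using a Mack.Mack_s[of k b "c * a"] by (simp add: mult.assoc Alg_mult)
next
  case (Mack_J b j)
  then show ?case using a Mack.Mack_J[of "b * a" k j] by (simp add: mult.assoc Alg_mult)
qed (auto simp: distrib_right intro: Mack.intros)

lemma Mack_J_left:
  assumes k: "k < n" and y: "y \<in> Mack k"
  shows "J (Suc k) * y \<in> Mack k"
  using y
proof induction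
  case (Mack_s a b)
  have "J (Suc k) * s k = s k * J k + \<kappa> p * J (Suc k)" using s_J[of k] Mack_s k by simp
  then have "J (Suc k) * (a * s k * b) = a * s k * (J k * b) + J (Suc k) ^ 1 * (\<kappa> p * (a * b))"
    using J_Alg[OF k Mack_s(2)]
    by (simp add: mult.assoc[symmetric]) (simp add: mult.assoc distrib_left distrib_right \<kappa>_left[of a] \<kappa>_left[of "J (Suc k)"])
  also have "\<dots> \<in> Mack k" using Mack_s
    by (intro Mack.Mack_add Mack.Mack_s Mack.Mack_J Alg_mult Alg_scalar Alg_J) auto
  finally show ?case .
next
  case (Mack_J a j)
  then show ?case using Mack.Mack_J[of a k "Suc j"] by (simp add: mult.assoc)
qed (auto simp: distrib_left intro: Mack.intros)

lemma Mack_scalar: "k < n \<Longrightarrow> y \<in> Mack k \<Longrightarrow> \<kappa> c * y \<in> Mack k"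
  by (rule Mack_left[OF _ Alg_scalar])

lemma Mack_diff: "k < n \<Longrightarrow> x \<in> Mack k \<Longrightarrow> y \<in> Mack k \<Longrightarrow> x - y \<in> Mack k"
  using Mack_add[OF _ Mack_scalar[of k y "- 1"]] by (simp add: \<kappa>_minus \<kappa>_1)

text \<open>Each \<open>J k\<close> next to \<open>s k\<close> is traded for
  \<open>J (Suc k)\<close> on the left, at the cost of terms with a single
  \<open>s k\<close>.\<close>

lemma Mack_sJs:
  assumes k: "1 \<le> k" "k < n"
  shows "s k * (J k ^ j * s k) \<in> Mack k"
proof (induction j)
  case 0
  have "\<kappa> p * s k * 1 + J (Suc k) ^ 0 * 1 \<in> Mack k"
    using k by (intro Mack_add Mack_s Mack_J Alg_scalar Alg_1) auto
  then show ?case using quad[OF k] by simp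
next
  case (Suc j)
  have 1: "J k ^ j * (J (Suc k) * s k) \<in> Mack k"
    using Mack_s[of k 1 1] k by (intro Mack_left Mack_J_left Alg_power Alg_J) (auto simp: Alg_1)
  have "s k * (J k ^ Suc j * s k) = (s k * J k) * (J k ^ j * s k)" by (simp add: mult.assoc)
  also have "\<dots> = J (Suc k) * (s k * (J k ^ j * s k)) - \<kappa> p * ((J (Suc k) * J k ^ j) * s k)"
    using s_J[OF k] by (simp add: left_diff_distrib mult.assoc)
  also have "J (Suc k) * J k ^ j = J k ^ j * J (Suc k)"
    using J_Alg[of k "J k ^ j"] k by (simp add: Alg_power Alg_J)
  finally have "s k * (J k ^ Suc j * s k) = J (Suc k) * (s k * (J k ^ j * s k)) - \<kappa> p * (J k ^ j * (J (Suc k) * s k))"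
    by (simp add: mult.assoc)
  then show ?case using Suc 1 k by (simp add: Mack_diff Mack_scalar Mack_J_left)
qed

text \<open>The critical product is \<open>s k * a * s k\<close> with \<open>a\<close> in
  \<open>Alg k\<close>. The decomposition one level down splits \<open>a\<close>: a term with
  \<open>s (k - 1)\<close> is handled by the braid relation, a term with a power of
  \<open>J k\<close> by \<open>Mack_sJs\<close>.\<close>

lemma Mack_s_left:
  assumes k: "1 \<le> k" "k < n" and low: "Alg k \<subseteq> Mack (k - 1)" and y: "y \<in> Mack k"
  shows "s k * y \<in> Mack k"
  using y
proof induction
  case (Mack_s a b)
  have "s k * (a * (s k * b)) \<in> Mack k" if "a \<in> Mack (k - 1)" for a
    using that
  proof induction
    case (Mack_s c d)
    have c: "s k * c = c * s k" "s k * d = d * s k" using s_Alg[of "k - 1" k] Mack_s k by auto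
    have br: "s k * s (k - 1) * s k = s (k - 1) * s k * s (k - 1)"
      using braid[of "k - 1"] Mack_s(1) k by simp
    have "s k * ((c * s (k - 1) * d) * (s k * b)) = (s k * c) * s (k - 1) * ((d * s k) * b)" by (simp only: mult.assoc)
    also have "\<dots> = c * (s k * s (k - 1) * s k) * (d * b)" unfolding c(1) c(2)[symmetric] by (simp only: mult.assoc)
    also have "\<dots> = (c * s (k - 1)) * s k * (s (k - 1) * (d * b))" unfolding br by (simp only: mult.assoc)
    also have "\<dots> \<in> Mack k"
      using Mack_s k \<open>b \<in> Alg k\<close> by (intro Mack.Mack_s Alg_mult Alg_s) (auto intro: Alg_mono[of "k - 1"])
    finally show ?case .
  next
    case (Mack_J c j)
    have c: "c * s k = s k * c" using s_Alg[of "k - 1" k] Mack_J k by auto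
    have "s k * ((J (Suc (k - 1)) ^ j * c) * (s k * b)) = s k * J (Suc (k - 1)) ^ j * (c * s k) * b" by (simp only: mult.assoc)
    also have "\<dots> = (s k * (J k ^ j * s k)) * (c * b)" unfolding c using k by (simp add: mult.assoc)
    also have "\<dots> \<in> Mack k" using Mack_J \<open>b \<in> Alg k\<close>
      by (intro Mack_right Mack_sJs[OF k] Alg_mult) (auto intro: Alg_mono[of "k - 1"])
    finally show ?case .
  qed (auto simp: distrib_left distrib_right intro: Mack.intros)
  from this[of a] show ?case using low Mack_s by (auto simp: mult.assoc)
next
  case (Mack_J a j)
  show ?case
  proof (induction j)
    case 0
    show ?case using Mack.Mack_s[of k 1 a] k Mack_J by (simp add: Alg_1)
  next
    case (Suc j)
    have "s k * (J (Suc k) ^ Suc j * a) = (s k * J (Suc k)) * (J (Suc k) ^ j * a)" by (simp add: mult.assoc)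
    also have "\<dots> = J k * (s k * (J (Suc k) ^ j * a)) + \<kappa> p * (J (Suc k) ^ Suc j * a)"
      using s_J1[OF k] by (simp add: distrib_right mult.assoc)
    also have "\<dots> \<in> Mack k" using Suc k Mack_J
      by (intro Mack_add Mack_left[of k "J k"] Mack_scalar Mack.Mack_J Alg_J) auto
    finally show ?case .
  qed
qed (auto simp: distrib_left intro: Mack.intros)

text \<open>The set \<open>Mack k\<close> contains 1 and is stable under left multiplication by
  scalars and generators, hence by all of \<open>Alg (Suc k)\<close>.\<close>

lemma Alg_Suc_subset_Mack: "k < n \<Longrightarrow> Alg (Suc k) \<subseteq> Mack k"
proof (induction k)
  case 0
  show ?case
  proof
    fix x assume "x \<in> Alg (Suc 0)"
    then have "\<forall>y\<in>Mack 0. x * y \<in> Mack 0"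
    proof induction
      case Alg_t then show ?case using Mack_J_left[OF 0] by simp
    qed (auto simp: distrib_right mult.assoc Mack_add Mack_scalar[OF 0])
    moreover have "1 \<in> Mack 0" using Mack_J[of 1 0 0] by (simp add: Alg_1)
    ultimately show "x \<in> Mack 0" by fastforce
  qed
next
  case (Suc k)
  show ?case
  proof
    fix x assume "x \<in> Alg (Suc (Suc k))"
    then have "\<forall>y\<in>Mack (Suc k). x * y \<in> Mack (Suc k)"
    proof induction
      case (Alg_s i)
      show ?case
      proof (cases "i = Suc k")
        case True
        then show ?thesis using Mack_s_left[of "Suc k"] Suc by simp
      next
        case False
        then have "s i \<in> Alg (Suc k)" using Alg_s by (intro Alg.Alg_s) auto
        then show ?thesis using Mack_left[OF Suc.prems] by blast
      qed
    next
      case Alg_t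
      then show ?case using Mack_left[OF Suc.prems Alg.Alg_t] by simp
    qed (auto simp: distrib_right mult.assoc Mack_add Mack_scalar[OF Suc.prems])
    moreover have "1 \<in> Mack (Suc k)" using Mack_J[of 1 "Suc k" 0] by (simp add: Alg_1)
    ultimately show "x \<in> Mack (Suc k)" by fastforce
  qed
qed

lemma Alg_0_scalar: "x \<in> Alg 0 \<Longrightarrow> \<exists>c. x = \<kappa> c"
  by (induction rule: Alg.induct) (auto simp: \<kappa>_add[symmetric] \<kappa>_mult[symmetric])

end

section \<open>Corner rings of the idempotents\<close>

context hecke_level
begin

text \<open>By \<open>intertwine\<close>, up to a scalar term \<open>s i\<close> maps
  \<open>E k W\<close> into the exchanged component; so only the entries at \<open>W\<close> and at
  its exchange can be nonzero, and the one at \<open>W\<close> is scalar.\<close>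

lemma E_s_E:
  assumes W: "W \<in> std k" and i: "1 \<le> i" "i < k"
  shows "Z \<in> std k \<Longrightarrow> Z \<noteq> W \<Longrightarrow> Z \<noteq> swap_tableau i W \<Longrightarrow> E k Z * s i * E k W = 0"
    and "\<exists>c. E k W * s i * E k W = \<kappa> c * E k W"
proof -
  let ?d = "p * cat W (i + 1) / (cat W i - cat W (i + 1))" and ?S = "swap_tableau i W"
  have *: "E k Z * s i * E k W + \<kappa> ?d * (E k Z * E k W) = 0" if Z: "Z \<in> std k" "Z \<noteq> ?S" for Z
  proof -
    have "E k Z * s i * E k W + \<kappa> ?d * (E k Z * E k W) = E k Z * ((s i + \<kappa> ?d) * E k W)"
      by (simp add: algebra_simps \<kappa>_left)
    also have "\<dots> = 0" unfolding intertwine[OF W i]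
      using E_orth[OF Z(1) _ Z(2)] by (simp add: mult.assoc[symmetric])
    finally show ?thesis .
  qed
  show "Z \<in> std k \<Longrightarrow> Z \<noteq> W \<Longrightarrow> Z \<noteq> ?S \<Longrightarrow> E k Z * s i * E k W = 0"
    using *[of Z] E_orth[OF _ W] by simp
  have "W \<noteq> ?S" using cat_swap[OF W i, of i] cat_next_ne[OF W kn i] i by auto
  from *[OF W this] have "E k W * s i * E k W = \<kappa> (- ?d) * E k W"
    unfolding E_idem[OF W] \<kappa>_minus by (metis add_eq_0_iff2 mult_minus_left)
  then show "\<exists>c. E k W * s i * E k W = \<kappa> c * E k W" by blast
qed

end

context hecke_alg
begin

text \<open>The vanishing between different shapes is proved together with the scalar claim, because
  it supplies the selection rule for the intermediate idempotents when \<open>a * s k * b\<close> is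
  expanded.\<close>

lemma corner:
  assumes "k \<le> n"
  shows "X \<in> std k \<Longrightarrow> Y \<in> std k \<Longrightarrow> shape X \<noteq> shape Y \<Longrightarrow> x \<in> Alg k \<Longrightarrow> E k X * x * E k Y = 0"
    and "X \<in> std k \<Longrightarrow> x \<in> Alg k \<Longrightarrow> \<exists>c. E k X * x * E k X = \<kappa> c * E k X"
  using assms
proof (induction k arbitrary: X Y x)
  case 0
  { case 1 then show ?case by (simp add: std_0) }
  { case 2 then show ?case using Alg_0_scalar by (simp add: E.simps) }
next
  case (Suc k)
  have kn: "k < n" if "Suc k \<le> n" using that by simp
  define R where "R = remove_entry (Suc k)"
  {
    assume kn': "Suc k \<le> n"
    interpret L: hecke_level \<kappa> m n q v t s "Suc k" by (rule level_at) (rule kn')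
    interpret L0: hecke_level \<kappa> m n q v t s k by (rule level_at) (use kn' in simp)
    note k = kn[OF kn']
    have R: "R X \<in> std k" "shape (R X) = pre X k" if "X \<in> std (Suc k)" for X
      using std_remove[OF that] by (auto simp: R_def)
    define P where "P = (\<lambda>X. pev (Lag (shape (R X)) (node_of X (Suc k))) (J (Suc k)))"
    have EP: "E (Suc k) X = E k (R X) * P X" for X by (simp add: E.simps R_def P_def)
    have EP': "E (Suc k) X = P X * E k (R X)" for X
      unfolding EP P_def using pev_J_E[of "Suc k" k] k by simp
    have ER: "E k (R X) * E (Suc k) X = E (Suc k) X" "E (Suc k) X * E k (R X) = E (Suc k) X" if "X \<in> std (Suc k)" for X
    proof -
      show "E k (R X) * E (Suc k) X = E (Suc k) X" unfolding EP by (rule L0.E_idem'[OF R(1)[OF that]])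
      show "E (Suc k) X * E k (R X) = E (Suc k) X" unfolding EP' by (simp only: mult.assoc L0.E_idem[OF R(1)[OF that]])
    qed
    \<comment> \<open>Elements of \<open>Alg k\<close> are squeezed between the idempotents of the
      shortened tableaux, where the induction hypothesis applies.\<close>
    have low: "E (Suc k) X * a * E (Suc k) Y = E (Suc k) X * (E k (R X) * a * E k (R Y)) * E (Suc k) Y"
      if "X \<in> std (Suc k)" "Y \<in> std (Suc k)" for X Y a
    proof -
      have "E (Suc k) X * a * E (Suc k) Y = (E (Suc k) X * E k (R X)) * a * (E k (R Y) * E (Suc k) Y)"
        using ER that by simp
      then show ?thesis by (simp only: mult.assoc)
    qed
    have shS: "shape X = insert (node_of X (Suc k)) (pre X k)" if "X \<in> std (Suc k)" for X
      using pre_n[OF that] pre_Suc[OF that, of k] by simp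
    have same: "shape (R X) = shape (R Z) \<and> node_of X (Suc k) = node_of Z (Suc k)"
      if X: "X \<in> std (Suc k)" and Z: "Z \<in> std (Suc k)" and a: "a \<in> Alg k"
        and nz: "E (Suc k) X * a * E (Suc k) Z \<noteq> 0" for X Z a
    proof -
      have sh: "shape (R X) = shape (R Z)"
      proof (rule ccontr)
        assume "shape (R X) \<noteq> shape (R Z)"
        then have z: "E k (R X) * a * E k (R Z) = 0"
          using Suc.IH(1)[OF R(1)[OF X] R(1)[OF Z] _ a] k by (meson less_imp_le)
        have "E (Suc k) X * a * E (Suc k) Z = 0" by (subst low[OF X Z]) (simp only: z mult_zero_left mult_zero_right)
        then show False using nz by contradiction
      qed
      have Sk: "Suc k \<in> {1..Suc k}" by simp
      have "\<kappa> (cat X (Suc k)) * (E (Suc k) X * a * E (Suc k) Z) = E (Suc k) X * J (Suc k) * a * E (Suc k) Z"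
        unfolding L.E_eigen_right[OF X Sk] by (simp only: mult.assoc)
      also have "\<dots> = E (Suc k) X * a * (J (Suc k) * E (Suc k) Z)"
        
      proof -
        have "E (Suc k) X * J (Suc k) * a * E (Suc k) Z = E (Suc k) X * (J (Suc k) * a) * E (Suc k) Z"
          by (simp only: mult.assoc)
        then show ?thesis unfolding J_Alg[OF k a] by (simp only: mult.assoc)
      qed
      also have "\<dots> = \<kappa> (cat Z (Suc k)) * (E (Suc k) X * a * E (Suc k) Z)"
        unfolding L.E_eigen[OF Z Sk] by (rule \<kappa>_left)
      finally have "cat X (Suc k) = cat Z (Suc k)" using L.eq_of_scaled nz by blast
      moreover have "inj_on ct (addable m (pre X k))"
        using ct_inj[OF pre_diag[OF X]] card_pre[OF X, of k] k by simp
      moreover have "node_of X (Suc k) \<in> addable m (pre X k)" "node_of Z (Suc k) \<in> addable m (pre X k)"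
        using node_of_addable[OF X, of k] node_of_addable[OF Z, of k] sh R(2) X Z by auto
      ultimately show ?thesis using sh by (auto simp: content_at_def dest: inj_onD)
    qed
    have sameS: "shape X = shape Z" if "X \<in> std (Suc k)" "Z \<in> std (Suc k)" "a \<in> Alg k"
        "E (Suc k) X * a * E (Suc k) Z \<noteq> 0" for X Z a
      using same[OF that] shS[OF that(1)] shS[OF that(2)] R(2) that(1,2) by simp
    have diag: "\<exists>c. E (Suc k) X * a * E (Suc k) X = \<kappa> c * E (Suc k) X" if X: "X \<in> std (Suc k)" and a: "a \<in> Alg k" for X a
    proof -
      obtain c where c: "E k (R X) * a * E k (R X) = \<kappa> c * E k (R X)" using Suc.IH(2)[OF R(1)[OF X] a] k by auto
      have "E (Suc k) X * a * E (Suc k) X = \<kappa> c * (E (Suc k) X * (E k (R X) * E (Suc k) X))"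
        by (subst low[OF X X], simp only: c, simp only: mult.assoc \<kappa>_left[of "E (Suc k) X"])
      then show ?thesis unfolding ER(1)[OF X] L.E_idem[OF X] by blast
    qed
    have expand: "E (Suc k) X * (a * s k * b) * E (Suc k) Y =
      (\<Sum>Z\<in>std (Suc k). \<Sum>W\<in>std (Suc k). (E (Suc k) X * a * E (Suc k) Z) * (E (Suc k) Z * s k * E (Suc k) W) * (E (Suc k) W * b * E (Suc k) Y))"
      for X Y a b
    proof -
      have "E (Suc k) X * (a * s k * b) * E (Suc k) Y = (\<Sum>Z\<in>std (Suc k). E (Suc k) X * a * E (Suc k) Z) * s k * (\<Sum>W\<in>std (Suc k). E (Suc k) W * (b * E (Suc k) Y))"
        unfolding L.E_expand_left L.E_expand_right by (simp only: mult.assoc)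
      also have "\<dots> = (\<Sum>Z\<in>std (Suc k). \<Sum>W\<in>std (Suc k). (E (Suc k) X * a * E (Suc k) Z) * s k * (E (Suc k) W * (b * E (Suc k) Y)))"
        by (simp only: sum_distrib_right[of _ _ "s k"] sum_product)
      also have "\<dots> = (\<Sum>Z\<in>std (Suc k). \<Sum>W\<in>std (Suc k). (E (Suc k) X * a * E (Suc k) Z) * (E (Suc k) Z * s k * E (Suc k) W) * (E (Suc k) W * b * E (Suc k) Y))"
        by (intro sum.cong refl) (simp only: mult.assoc L.E_idem')
      finally show ?thesis .
    qed
    have k1: "1 \<le> k" "k < Suc k" if "1 \<le> k" using that by auto
    have zero_term: "(E (Suc k) X * a * E (Suc k) Z) * (E (Suc k) Z * s k * E (Suc k) W) * (E (Suc k) W * b * E (Suc k) Y) = 0"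
      if X: "X \<in> std (Suc k)" and Y: "Y \<in> std (Suc k)" and Z: "Z \<in> std (Suc k)" and W: "W \<in> std (Suc k)"
        and k0: "1 \<le> k" and a: "a \<in> Alg k" and b: "b \<in> Alg k" and ne: "shape X \<noteq> shape Y \<or> (X = Y \<and> Z \<noteq> W)" for X Y Z W a b
    proof (rule ccontr)
      assume nz: "\<not> ?thesis"
      have n1: "E (Suc k) X * a * E (Suc k) Z \<noteq> 0" and n2: "E (Suc k) Z * s k * E (Suc k) W \<noteq> 0"
        and n3: "E (Suc k) W * b * E (Suc k) Y \<noteq> 0" using nz by auto
      \<comment> \<open>Either way the shapes of \<open>Z\<close> and \<open>W\<close> agree, which
        settles different outer shapes. For \<open>X = Y\<close> the exchange is also impossible:
        \<open>Z\<close> and \<open>W\<close> would have the same initial segment of size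
        \<open>k\<close>, but the exchange moves the last node of \<open>W\<close> into it.\<close>
      have ZW: "Z = W \<or> Z = swap_tableau k W" using L.E_s_E(1)[OF W k1[OF k0] Z] n2 by blast
      have sh: "shape Z = shape W" using ZW shape_swap[OF k0] by auto
      have "shape X = shape Y" using sameS[OF X Z a n1] sameS[OF W Y b n3] sh by simp
      then have XY: "X = Y" "Z \<noteq> W" using ne by auto
      then have Zs: "Z = swap_tableau k W" using ZW by blast
      have "pre Z k = pre W k"
        using same[OF X Z a n1] same[OF W Y b n3] XY R(2) X Y Z W by metis
      moreover have "node_of W (k + 1) = node_of Z k" unfolding Zs using node_of_swap[OF W k1[OF k0], of k] k0 by simp
      moreover have "node_of Z k \<in> pre Z k" using two_nodes(5)[OF Z k1[OF k0]] by simp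
      moreover have "node_of W (k + 1) \<notin> pre W k" using addable_notin[OF node_of_addable[OF W, of k]] by simp
      ultimately show False by simp
    qed
    have main: "(shape X \<noteq> shape Y \<longrightarrow> E (Suc k) X * x * E (Suc k) Y = 0) \<and> (\<exists>c. E (Suc k) X * x * E (Suc k) X = \<kappa> c * E (Suc k) X)"
      if x: "x \<in> Mack k" and X: "X \<in> std (Suc k)" and Y: "Y \<in> std (Suc k)" for x X Y
      using x
    proof induction
      case Mack_0
      show ?case by (auto intro: exI[of _ 0] simp: \<kappa>_0)
    next
      case (Mack_add x y)
      then obtain c d where "E (Suc k) X * x * E (Suc k) X = \<kappa> c * E (Suc k) X" "E (Suc k) X * y * E (Suc k) X = \<kappa> d * E (Suc k) X"
        by blast
      then have "E (Suc k) X * (x + y) * E (Suc k) X = \<kappa> (c + d) * E (Suc k) X"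
        by (simp add: distrib_left distrib_right \<kappa>_add)
      then show ?case using Mack_add by (auto simp: distrib_left distrib_right)
    next
      case (Mack_J a j)
      have Jj: "E (Suc k) X * J (Suc k) ^ j = \<kappa> (cat X (Suc k) ^ j) * E (Suc k) X"
      proof (induction j)
        case (Suc j)
        have "E (Suc k) X * J (Suc k) ^ Suc j = (E (Suc k) X * J (Suc k) ^ j) * J (Suc k)"
          by (simp only: power_Suc2 mult.assoc)
        also have "\<dots> = \<kappa> (cat X (Suc k) ^ j) * (E (Suc k) X * J (Suc k))" unfolding Suc by (simp only: mult.assoc)
        also have "\<dots> = \<kappa> (cat X (Suc k) ^ Suc j) * E (Suc k) X"
          using L.E_eigen_right[OF X, of "Suc k"] by (simp only: atLeastAtMost_iff power_Suc2 \<kappa>_mult mult.assoc) simp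
        finally show ?case .
      qed (simp add: \<kappa>_1)
      have eq: "E (Suc k) X * (J (Suc k) ^ j * a) * E (Suc k) Z = \<kappa> (cat X (Suc k) ^ j) * (E (Suc k) X * a * E (Suc k) Z)" for Z
        using Jj by (simp only: mult.assoc[symmetric])
      obtain c where "E (Suc k) X * a * E (Suc k) X = \<kappa> c * E (Suc k) X" using diag[OF X Mack_J] by blast
      then have "E (Suc k) X * (J (Suc k) ^ j * a) * E (Suc k) X = \<kappa> (cat X (Suc k) ^ j * c) * E (Suc k) X"
        unfolding eq by (simp add: \<kappa>_mult mult.assoc)
      moreover have "E (Suc k) X * a * E (Suc k) Y = 0" if "shape X \<noteq> shape Y" using sameS[OF X Y Mack_J] that by blast
      ultimately show ?case using eq by auto
    next
      case (Mack_s a b)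
      have "E (Suc k) X * (a * s k * b) * E (Suc k) Y = 0" if "shape X \<noteq> shape Y"
        unfolding expand by (intro sum.neutral ballI zero_term[OF X Y _ _ Mack_s]) (use that in auto)
      moreover have "\<exists>c. E (Suc k) X * (a * s k * b) * E (Suc k) X = \<kappa> c * E (Suc k) X"
      proof -
        have termZ: "\<exists>c. (E (Suc k) X * a * E (Suc k) Z) * (E (Suc k) Z * s k * E (Suc k) Z) * (E (Suc k) Z * b * E (Suc k) X) = \<kappa> c * E (Suc k) X"
          if Z: "Z \<in> std (Suc k)" for Z
        proof (cases "E (Suc k) X * a * E (Suc k) Z = 0")
          case True
          then show ?thesis by (auto intro: exI[of _ 0] simp: \<kappa>_0)
        next
          case False
          obtain d where d: "E (Suc k) Z * s k * E (Suc k) Z = \<kappa> d * E (Suc k) Z"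
            using L.E_s_E(2)[OF Z k1[OF Mack_s(1)]] by blast
          \<comment> \<open>The last factor of the idempotent depends only on the shortened shape
            and the last node, on which \<open>X\<close> and \<open>Z\<close> agree. It commutes
            with \<open>a\<close> and is absorbed by \<open>E (Suc k) X\<close>, leaving the middle
            element \<open>a * E k (R Z) * b\<close> of \<open>Alg k\<close>.\<close>
          have PP: "P Z = P X" unfolding P_def using same[OF X Z Mack_s(2) False] by simp
          have PX: "E (Suc k) X * P X = E (Suc k) X"
          proof -
            have Sk: "Suc k \<in> {1..Suc k}" by simp
            have "E (Suc k) X * P X = \<kappa> (poly (Lag (shape (R X)) (node_of X (Suc k))) (cat X (Suc k))) * E (Suc k) X"
              unfolding P_def by (rule pev_eigen_right[OF L.E_eigen_right[OF X Sk]])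
            also have "poly (Lag (shape (R X)) (node_of X (Suc k))) (cat X (Suc k)) = 1"
              unfolding content_at_def R(2)[OF X]
              using Lag_at[OF pre_diag[OF X] _ node_of_addable[OF X] node_of_addable[OF X], of k] card_pre[OF X, of k] k by simp
            finally show ?thesis by (simp add: \<kappa>_1)
          qed
          have Pa: "a * P X = P X * a" unfolding P_def using pev_comm[of a "J (Suc k)"] J_Alg[OF k Mack_s(2)] by metis
          have EEa: "a * E k (R Z) * b \<in> Alg k" using Mack_s by (intro Alg_mult Alg_E) auto
          obtain c where c: "E (Suc k) X * (a * E k (R Z) * b) * E (Suc k) X = \<kappa> c * E (Suc k) X"
            using diag[OF X EEa] by blast
          have "(E (Suc k) X * a * E (Suc k) Z) * (E (Suc k) Z * s k * E (Suc k) Z) * (E (Suc k) Z * b * E (Suc k) X)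
              = \<kappa> d * (E (Suc k) X * a * (E (Suc k) Z * (E (Suc k) Z * (E (Suc k) Z * (b * E (Suc k) X)))))"
            unfolding d by (simp only: mult.assoc \<kappa>_left[of "E (Suc k) _"] \<kappa>_left[of a])
          also have "E (Suc k) Z * (E (Suc k) Z * (E (Suc k) Z * (b * E (Suc k) X))) = E (Suc k) Z * (b * E (Suc k) X)"
            by (simp only: L.E_idem'[OF Z])
          also have "E (Suc k) X * a * (E (Suc k) Z * (b * E (Suc k) X)) = E (Suc k) X * (a * P X) * E k (R Z) * b * E (Suc k) X"
            unfolding EP'[of Z] PP by (simp only: mult.assoc)
          also have "\<dots> = (E (Suc k) X * P X) * (a * E k (R Z) * b) * E (Suc k) X"
            unfolding Pa by (simp only: mult.assoc)
          also have "\<dots> = \<kappa> c * E (Suc k) X" unfolding PX by (rule c)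
          finally show ?thesis by (metis \<kappa>_mult mult.assoc)
        qed
        have sums: "\<exists>c. (\<Sum>Z\<in>S. f Z) = \<kappa> c * E (Suc k) X" if "finite S" "\<And>Z. Z \<in> S \<Longrightarrow> \<exists>c. f Z = \<kappa> c * E (Suc k) X"
          for S and f :: "mtableau \<Rightarrow> 'a"
          using that
        proof (induction S rule: finite_induct)
          case (insert z S)
          then obtain c d where "(\<Sum>Z\<in>S. f Z) = \<kappa> c * E (Suc k) X" "f z = \<kappa> d * E (Suc k) X" by blast
          then have "(\<Sum>Z\<in>insert z S. f Z) = \<kappa> (d + c) * E (Suc k) X" using insert by (simp add: \<kappa>_add distrib_right)
          then show ?case by blast
        qed (auto intro: exI[of _ 0] simp: \<kappa>_0)
        have "E (Suc k) X * (a * s k * b) * E (Suc k) X =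
            (\<Sum>Z\<in>std (Suc k). (E (Suc k) X * a * E (Suc k) Z) * (E (Suc k) Z * s k * E (Suc k) Z) * (E (Suc k) Z * b * E (Suc k) X))"
          unfolding expand
          by (intro sum.cong refl L.sum_single finite_std zero_term[OF X X _ _ Mack_s]) auto
        then show ?thesis using sums[OF finite_std termZ] by simp
      qed
      ultimately show ?case by blast
    qed
    note main = main
  }
  note main = this
  { case 1
    then show ?case using main Alg_Suc_subset_Mack[of k] by (auto dest: Suc_le_lessD) }
  { case 2
    then show ?case using main[of _ X X] Alg_Suc_subset_Mack[of k] by (auto dest: Suc_le_lessD) }
qed

end

section \<open>Free algebras\<close>

lemma free_algebra_ring: "ring (free_algebra G)"
proof (rule ringI)
  let ?R = "free_algebra G :: ('a fword \<Rightarrow>\<^sub>0 'b::field) ring"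
  show "abelian_group ?R"
  proof (rule abelian_groupI)
    fix x y assume "x \<in> carrier ?R" "y \<in> carrier ?R"
    then show "x \<oplus>\<^bsub>?R\<^esub> y \<in> carrier ?R" using keys_add[of x y] by (auto simp: free_algebra_def)
  next
    fix x assume "x \<in> carrier ?R"
    then show "\<exists>y\<in>carrier ?R. y \<oplus>\<^bsub>?R\<^esub> x = \<zero>\<^bsub>?R\<^esub>"
      by (intro bexI[of _ "- x"]) (auto simp: free_algebra_def)
  qed (auto simp: free_algebra_def add.assoc add.commute)
  show "Group.monoid ?R"
  proof (rule monoidI)
    fix x y assume "x \<in> carrier ?R" "y \<in> carrier ?R"
    then show "x \<otimes>\<^bsub>?R\<^esub> y \<in> carrier ?R" using keys_mult[of x y] by (force simp: free_algebra_def plus_fword_def)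
  qed (auto simp: free_algebra_def mult.assoc zero_fword_def)
qed (auto simp: free_algebra_def distrib_left distrib_right)

lemma free_algebra_simps:
  "monoid.mult (free_algebra G) = (*)" "monoid.one (free_algebra G) = 1" "ring.add (free_algebra G) = (+)" "ring.zero (free_algebra G) = 0"
  by (simp_all add: free_algebra_def)

lemma free_algebra_mem: "P \<in> carrier (free_algebra G) \<longleftrightarrow> (\<forall>w\<in>Poly_Mapping.keys P. set (letters w) \<subseteq> G)"
  by (simp add: free_algebra_def)

lemma fgen_carrier [simp]: "fgen g \<in> carrier (free_algebra G) \<longleftrightarrow> g \<in> G"
  by (simp add: free_algebra_mem fgen_def)

lemma fconst_carrier [simp]: "fconst c \<in> carrier (free_algebra G)"
  by (simp add: free_algebra_mem fconst_def zero_fword_def)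

lemma free_algebra_closed [simp, intro]:
  assumes "P \<in> carrier (free_algebra G)" "Q \<in> carrier (free_algebra G)"
  shows "P + Q \<in> carrier (free_algebra G)" "P * Q \<in> carrier (free_algebra G)" "P - Q \<in> carrier (free_algebra G)"
    "- P \<in> carrier (free_algebra G)"
proof -
  interpret ring "free_algebra G" by (rule free_algebra_ring)
  show "P + Q \<in> carrier (free_algebra G)" "P * Q \<in> carrier (free_algebra G)"
    using a_closed[OF assms] m_closed[OF assms] by (simp_all add: free_algebra_simps)
  show "- P \<in> carrier (free_algebra G)" using assms by (simp add: free_algebra_mem)
  then show "P - Q \<in> carrier (free_algebra G)"
    using assms keys_diff[of P Q] by (auto simp: free_algebra_mem)
qed

lemma free_algebra_01 [simp, intro]: "0 \<in> carrier (free_algebra G)" "1 \<in> carrier (free_algebra G)"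
  by (auto simp: free_algebra_mem zero_fword_def)

lemma free_algebra_uminus: "P \<in> carrier (free_algebra G) \<Longrightarrow> \<ominus>\<^bsub>free_algebra G\<^esub> P = - P"
proof -
  assume P: "P \<in> carrier (free_algebra G)"
  interpret ring "free_algebra G" by (rule free_algebra_ring)
  show ?thesis by (rule minus_equality) (use P in \<open>auto simp: free_algebra_simps\<close>)
qed

lemma sum_singles: "P = (\<Sum>w\<in>Poly_Mapping.keys P. Poly_Mapping.single w (Poly_Mapping.lookup P w))"
proof (rule poly_mapping_eqI)
  fix w
  show "Poly_Mapping.lookup P w = Poly_Mapping.lookup (\<Sum>w\<in>Poly_Mapping.keys P. Poly_Mapping.single w (Poly_Mapping.lookup P w)) w"
    by (simp add: lookup_sum lookup_single when_def in_keys_iff)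
qed

lemma fconst_central: "fconst c * P = P * fconst (c::'k::field)"
proof -
  have "fconst c * Poly_Mapping.single w d = Poly_Mapping.single w d * fconst c" for w and d :: 'k
    by (simp add: fconst_def mult_single mult.commute)
  then have "fconst c * (\<Sum>w\<in>S. Poly_Mapping.single w (f w)) = (\<Sum>w\<in>S. Poly_Mapping.single w (f w)) * fconst c" for S and f :: "'b fword \<Rightarrow> 'k"
    unfolding sum_distrib_left sum_distrib_right by (intro sum.cong) auto
  then show ?thesis using sum_singles[of P] by metis
qed

lemma central_scalars_fconst: "central_scalars (fconst :: 'k::field \<Rightarrow> _)"
  by (unfold_locales; (rule fconst_central)?) (auto simp: fconst_def single_add mult_single)

section \<open>Evaluation of noncommutative polynomials\<close>

context central_scalars
begin

definition fev :: "('g \<Rightarrow> 'a) \<Rightarrow> ('g fword \<Rightarrow>\<^sub>0 'k) \<Rightarrow> 'a" where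
  "fev f P = (\<Sum>w\<in>Poly_Mapping.keys P. \<kappa> (Poly_Mapping.lookup P w) * prod_list (map f (letters w)))"

lemma fev_superset:
  assumes "finite S" "Poly_Mapping.keys P \<subseteq> S"
  shows "fev f P = (\<Sum>w\<in>S. \<kappa> (Poly_Mapping.lookup P w) * prod_list (map f (letters w)))"
  unfolding fev_def using assms by (intro sum.mono_neutral_left) (auto simp: in_keys_iff \<kappa>_0)

lemma fev_add: "fev f (P + Q) = fev f P + fev f Q"
proof -
  let ?S = "Poly_Mapping.keys P \<union> Poly_Mapping.keys Q"
  have "fev f R = (\<Sum>w\<in>?S. \<kappa> (Poly_Mapping.lookup R w) * prod_list (map f (letters w)))"
    if "Poly_Mapping.keys R \<subseteq> ?S" for R
    using that by (intro fev_superset) auto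
  from this[of P] this[of Q] this[of "P + Q"] show ?thesis
    using keys_add[of P Q] by (simp add: lookup_add \<kappa>_add distrib_right sum.distrib)
qed

lemma fev_single: "fev f (Poly_Mapping.single w c) = \<kappa> c * prod_list (map f (letters w))"
  by (simp add: fev_def \<kappa>_0)

lemma fev_0: "fev f 0 = 0" by (simp add: fev_def)

lemma fev_sum: "finite S \<Longrightarrow> fev f (\<Sum>x\<in>S. g x) = (\<Sum>x\<in>S. fev f (g x))"
  by (induction S rule: finite_induct) (auto simp: fev_add fev_0)

lemma fev_minus: "fev f (- P) = - fev f P"
  using fev_add[of f P "- P"] by (simp add: fev_0 eq_neg_iff_add_eq_0 add.commute)

lemma fev_diff: "fev f (P - Q) = fev f P - fev f Q"
  using fev_add[of f P "- Q"] by (simp add: fev_minus)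

lemma fev_mult: "fev f (P * Q) = fev f P * fev f Q"
proof -
  let ?s = "\<lambda>P w. Poly_Mapping.single w (Poly_Mapping.lookup P w)"
  have 1: "fev f (?s P w * ?s Q u) = fev f (?s P w) * fev f (?s Q u)" for w u
    by (simp add: mult_single fev_single plus_fword_def \<kappa>_mult mult.assoc \<kappa>_left[of "prod_list _"])
  have "P * Q = (\<Sum>w\<in>Poly_Mapping.keys P. ?s P w) * (\<Sum>u\<in>Poly_Mapping.keys Q. ?s Q u)"
    using sum_singles[of P] sum_singles[of Q] by simp
  then have "fev f (P * Q) = (\<Sum>w\<in>Poly_Mapping.keys P. \<Sum>u\<in>Poly_Mapping.keys Q. fev f (?s P w) * fev f (?s Q u))"
    by (simp add: sum_product fev_sum 1)
  also have "\<dots> = (\<Sum>w\<in>Poly_Mapping.keys P. fev f (?s P w)) * (\<Sum>u\<in>Poly_Mapping.keys Q. fev f (?s Q u))"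
    by (simp add: sum_product)
  also have "\<dots> = fev f P * fev f Q"
    using sum_singles[of P] sum_singles[of Q] by (simp only: fev_sum[OF finite_keys, symmetric]) 
  finally show ?thesis .
qed

lemma fev_fgen [simp]: "fev f (fgen g) = f g"
  by (simp add: fgen_def fev_single \<kappa>_1)

lemma fev_fconst [simp]: "fev f (fconst c) = \<kappa> c"
  by (simp add: fconst_def fev_single zero_fword_def)

lemma fev_1 [simp]: "fev f 1 = 1"
  using fev_fconst[of f 1] by (simp add: fconst_def \<kappa>_1 single_one)

lemma fev_prod_list: "fev f (prod_list Ps) = prod_list (map (fev f) Ps)"
  by (induction Ps) (auto simp: fev_mult)

text \<open>Also serves as an induction principle over generators, with \<open>S\<close> the set of
  elements having a given property.\<close>

lemma fev_closed:
  assumes "\<And>g. g \<in> G \<Longrightarrow> f g \<in> S" "\<And>c. \<kappa> c \<in> S" "\<And>x y. x \<in> S \<Longrightarrow> y \<in> S \<Longrightarrow> x + y \<in> S"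
    "\<And>x y. x \<in> S \<Longrightarrow> y \<in> S \<Longrightarrow> x * y \<in> S" and P: "P \<in> carrier (free_algebra G)"
  shows "fev f P \<in> S"
proof -
  have 0: "0 \<in> S" "1 \<in> S" using assms(2)[of 0] assms(2)[of 1] by (auto simp: \<kappa>_0 \<kappa>_1)
  have "prod_list (map f ws) \<in> S" if "set ws \<subseteq> G" for ws
    using that by (induction ws) (auto intro: 0 assms)
  then have in_S: "\<kappa> (Poly_Mapping.lookup P w) * prod_list (map f (letters w)) \<in> S" if "w \<in> Poly_Mapping.keys P" for w
    using that P by (intro assms) (auto simp: free_algebra_mem)
  have "sum h T \<in> S" if "finite T" "\<And>w. w \<in> T \<Longrightarrow> h w \<in> S" for T and h :: "'g fword \<Rightarrow> 'a"
    using that by (induction T rule: finite_induct) (auto intro: 0 assms(3))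
  from this[OF finite_keys in_S] show ?thesis unfolding fev_def .
qed

lemma kernel_ideal: "ideal {P \<in> carrier (free_algebra G). fev f P = 0} (free_algebra G)" (is "ideal ?I ?R")
proof (rule idealI)
  interpret ring ?R by (rule free_algebra_ring)
  show "subgroup ?I (add_monoid ?R)"
  proof (rule add.subgroupI)
    show "?I \<noteq> {}" using fev_0[of f] by blast
    show "\<ominus>\<^bsub>?R\<^esub> a \<in> ?I" if "a \<in> ?I" for a using that by (auto simp: free_algebra_uminus fev_minus)
  qed (auto simp: free_algebra_simps fev_add)
qed (auto simp: free_algebra_ring free_algebra_simps fev_mult)

end

text \<open>The uniqueness half of the universal property of the free algebra.\<close>

lemma central_scalars_eqI:
  assumes "central_scalars \<kappa>"
    and "\<And>P Q. h (P + Q) = h P + h Q" "\<And>P Q. h (P * Q) = h P * h Q" "\<And>c. h (fconst c) = \<kappa> c"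
  shows "h (P :: 'g fword \<Rightarrow>\<^sub>0 'k::field) = central_scalars.fev \<kappa> (\<lambda>g. h (fgen g)) P"
proof -
  interpret central_scalars \<kappa> by fact
  have w: "h (Poly_Mapping.single (FWord ws) 1) = prod_list (map (\<lambda>g. h (fgen g)) ws)" for ws
  proof (induction ws)
    case Nil
    have "Poly_Mapping.single (FWord []) 1 = (fconst 1 :: 'g fword \<Rightarrow>\<^sub>0 'k)" by (simp add: fconst_def zero_fword_def)
    then show ?case using assms(4)[of 1] by (simp add: \<kappa>_1)
  next
    case (Cons g ws)
    have "Poly_Mapping.single (FWord (g # ws)) 1 = fgen g * (Poly_Mapping.single (FWord ws) 1 :: 'g fword \<Rightarrow>\<^sub>0 'k)"
      by (simp add: fgen_def mult_single plus_fword_def)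
    then show ?case using Cons assms(3) by simp
  qed
  have s: "h (Poly_Mapping.single w c) = \<kappa> c * prod_list (map (\<lambda>g. h (fgen g)) (letters w))" for w c
  proof -
    have "Poly_Mapping.single w c = fconst c * Poly_Mapping.single (FWord (letters w)) 1"
      by (simp add: fconst_def mult_single)
    then show ?thesis using w assms(3,4) by metis
  qed
  have h0: "h 0 = 0" using assms(2)[of 0 0] by simp
  have hsum: "h (\<Sum>x\<in>S. g x) = (\<Sum>x\<in>S. h (g x))" if "finite S" for S and g :: "'g fword \<Rightarrow> _"
    using that by (induction S rule: finite_induct) (auto simp: assms(2) h0)
  have "h P = (\<Sum>w\<in>Poly_Mapping.keys P. h (Poly_Mapping.single w (Poly_Mapping.lookup P w)))"
    using sum_singles[of P] hsum[OF finite_keys] by metis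
  then show ?thesis by (simp add: fev_def s)
qed

section \<open>The presented Hecke algebra and representatives of its elements\<close>

lemma hecke_relators_carrier:
  "hecke_relators m n q v \<subseteq> carrier (free_algebra (hecke_gens n))"
proof -
  have pl: "prod_list xs \<in> carrier (free_algebra G)" if "set xs \<subseteq> carrier (free_algebra G)" for xs :: "('g fword \<Rightarrow>\<^sub>0 'k::field) list" and G
    using that by (induction xs) auto
  have [simp]: "Tau \<in> hecke_gens n" "\<And>i. hgen.Sigma i \<in> hecke_gens n \<longleftrightarrow> 1 \<le> i \<and> i < n"
    by (auto simp: hecke_gens_def)
  show ?thesis unfolding hecke_relators_def Let_def
    by (auto intro!: pl simp del: upt_Suc)
qed

lemma hecke_is_ideal: "ideal (hecke_ideal m n q v) (free_algebra (hecke_gens n))"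
  unfolding hecke_ideal_def by (rule ring.genideal_ideal[OF free_algebra_ring hecke_relators_carrier])

lemma hecke_ring: "ring (hecke m n q v)"
  unfolding hecke_def by (rule ideal.quotient_is_ring[OF hecke_is_ideal])

lemma hecke_class_hom: "ring_hom_ring (free_algebra (hecke_gens n)) (hecke m n q v) (hecke_class m n q v)"
  unfolding hecke_def hecke_class_def[abs_def] by (rule ideal.rcos_ring_hom_ring[OF hecke_is_ideal])

lemma hecke_carrier: "carrier (hecke m n q v) = hecke_class m n q v ` carrier (free_algebra (hecke_gens n))"
  unfolding hecke_def hecke_class_def[abs_def] by (auto simp: FactRing_def A_RCOSETS_def RCOSETS_def a_r_coset_def)

context
  fixes m n :: nat and q :: "'k::field" and v :: "nat \<Rightarrow> 'k"
begin

interpretation C: ring_hom_ring "free_algebra (hecke_gens n)" "hecke m n q v" "hecke_class m n q v"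
  by (rule hecke_class_hom)

lemma hecke_class_simps:
  assumes "P \<in> carrier (free_algebra (hecke_gens n))" "Q \<in> carrier (free_algebra (hecke_gens n))"
  shows "hecke_class m n q v (P + Q) = hecke_class m n q v P \<oplus>\<^bsub>hecke m n q v\<^esub> hecke_class m n q v Q"
    "hecke_class m n q v (P * Q) = hecke_class m n q v P \<otimes>\<^bsub>hecke m n q v\<^esub> hecke_class m n q v Q"
    "hecke_class m n q v (P - Q) = hecke_class m n q v P \<ominus>\<^bsub>hecke m n q v\<^esub> hecke_class m n q v Q"
    "hecke_class m n q v P \<in> carrier (hecke m n q v)"
proof -
  have a: "hecke_class m n q v (P + Q) = hecke_class m n q v P \<oplus>\<^bsub>hecke m n q v\<^esub> hecke_class m n q v Q"
    if "Q \<in> carrier (free_algebra (hecke_gens n))" for Q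
    using C.hom_add[OF assms(1) that] by (simp add: free_algebra_simps)
  show "hecke_class m n q v (P * Q) = hecke_class m n q v P \<otimes>\<^bsub>hecke m n q v\<^esub> hecke_class m n q v Q"
    using C.hom_mult[OF assms] by (simp add: free_algebra_simps)
  show "hecke_class m n q v (P - Q) = hecke_class m n q v P \<ominus>\<^bsub>hecke m n q v\<^esub> hecke_class m n q v Q"
    using a[of "- Q"] C.hom_a_inv[OF assms(2)] assms(2) by (simp add: a_minus_def free_algebra_uminus)
  show "hecke_class m n q v P \<in> carrier (hecke m n q v)" using C.hom_closed[OF assms(1)] .
  show "hecke_class m n q v (P + Q) = hecke_class m n q v P \<oplus>\<^bsub>hecke m n q v\<^esub> hecke_class m n q v Q"
    using a[OF assms(2)] .
qed

lemma hecke_class_1: "hecke_class m n q v 1 = \<one>\<^bsub>hecke m n q v\<^esub>"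
  using C.hom_one by (simp add: free_algebra_simps)

lemma hecke_class_0: "hecke_class m n q v 0 = \<zero>\<^bsub>hecke m n q v\<^esub>"
  using C.hom_zero by (simp add: free_algebra_simps)

lemma hconst_carrier: "hconst m n q v c \<in> carrier (hecke m n q v)"
  unfolding hconst_def by (rule hecke_class_simps) auto

lemma htau_carrier: "htau m n q v \<in> carrier (hecke m n q v)"
  unfolding htau_def by (rule hecke_class_simps(4)) (auto simp: hecke_gens_def)

lemma hsigma_carrier: "i \<in> {1..<n} \<Longrightarrow> hsigma m n q v i \<in> carrier (hecke m n q v)"
  unfolding hsigma_def by (rule hecke_class_simps(4)) (auto simp: hecke_gens_def)

fun PJ :: "nat \<Rightarrow> hgen fword \<Rightarrow>\<^sub>0 'k" where
  "PJ 0 = 1"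
| "PJ (Suc 0) = fgen Tau"
| "PJ (Suc (Suc i)) = fgen (hgen.Sigma (Suc i)) * PJ (Suc i) * fgen (hgen.Sigma (Suc i))"

lemma PJ_carrier: "1 \<le> k \<Longrightarrow> k \<le> n \<Longrightarrow> PJ k \<in> carrier (free_algebra (hecke_gens n))"
  by (induction k rule: PJ.induct) (auto simp: hecke_gens_def)

lemma JM_class: "1 \<le> k \<Longrightarrow> k \<le> n \<Longrightarrow> JM m n q v k = hecke_class m n q v (PJ k)"
proof (induction k rule: PJ.induct)
  case (3 i)
  have c: "fgen (hgen.Sigma (Suc i)) \<in> carrier (free_algebra (hecke_gens n))" using 3 by (auto simp: hecke_gens_def)
  have "PJ (Suc i) \<in> carrier (free_algebra (hecke_gens n))" using 3 by (intro PJ_carrier) auto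
  then show ?case using 3 c by (simp add: hecke_class_simps hsigma_def)
qed (auto simp: htau_def)

end

interpretation Free: central_scalars fconst by (rule central_scalars_fconst)

lemma Free_pev_carrier: "x \<in> carrier (free_algebra G) \<Longrightarrow> Free.pev r x \<in> carrier (free_algebra G)"
  by (induction r) auto

text \<open>The ring is not commutative, so the product is evaluated through the underlying
  \<open>foldD\<close>. The factors are polynomials in the one element \<open>x\<close>, hence
  commute with each other, which is all the fold requires.\<close>

lemma finprod_hecke_class:
  fixes q :: "'k::field"
  assumes x: "x \<in> carrier (free_algebra (hecke_gens n))" and A: "finite A"
  shows "finprod (hecke m n q v) (\<lambda>a. hecke_class m n q v (Free.pev (r a) x)) A = hecke_class m n q v (Free.pev (\<Prod>a\<in>A. r a) x)"
proof -
  interpret H: ring "hecke m n q v" by (rule hecke_ring)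
  let ?f = "\<lambda>a. hecke_class m n q v (Free.pev (r a) x)" and ?H = "hecke m n q v"
  note pc = Free_pev_carrier[OF x]
  have cl: "?f a \<in> carrier ?H" for a using hecke_class_simps(4) pc by blast
  have comm: "?f a \<otimes>\<^bsub>?H\<^esub> ?f b = ?f b \<otimes>\<^bsub>?H\<^esub> ?f a" for a b
    using hecke_class_simps(2)[OF pc pc, of m q v "r a" "r b"] hecke_class_simps(2)[OF pc pc, of m q v "r b" "r a"]
    by (simp add: Free.pev_mult[symmetric] mult.commute)
  interpret L: LCD A "carrier ?H" "monoid.mult ?H \<circ> ?f"
    by unfold_locales (use cl comm in \<open>simp_all add: H.m_assoc[symmetric]\<close>)
  have "foldD (carrier ?H) (monoid.mult ?H \<circ> ?f) \<one>\<^bsub>?H\<^esub> B = hecke_class m n q v (Free.pev (\<Prod>a\<in>B. r a) x)"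
    if "B \<subseteq> A" for B
    using finite_subset[OF that A] that
  proof (induction B rule: finite_induct)
    case (insert b B)
    have "foldD (carrier ?H) (monoid.mult ?H \<circ> ?f) \<one>\<^bsub>?H\<^esub> (insert b B) =
        (monoid.mult ?H \<circ> ?f) b (foldD (carrier ?H) (monoid.mult ?H \<circ> ?f) \<one>\<^bsub>?H\<^esub> B)"
      by (rule L.foldD_insert) (use insert.hyps insert.prems in auto)
    also have "foldD (carrier ?H) (monoid.mult ?H \<circ> ?f) \<one>\<^bsub>?H\<^esub> B = hecke_class m n q v (Free.pev (\<Prod>a\<in>B. r a) x)"
      using insert.prems by (intro insert.IH) auto
    also have "(monoid.mult ?H \<circ> ?f) b \<dots> = hecke_class m n q v (Free.pev (r b) x * Free.pev (\<Prod>a\<in>B. r a) x)"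
      unfolding comp_apply by (rule hecke_class_simps(2)[OF pc pc, symmetric])
    finally show ?case unfolding Free.pev_mult[symmetric] prod.insert[OF insert.hyps] .
  qed (simp add: hecke_class_1)
  then show ?thesis using A by (simp add: finprod_def)
qed

context hecke_params
begin

primrec PE :: "nat \<Rightarrow> mtableau \<Rightarrow> hgen fword \<Rightarrow>\<^sub>0 'k" where
  "PE 0 X = 1"
| "PE (Suc k) X = PE k (remove_entry (Suc k) X) *
     Free.pev (Lag (shape (remove_entry (Suc k) X)) (node_of X (Suc k))) (PJ (Suc k))"

lemma E_upto_class:
  "k \<le> n \<Longrightarrow> X \<in> standard_tableaux m k \<Longrightarrow>
     E_upto m n q v k X = hecke_class m n q v (PE k X) \<and> PE k X \<in> carrier (free_algebra (hecke_gens n))"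
proof (induction k arbitrary: X)
  case 0
  then show ?case by (simp add: hecke_class_1)
next
  case (Suc k)
  let ?Y = "remove_entry (Suc k) X" and ?a = "node_of X (Suc k)" and ?H = "hecke m n q v"
  have IH: "E_upto m n q v k ?Y = hecke_class m n q v (PE k ?Y)" "PE k ?Y \<in> carrier (free_algebra (hecke_gens n))"
    using Suc.IH[OF _ std_remove(1)[OF Suc.prems(2)]] Suc.prems(1) by auto
  have J: "(PJ (Suc k) :: hgen fword \<Rightarrow>\<^sub>0 'k) \<in> carrier (free_algebra (hecke_gens n))" using PJ_carrier[of "Suc k" n] Suc.prems by simp
  have JM: "JM m n q v (Suc k) = hecke_class m n q v (PJ (Suc k))" using JM_class[of "Suc k"] Suc.prems by simp
  have fin: "finite (addable m (shape ?Y) - {?a})" using finite_addable[OF shape_diag[OF std_remove(1)[OF Suc.prems(2)]]] by simp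
  have "hconst m n q v c \<otimes>\<^bsub>?H\<^esub> (JM m n q v (Suc k) \<ominus>\<^bsub>?H\<^esub> hconst m n q v d) =
      hecke_class m n q v (Free.pev (smult c [:- d, 1:]) (PJ (Suc k)))" for c d
    unfolding JM hconst_def Free.pev_smult Free.pev_linear
    by (simp only: hecke_class_simps(2)[OF fconst_carrier free_algebra_closed(3)[OF J fconst_carrier]]
        hecke_class_simps(3)[OF J fconst_carrier])
  then have "E_upto m n q v (Suc k) X = hecke_class m n q v (PE k ?Y) \<otimes>\<^bsub>?H\<^esub>
      hecke_class m n q v (Free.pev (Lag (shape ?Y) ?a) (PJ (Suc k)))"
    unfolding E_upto.simps Let_def IH(1) Lag_def by (simp only: finprod_hecke_class[OF J fin])
  then show ?case using IH(2) Free_pev_carrier[OF J] by (simp add: hecke_class_simps)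
qed

end

definition hgen_val :: "'a \<Rightarrow> (nat \<Rightarrow> 'a) \<Rightarrow> hgen \<Rightarrow> 'a" where
  "hgen_val t s g = (case g of Tau \<Rightarrow> t | hgen.Sigma i \<Rightarrow> s i)"

lemma hgen_val_simps [simp]: "hgen_val t s Tau = t" "hgen_val t s (hgen.Sigma i) = s i"
  by (simp_all add: hgen_val_def)

lemma (in central_scalars) pev_prod_linear:
  "pev (\<Prod>j\<in>{1..m}. [:- v j, 1:]) t = prod_list (map (\<lambda>j. t - \<kappa> (v j)) [1..<Suc m])"
proof -
  have "pev (prod_list (map f xs)) t = prod_list (map (\<lambda>j. pev (f j) t) xs)" for f :: "nat \<Rightarrow> 'k poly" and xs
    by (induction xs) (auto simp: pev_mult)
  moreover have "(\<Prod>j\<in>{1..m}. [:- v j, 1:]) = prod_list (map (\<lambda>j. [:- v j, 1:]) [1..<Suc m])"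
    using prod.distinct_set_conv_list[of "[1..<Suc m]" "\<lambda>j. [:- v j, 1:]"]
    by (simp only: distinct_upt set_upt atLeastLessThanSuc_atLeastAtMost simp_thms)
  ultimately show ?thesis by (simp only: pev_linear)
qed

context hecke_alg
begin

abbreviation "ev \<equiv> fev (hgen_val t s)"

lemma ev_relator: "P \<in> hecke_relators m n q v \<Longrightarrow> ev P = 0"
proof -
  have far: "s i * s j = s j * s i" if "i \<in> {1..<n}" "j \<in> {1..<n}" "1 < \<bar>int i - int j\<bar>" for i j
    using s_far[of i j] s_far[of j i] that by (cases "i < j") auto
  have [simp]: "ev (prod_list (map (\<lambda>j. fgen Tau - fconst (v j)) [1..<Suc m])) = 0"
    using cyc unfolding pev_prod_linear fev_prod_list by (simp del: upt_Suc add: comp_def fev_diff)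
  show "P \<in> hecke_relators m n q v \<Longrightarrow> ev P = 0"
    unfolding hecke_relators_def Let_def
    using braid far t_braid t_s quad by (auto simp: fev_diff fev_mult fev_add simp del: upt_Suc One_nat_def)
qed

lemma ev_ideal: "P \<in> hecke_ideal m n q v \<Longrightarrow> ev P = 0"
proof -
  have "hecke_relators m n q v \<subseteq> {P \<in> carrier (free_algebra (hecke_gens n)). ev P = 0}"
    using hecke_relators_carrier ev_relator by blast
  then have "hecke_ideal m n q v \<subseteq> {P \<in> carrier (free_algebra (hecke_gens n)). ev P = 0}"
    unfolding hecke_ideal_def by (intro ring.genideal_minimal[OF free_algebra_ring] kernel_ideal)
  then show "P \<in> hecke_ideal m n q v \<Longrightarrow> ev P = 0" by blast
qed

text \<open>The homomorphism induced on the quotient, through an arbitrary representative of the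
  coset; \<open>hmap_class\<close> shows that the choice does not matter.\<close>

definition hmap :: "(hgen fword \<Rightarrow>\<^sub>0 'k) set \<Rightarrow> 'a" where
  "hmap C = ev (SOME P. P \<in> C)"

lemma hmap_class: 
  assumes "P \<in> carrier (free_algebra (hecke_gens n))"
  shows "hmap (hecke_class m n q v P) = ev P"
proof -
  have cls: "hecke_class m n q v P = {i + P | i. i \<in> hecke_ideal m n q v}"
    by (auto simp: hecke_class_def a_r_coset_def r_coset_def free_algebra_simps)
  have "0 \<in> hecke_ideal m n q v"
    using additive_subgroup.zero_closed[OF ideal.axioms(1)[OF hecke_is_ideal]] by (simp add: free_algebra_simps)
  then have "P \<in> hecke_class m n q v P" unfolding cls by force
  then have "(SOME Q. Q \<in> hecke_class m n q v P) \<in> hecke_class m n q v P" by (rule someI)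
  then show ?thesis unfolding hmap_def cls using ev_ideal by (auto simp: fev_add)
qed

lemma hmap_simps:
  assumes "x \<in> carrier (hecke m n q v)" "y \<in> carrier (hecke m n q v)"
  shows "hmap (x \<oplus>\<^bsub>hecke m n q v\<^esub> y) = hmap x + hmap y" "hmap (x \<otimes>\<^bsub>hecke m n q v\<^esub> y) = hmap x * hmap y"
    "hmap (x \<ominus>\<^bsub>hecke m n q v\<^esub> y) = hmap x - hmap y"
proof -
  obtain P Q where P: "P \<in> carrier (free_algebra (hecke_gens n))" "x = hecke_class m n q v P"
    and Q: "Q \<in> carrier (free_algebra (hecke_gens n))" "y = hecke_class m n q v Q"
    using assms unfolding hecke_carrier by blast
  show "hmap (x \<oplus>\<^bsub>hecke m n q v\<^esub> y) = hmap x + hmap y" "hmap (x \<otimes>\<^bsub>hecke m n q v\<^esub> y) = hmap x * hmap y"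
    "hmap (x \<ominus>\<^bsub>hecke m n q v\<^esub> y) = hmap x - hmap y"
    unfolding P Q hecke_class_simps(1-3)[OF P(1) Q(1), symmetric]
    using P(1) Q(1) by (simp_all add: hmap_class fev_add fev_mult fev_diff)
qed

lemma hmap_0: "hmap \<zero>\<^bsub>hecke m n q v\<^esub> = 0" 
  unfolding hecke_class_0[symmetric] by (simp add: hmap_class fev_0)
lemma hmap_1: "hmap \<one>\<^bsub>hecke m n q v\<^esub> = 1"
  unfolding hecke_class_1[symmetric] by (simp add: hmap_class)
lemma hmap_const: "hmap (hconst m n q v c) = \<kappa> c"
  unfolding hconst_def by (simp add: hmap_class)
lemma hmap_tau: "hmap (htau m n q v) = t"
  unfolding htau_def by (simp add: hmap_class hecke_gens_def)
lemma hmap_sigma: "i \<in> {1..<n} \<Longrightarrow> hmap (hsigma m n q v i) = s i"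
  unfolding hsigma_def by (subst hmap_class) (auto simp: hecke_gens_def)

lemma ev_pev: "ev (Free.pev r x) = pev r (ev x)"
  by (induction r) (auto simp: fev_add fev_mult fev_0)

lemma ev_PJ: "ev (PJ k) = J k"
  by (induction k rule: PJ.induct) (auto simp: fev_mult)

lemma ev_PE: "ev (PE k X) = E k X"
  by (induction k arbitrary: X) (auto simp: fev_mult ev_pev ev_PJ E.simps)

lemma hmap_E: "X \<in> standard_tableaux m n \<Longrightarrow> hmap (E_elt m n q v X) = E n X"
  unfolding E_elt_def using E_upto_class[of n X] by (auto simp: hmap_class ev_PE)

lemma E_elt_carrier: "X \<in> standard_tableaux m n \<Longrightarrow> E_elt m n q v X \<in> carrier (hecke m n q v)"
  unfolding E_elt_def using E_upto_class[of n X] by (auto simp: hecke_class_simps)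

lemma hmap_Alg:
  assumes "x \<in> carrier (hecke m n q v)" "1 \<le> n"
  shows "hmap x \<in> Alg n"
proof -
  obtain P where P: "P \<in> carrier (free_algebra (hecke_gens n))" "x = hecke_class m n q v P"
    using assms(1) unfolding hecke_carrier by blast
  have "hgen_val t s g \<in> Alg n" if "g \<in> hecke_gens n" for g
    using that Alg_t[OF assms(2)] Alg_s[of _ n] by (auto simp: hecke_gens_def)
  then have "ev P \<in> Alg n" by (rule fev_closed[OF _ Alg_scalar Alg_add Alg_mult P(1)])
  then show ?thesis using P by (simp add: hmap_class)
qed

end

section \<open>Embedding the Hecke algebra in a ring type\<close>

definition two_sided :: "'r::ring_1 set \<Rightarrow> bool" where
  "two_sided I \<longleftrightarrow> 0 \<in> I \<and> (\<forall>x\<in>I. \<forall>y\<in>I. x - y \<in> I) \<and> (\<forall>x\<in>I. \<forall>y. x * y \<in> I \<and> y * x \<in> I)"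

lemma two_sided_closed:
  assumes "two_sided I"
  shows "0 \<in> I" "x \<in> I \<Longrightarrow> y \<in> I \<Longrightarrow> x - y \<in> I" "x \<in> I \<Longrightarrow> x * y \<in> I" "x \<in> I \<Longrightarrow> y * x \<in> I"
    "x \<in> I \<Longrightarrow> - x \<in> I" "x \<in> I \<Longrightarrow> y \<in> I \<Longrightarrow> x + y \<in> I"
proof -
  show 0: "0 \<in> I" and d: "\<And>x y. x \<in> I \<Longrightarrow> y \<in> I \<Longrightarrow> x - y \<in> I"
    and "x \<in> I \<Longrightarrow> x * y \<in> I" "x \<in> I \<Longrightarrow> y * x \<in> I"
    using assms by (auto simp: two_sided_def)
  show m: "\<And>x. x \<in> I \<Longrightarrow> - x \<in> I" using d[OF 0] by simp
  show "x \<in> I \<Longrightarrow> y \<in> I \<Longrightarrow> x + y \<in> I" using d[OF _ m, of x y] by simp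
qed

text \<open>A type cannot depend on the parameters of the algebra, so the product of all quotient rings
  serves as a single type of class \<open>ring_1\<close> into which every quotient embeds.\<close>

definition quot_rel :: "('r::ring_1 set \<Rightarrow> 'r) \<Rightarrow> ('r set \<Rightarrow> 'r) \<Rightarrow> bool" where
  "quot_rel f g \<longleftrightarrow> (\<forall>I. two_sided I \<longrightarrow> f I - g I \<in> I)"

lemma quot_rel_sym: "quot_rel f g \<Longrightarrow> quot_rel g f"
  unfolding quot_rel_def using two_sided_closed(5) by (metis minus_diff_eq)

lemma quot_rel_trans: "quot_rel f g \<Longrightarrow> quot_rel g h \<Longrightarrow> quot_rel f h"
proof -
  have "f I - h I = (f I - g I) + (g I - h I)" for I by simp
  then show "quot_rel f g \<Longrightarrow> quot_rel g h \<Longrightarrow> quot_rel f h"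
    unfolding quot_rel_def using two_sided_closed(6) by metis
qed

quotient_type (overloaded) 'r quots = "'r::ring_1 set \<Rightarrow> 'r" / quot_rel
  by (intro equivpI reflpI sympI transpI) (simp add: quot_rel_def two_sided_closed, rule quot_rel_sym, assumption,
      rule quot_rel_trans)

instantiation quots :: (ring_1) ring_1
begin

lift_definition zero_quots :: "'a quots" is "\<lambda>_. 0" .
lift_definition one_quots :: "'a quots" is "\<lambda>_. 1" .

lift_definition plus_quots :: "'a quots \<Rightarrow> 'a quots \<Rightarrow> 'a quots" is "\<lambda>f g I. f I + g I"
proof -
  fix f f' g g' :: "'a set \<Rightarrow> 'a" assume h: "quot_rel f f'" "quot_rel g g'"
  have "(f I + g I) - (f' I + g' I) = (f I - f' I) + (g I - g' I)" for I by simp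
  then show "quot_rel (\<lambda>I. f I + g I) (\<lambda>I. f' I + g' I)" using h two_sided_closed(6) unfolding quot_rel_def by metis
qed

lift_definition uminus_quots :: "'a quots \<Rightarrow> 'a quots" is "\<lambda>f I. - f I"
proof -
  fix f f' :: "'a set \<Rightarrow> 'a" assume h: "quot_rel f f'"
  have "(- f I) - (- f' I) = - (f I - f' I)" for I by simp
  then show "quot_rel (\<lambda>I. - f I) (\<lambda>I. - f' I)" using h two_sided_closed(5) unfolding quot_rel_def by metis
qed

definition minus_quots :: "'a quots \<Rightarrow> 'a quots \<Rightarrow> 'a quots" where
  "minus_quots x y = x + - y"

lift_definition times_quots :: "'a quots \<Rightarrow> 'a quots \<Rightarrow> 'a quots" is "\<lambda>f g I. f I * g I"
proof -
  fix f f' g g' :: "'a set \<Rightarrow> 'a" assume h: "quot_rel f f'" "quot_rel g g'"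
  have "f I * g I - f' I * g' I = (f I - f' I) * g I + f' I * (g I - g' I)" for I by (simp add: algebra_simps)
  then show "quot_rel (\<lambda>I. f I * g I) (\<lambda>I. f' I * g' I)"
    using h two_sided_closed(3,4,6) unfolding quot_rel_def by metis
qed

instance
proof
  fix a b c :: "'a quots"
  show "a + b + c = a + (b + c)" by transfer (simp add: quot_rel_def two_sided_closed add.assoc)
  show "a + b = b + a" by transfer (simp add: quot_rel_def two_sided_closed)
  show "0 + a = a" by transfer (simp add: quot_rel_def two_sided_closed)
  show "- a + a = 0" by transfer (simp add: quot_rel_def two_sided_closed)
  show "a - b = a + - b" by (simp add: minus_quots_def)
  show "a * b * c = a * (b * c)" by transfer (simp add: quot_rel_def two_sided_closed mult.assoc)
  show "1 * a = a" "a * 1 = a" by (transfer, simp add: quot_rel_def two_sided_closed)+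
  show "(a + b) * c = a * c + b * c" by transfer (simp add: quot_rel_def two_sided_closed distrib_right)
  show "a * (b + c) = a * b + a * c" by transfer (simp add: quot_rel_def two_sided_closed distrib_left)
  \<comment> \<open>The component at the zero ideal is the original ring, so the product is
    nontrivial even if the quotient of interest should collapse.\<close>
  show "(0::'a quots) \<noteq> 1"
  proof transfer
    have "two_sided {0::'a}" by (simp add: two_sided_def)
    then show "\<not> quot_rel (\<lambda>_. 0) (\<lambda>_. 1::'a)" unfolding quot_rel_def by fastforce
  qed
qed

end

text \<open>The component at \<open>I\<close> carries \<open>x\<close> itself. The others carry
  \<open>c x\<close>, where a ring endomorphism \<open>c\<close> keeps the embedding additive,
  multiplicative and unital.\<close>

lift_definition at_quot :: "'r::ring_1 set \<Rightarrow> ('r \<Rightarrow> 'r) \<Rightarrow> 'r \<Rightarrow> 'r quots" is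
  "\<lambda>I c x J. if J = I then x else c x" .

lemma at_quot_add: "(\<And>x y. c (x + y) = c x + c y) \<Longrightarrow> at_quot I c (x + y) = at_quot I c x + at_quot I c y"
  by transfer (auto simp: quot_rel_def two_sided_closed)

lemma at_quot_mult: "(\<And>x y. c (x * y) = c x * c y) \<Longrightarrow> at_quot I c (x * y) = at_quot I c x * at_quot I c y"
  by transfer (auto simp: quot_rel_def two_sided_closed)

lemma at_quot_1: "c 1 = 1 \<Longrightarrow> at_quot I c 1 = 1"
  by transfer (auto simp: quot_rel_def two_sided_closed)

lemma at_quot_eq_0: "two_sided I \<Longrightarrow> at_quot I c x = 0 \<Longrightarrow> x \<in> I"
  by transfer (auto simp: quot_rel_def)

lemma at_quot_0: "x \<in> I \<Longrightarrow> c x = 0 \<Longrightarrow> at_quot I c x = 0"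
  by transfer (auto simp: quot_rel_def two_sided_closed)

text \<open>Scalars are placed diagonally, where centrality is inherited from the original ring; an
  endomorphism \<open>c\<close> fixing them makes this agree with \<open>at_quot\<close>.\<close>

lift_definition diag_quot :: "'r::ring_1 \<Rightarrow> 'r quots" is "\<lambda>x _. x" .

lemma diag_quot_simps:
  "diag_quot (x + y) = diag_quot x + diag_quot y" "diag_quot (x * y) = diag_quot x * diag_quot y" "diag_quot 1 = 1"
  by (transfer, simp add: quot_rel_def two_sided_closed)+

lemma diag_quot_central: "(\<And>y. x * y = y * x) \<Longrightarrow> diag_quot x * z = z * diag_quot x"
  by transfer (simp add: quot_rel_def two_sided_closed)

lemma at_quot_diag: "c x = x \<Longrightarrow> at_quot I c x = diag_quot x"
  by transfer (auto simp: quot_rel_def two_sided_closed)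

lemma Free_fev_fgen: "Free.fev fgen P = P"
  using central_scalars_eqI[OF central_scalars_fconst, of "\<lambda>x. x" P] by simp

lemma Free_fev_carrier:
  fixes P :: "'a fword \<Rightarrow>\<^sub>0 'b::field"
  assumes "P \<in> carrier (free_algebra G)"
  shows "Free.fev (\<lambda>g. if g \<in> G then fgen g else 0) P = P"
proof -
  have "Free.fev (\<lambda>g. if g \<in> G then fgen g else 0) P = Free.fev fgen P" unfolding Free.fev_def
  proof (intro sum.cong refl)
    fix w assume "w \<in> Poly_Mapping.keys P"
    then have "map (\<lambda>g. if g \<in> G then fgen g else 0) (letters w) = map (fgen :: _ \<Rightarrow> _ \<Rightarrow>\<^sub>0 'b) (letters w)"
      using assms by (auto simp: free_algebra_mem subset_iff)
    then show "fconst (poly_mapping.lookup P w) * prod_list (map (\<lambda>g. if g \<in> G then fgen g else 0) (letters w)) =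
         fconst (poly_mapping.lookup P w) * prod_list (map fgen (letters w))" by (simp only:)
  qed
  then show ?thesis by (simp add: Free_fev_fgen)
qed

context hecke_params
begin

text \<open>The type of words has generators \<open>Sigma i\<close> for every \<open>i\<close>,
  whereas the carrier uses finitely many. Sending the surplus generators to 0 allows the ideal in
  the carrier to be pulled back to a two-sided ideal of the whole ring type.\<close>

definition retract :: "(hgen fword \<Rightarrow>\<^sub>0 'k) \<Rightarrow> (hgen fword \<Rightarrow>\<^sub>0 'k)" where
  "retract = Free.fev (\<lambda>g. if g \<in> hecke_gens n then fgen g else 0)"

definition big_ideal :: "(hgen fword \<Rightarrow>\<^sub>0 'k) set" where
  "big_ideal = {P. retract P \<in> hecke_ideal m n q v}"

text \<open>The components that do not belong to \<open>big_ideal\<close> are filled by the character \<open>\<tau> \<mapsto> v\<^sub>1\<close>,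
  \<open>\<sigma>\<^sub>i \<mapsto> q\<close>, so that the relations hold in all of them.\<close>

definition chi :: "(hgen fword \<Rightarrow>\<^sub>0 'k) \<Rightarrow> (hgen fword \<Rightarrow>\<^sub>0 'k)" where
  "chi = Free.fev (hgen_val (fconst (v 1)) (\<lambda>_. fconst q))"

definition uni :: "(hgen fword \<Rightarrow>\<^sub>0 'k) \<Rightarrow> (hgen fword \<Rightarrow>\<^sub>0 'k) quots" where
  "uni = at_quot big_ideal chi"

lemma retract_carrier: "retract P \<in> carrier (free_algebra (hecke_gens n))"
proof -
  have P: "P \<in> carrier (free_algebra UNIV)" by (simp add: free_algebra_mem)
  show ?thesis unfolding retract_def
    by (rule Free.fev_closed[where S = "carrier (free_algebra (hecke_gens n))", OF _ _ _ _ P]) auto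
qed

lemma big_ideal_two_sided: "two_sided big_ideal"
proof -
  interpret I: ideal "hecke_ideal m n q v" "free_algebra (hecke_gens n)" by (rule hecke_is_ideal)
  let ?I = "hecke_ideal m n q v"
  have zero: "0 \<in> ?I" using additive_subgroup.zero_closed[OF I.additive_subgroup_axioms] by (simp add: free_algebra_simps)
  have add: "x + y \<in> ?I" if "x \<in> ?I" "y \<in> ?I" for x y using additive_subgroup.a_closed[OF I.additive_subgroup_axioms that] by (simp add: free_algebra_simps)
  have min: "- x \<in> ?I" if "x \<in> ?I" for x using additive_subgroup.a_inv_closed[OF I.additive_subgroup_axioms that] I.Icarr[OF that] by (simp add: free_algebra_uminus)
  have diff: "x - y \<in> ?I" if "x \<in> ?I" "y \<in> ?I" for x y using add[OF that(1) min[OF that(2)]] by simp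
  have m: "x * y \<in> ?I" "y * x \<in> ?I" if "x \<in> ?I" "y \<in> carrier (free_algebra (hecke_gens n))" for x y
    using I.I_r_closed[OF that] I.I_l_closed[OF that] by (simp_all add: free_algebra_simps)
  have r: "retract 0 = 0" "\<And>x y. retract (x - y) = retract x - retract y" "\<And>x y. retract (x * y) = retract x * retract y"
    by (simp_all add: retract_def Free.fev_0 Free.fev_diff Free.fev_mult)
  show ?thesis unfolding two_sided_def big_ideal_def mem_Collect_eq r using zero diff m retract_carrier by simp
qed

text \<open>The retraction fixes the carrier, so the pulled-back ideal meets it exactly in the Hecke
  ideal; this makes the embedding injective.\<close>

lemma uni_eq_0:
  assumes "P \<in> carrier (free_algebra (hecke_gens n))" "uni P = 0"
  shows "P \<in> hecke_ideal m n q v"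
  using at_quot_eq_0[OF big_ideal_two_sided, of chi P] assms Free_fev_carrier[OF assms(1)]
  by (simp add: uni_def big_ideal_def retract_def)

lemma uni_add: "uni (x + y) = uni x + uni y" and uni_mult: "uni (x * y) = uni x * uni y" and uni_1: "uni 1 = 1"
  unfolding uni_def by (auto intro!: at_quot_add at_quot_mult at_quot_1 simp: chi_def Free.fev_add Free.fev_mult)

lemma uni_minus: "uni (- x) = - uni x"
  using uni_add[of x "- x"] at_quot_0[of 0 big_ideal chi] big_ideal_two_sided
  by (simp add: uni_def two_sided_def chi_def Free.fev_0 eq_neg_iff_add_eq_0 add.commute)

lemma uni_diff: "uni (x - y) = uni x - uni y"
  using uni_add[of x "- y"] by (simp add: uni_minus)

lemma uni_const: "uni (fconst c) = diag_quot (fconst c)"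
  unfolding uni_def by (rule at_quot_diag) (simp add: chi_def)

sublocale Uni: central_scalars "\<lambda>c. diag_quot (fconst c :: hgen fword \<Rightarrow>\<^sub>0 'k)"
  by unfold_locales
    (auto simp: Free.\<kappa>_add Free.\<kappa>_mult Free.\<kappa>_1 diag_quot_simps intro!: diag_quot_central fconst_central)

lemma uni_fev: "uni P = Uni.fev (\<lambda>g. uni (fgen g)) P"
  by (rule central_scalars_eqI[OF Uni.central_scalars_axioms]) (auto simp: uni_add uni_mult uni_const)

text \<open>In the distinguished component the relator lies in the ideal. In all others it is killed
  by the character: the factor for \<open>j = 1\<close> annihilates the cyclotomic relator, and
  \<open>q\<close> is a root of the quadratic relation.\<close>

lemma uni_relator:
  assumes m: "1 \<le> m" and P: "P \<in> hecke_relators m n q v"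
  shows "uni P = 0"
proof -
  have "P \<in> carrier (free_algebra (hecke_gens n))" using hecke_relators_carrier P by blast
  moreover have "P \<in> hecke_ideal m n q v" unfolding hecke_ideal_def
    using ring.genideal_self[OF free_algebra_ring hecke_relators_carrier] P by blast
  ultimately have 1: "P \<in> big_ideal" by (simp add: big_ideal_def retract_def Free_fev_carrier)
  have [simp]: "Free.fev (hgen_val (fconst (v 1)) (\<lambda>_. fconst q)) (prod_list (map (\<lambda>j. fgen Tau - fconst (v j)) [1..<Suc m])) = (0 :: hgen fword \<Rightarrow>\<^sub>0 'k)"
  proof -
    have "0 \<in> set (map (\<lambda>j. fconst (v 1) - fconst (v j) :: hgen fword \<Rightarrow>\<^sub>0 'k) [1..<Suc m])"
      using m by (auto simp: image_iff simp del: upt_Suc intro!: bexI[of _ 1])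
    moreover have "0 \<in> set xs \<Longrightarrow> prod_list xs = 0" for xs :: "(hgen fword \<Rightarrow>\<^sub>0 'k) list"
      by (induction xs) auto
    ultimately have "prod_list (map (\<lambda>j. fconst (v 1) - fconst (v j) :: hgen fword \<Rightarrow>\<^sub>0 'k) [1..<Suc m]) = 0" by blast
    then show ?thesis by (simp add: Free.fev_prod_list comp_def Free.fev_diff del: upt_Suc One_nat_def)
  qed
  have k: "fconst (q - inverse q) * fconst q + 1 = (fconst q * fconst q :: hgen fword \<Rightarrow>\<^sub>0 'k)"
    unfolding Free.\<kappa>_mult[symmetric] Free.\<kappa>_1[symmetric] Free.\<kappa>_add[symmetric]
    using q0 by (simp add: algebra_simps)
  have c: "fconst (v 1) * fconst q = (fconst q * fconst (v 1) :: hgen fword \<Rightarrow>\<^sub>0 'k)" by (rule fconst_central)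
  have c': "fconst (v 1) * (fconst q * x) = fconst q * (fconst (v 1) * x)" for x :: "hgen fword \<Rightarrow>\<^sub>0 'k"
    by (rule Free.\<kappa>_left)
  have "chi P = 0"
    using P unfolding hecke_relators_def Let_def chi_def
    by (elim UnE CollectE exE conjE; hypsubst?) (simp_all add: Free.fev_diff Free.fev_mult Free.fev_add k c c' mult.assoc del: upt_Suc One_nat_def)
  then show ?thesis using at_quot_0[OF 1] by (simp add: uni_def)
qed

lemma uni_hecke_alg:
  assumes m: "1 \<le> m"
  shows "hecke_alg (\<lambda>c. diag_quot (fconst c)) m n q v (uni (fgen Tau)) (\<lambda>i. uni (fgen (hgen.Sigma i)))"
proof unfold_locales
  note rel = uni_relator[OF m, unfolded hecke_relators_def Let_def]
  let ?T = "uni (fgen Tau)" and ?S = "\<lambda>i. uni (fgen (hgen.Sigma i))"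
  { fix i :: nat assume "1 \<le> i" "i + 1 < n"
    then have "uni (fgen (hgen.Sigma i) * fgen (hgen.Sigma (i + 1)) * fgen (hgen.Sigma i) - fgen (hgen.Sigma (i + 1)) * fgen (hgen.Sigma i) * fgen (hgen.Sigma (i + 1))) = 0"
      by (intro rel) blast
    then show "?S i * ?S (i + 1) * ?S i = ?S (i + 1) * ?S i * ?S (i + 1)" by (simp add: uni_mult uni_diff) }
  { fix i j :: nat assume h: "1 \<le> i" "i + 1 < j" "j < n"
    have "uni (fgen (hgen.Sigma i) * fgen (hgen.Sigma j) - fgen (hgen.Sigma j) * fgen (hgen.Sigma i)) = 0"
      by (rule rel, rule UnI1, rule UnI1, rule UnI1, rule UnI1, rule UnI2) (use h in force)
    then show "?S i * ?S j = ?S j * ?S i" by (simp add: uni_mult uni_diff) }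
  { assume "1 < n"
    then have "uni (fgen Tau * fgen (hgen.Sigma 1) * fgen Tau * fgen (hgen.Sigma 1) - fgen (hgen.Sigma 1) * fgen Tau * fgen (hgen.Sigma 1) * fgen Tau) = 0"
      by (intro rel) blast
    then show "?T * ?S 1 * ?T * ?S 1 = ?S 1 * ?T * ?S 1 * ?T" by (simp add: uni_mult uni_diff) }
  { fix i :: nat assume "1 < i" "i < n"
    then have "uni (fgen Tau * fgen (hgen.Sigma i) - fgen (hgen.Sigma i) * fgen Tau) = 0" by (intro rel) blast
    then show "?T * ?S i = ?S i * ?T" by (simp add: uni_mult uni_diff) }
  { fix i :: nat assume "1 \<le> i" "i < n"
    then have "uni (fgen (hgen.Sigma i) * fgen (hgen.Sigma i) - (fconst (q - inverse q) * fgen (hgen.Sigma i) + 1)) = 0"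
      by (intro rel) blast
    then show "?S i * ?S i = diag_quot (fconst (q - inverse q)) * ?S i + 1" by (simp add: uni_mult uni_diff uni_add uni_const uni_1) }
  have "uni (prod_list (map (\<lambda>j. fgen Tau - fconst (v j)) [1..<Suc m])) = 0" by (intro rel) blast
  then show "Uni.pev (\<Prod>j\<in>{1..m}. [:- v j, 1:]) ?T = 0"
    unfolding Uni.pev_prod_linear
    by (subst (asm) uni_fev) (simp add: Uni.fev_prod_list comp_def Uni.fev_diff del: upt_Suc)
qed

end

section \<open>The seminormal representation\<close>

text \<open>Linear operators as a ring type, so that the locale of the Hecke relations can be
  interpreted in it.\<close>

typedef (overloaded) ('b, 'k) lop = "{T :: ('b \<Rightarrow> 'k::field) \<Rightarrow> 'b \<Rightarrow> 'k.
    (\<forall>f g. T (\<lambda>x. f x + g x) = (\<lambda>x. T f x + T g x)) \<and> (\<forall>c f. T (\<lambda>x. c * f x) = (\<lambda>x. c * T f x))}"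
  by (rule exI[of _ "\<lambda>f. f"]) simp

setup_lifting type_definition_lop

lift_definition lapp :: "('b, 'k::field) lop \<Rightarrow> ('b \<Rightarrow> 'k) \<Rightarrow> 'b \<Rightarrow> 'k" is "\<lambda>T. T" .

lemma lapp_linear: "lapp T (\<lambda>x. f x + g x) = (\<lambda>x. lapp T f x + lapp T g x)" "lapp T (\<lambda>x. c * f x) = (\<lambda>x. c * lapp T f x)"
  by (transfer, auto)+

lemma lop_eqI: "(\<And>f x. lapp T f x = lapp U f x) \<Longrightarrow> T = U"
  by transfer auto

instantiation lop :: (type, field) ring_1
begin

lift_definition zero_lop :: "('a, 'b) lop" is "\<lambda>f x. 0" by auto
lift_definition one_lop :: "('a, 'b) lop" is "\<lambda>f. f" by auto
lift_definition plus_lop :: "('a, 'b) lop \<Rightarrow> ('a, 'b) lop \<Rightarrow> ('a, 'b) lop" is "\<lambda>T U f x. T f x + U f x"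
  by (auto simp: fun_eq_iff algebra_simps)
lift_definition uminus_lop :: "('a, 'b) lop \<Rightarrow> ('a, 'b) lop" is "\<lambda>T f x. - T f x"
  by (auto simp: fun_eq_iff algebra_simps)
lift_definition minus_lop :: "('a, 'b) lop \<Rightarrow> ('a, 'b) lop \<Rightarrow> ('a, 'b) lop" is "\<lambda>T U f x. T f x - U f x"
  by (auto simp: fun_eq_iff algebra_simps)
lift_definition times_lop :: "('a, 'b) lop \<Rightarrow> ('a, 'b) lop \<Rightarrow> ('a, 'b) lop" is "\<lambda>T U f. T (U f)"
  by auto

lemma lapp_simps: "lapp 0 f x = 0" "lapp 1 f x = f x" "lapp (T + U) f x = lapp T f x + lapp U f x"
  "lapp (T * U) f = lapp T (lapp U f)" "lapp (- T) f x = - lapp T f x" "lapp (T - U) f x = lapp T f x - lapp U f x"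
  by (transfer, simp)+

lemma lapp_1: "lapp 1 f = f"
  by transfer simp

instance
proof
  fix T U V :: "('a, 'b) lop"
  have add: "lapp T (lapp (U + V) f) x = lapp T (lapp U f) x + lapp T (lapp V f) x" for T U V :: "('a, 'b) lop" and f x
  proof -
    have "lapp (U + V) f = (\<lambda>x. lapp U f x + lapp V f x)" by (rule ext) (rule lapp_simps)
    then show ?thesis using lapp_linear(1)[of T "lapp U f" "lapp V f"] by simp
  qed
  show "T * (U + V) = T * U + T * V" by (rule lop_eqI) (simp add: lapp_simps(3,4) add)
  show "(0 :: ('a, 'b) lop) \<noteq> 1"
  proof
    assume "(0 :: ('a, 'b) lop) = 1"
    then have "lapp (0 :: ('a, 'b) lop) (\<lambda>_. 1) undefined = lapp 1 (\<lambda>_. 1) undefined" by simp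
    then show False by (simp add: lapp_simps)
  qed
qed (auto intro!: lop_eqI simp: lapp_simps lapp_1 algebra_simps)

end

lift_definition lscale :: "'k::field \<Rightarrow> ('b, 'k) lop" is "\<lambda>c f x. c * f x"
  by (auto simp: fun_eq_iff algebra_simps)

lemma lapp_scale: "lapp (lscale c) f = (\<lambda>x. c * f x)" by transfer simp

interpretation Lop: central_scalars "lscale :: 'k::field \<Rightarrow> ('b, 'k) lop"
  by unfold_locales (auto intro!: lop_eqI simp: lapp_simps lapp_scale lapp_linear algebra_simps)

lift_definition lstep :: "('b \<Rightarrow> 'k::field) \<Rightarrow> ('b \<Rightarrow> 'k) \<Rightarrow> ('b \<Rightarrow> 'b) \<Rightarrow> ('b, 'k) lop" is
  "\<lambda>a b g f x. a x * f x + b x * f (g x)"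
  by (auto simp: fun_eq_iff algebra_simps)

lemma lapp_step: "lapp (lstep a b g) f x = a x * f x + b x * f (g x)" by transfer simp

text \<open>Diagonal action is needed only at the single point \<open>x\<close>; elsewhere the
  operator may be arbitrary.\<close>

lemma lapp_diag_pev: 
  assumes "\<And>f. lapp T f x = c * f x"
  shows "lapp (Lop.pev r T) f x = poly r c * f x"
  by (induction r) (simp_all add: lapp_simps lapp_scale assms algebra_simps)

context hecke_params
begin

text \<open>The seminormal representation acts on all functions on tableaux; off the standard ones it is the
  character \<open>\<tau> \<mapsto> v\<^sub>1\<close>, \<open>\<sigma>\<^sub>i \<mapsto> q\<close>, which makes the relations hold on the whole space.\<close>

definition seminormal_diag :: "'k \<Rightarrow> 'k \<Rightarrow> 'k" where
  "seminormal_diag x y = (q - inverse q) * y / (y - x)"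

definition sn_a :: "nat \<Rightarrow> mtableau \<Rightarrow> 'k" where
  "sn_a i X = (if X \<in> standard_tableaux m n then seminormal_diag (cat X i) (cat X (i + 1)) else q)"

text \<open>The diagonal coefficient is the scalar \<open>p * b / (b - a)\<close> of
  \<open>s_scalar_of_Phi_0\<close>. The off-diagonal one is normalized as \<open>q\<close> minus it:
  the two off-diagonal entries then have the product dictated by the quadratic relation, without
  square roots.\<close>

definition sn_b :: "nat \<Rightarrow> mtableau \<Rightarrow> 'k" where
  "sn_b i X = (if X \<in> standard_tableaux m n \<and> swap_tableau i X \<in> standard_tableaux m n
     then q - seminormal_diag (cat X i) (cat X (i + 1)) else 0)"

definition sn_s :: "nat \<Rightarrow> (mtableau, 'k) lop" where
  "sn_s i = lstep (sn_a i) (sn_b i) (swap_tableau i)"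

definition sn_d :: "mtableau \<Rightarrow> 'k" where
  "sn_d X = (if X \<in> standard_tableaux m n then cat X 1 else v 1)"

definition sn_t :: "(mtableau, 'k) lop" where
  "sn_t = lstep sn_d (\<lambda>_. 0) (\<lambda>X. X)"

lemma lapp_sn_s: "lapp (sn_s i) f X = sn_a i X * f X + sn_b i X * f (swap_tableau i X)"
  unfolding sn_s_def lapp_step ..

lemma lapp_sn_t: "lapp sn_t f X = sn_d X * f X"
  unfolding sn_t_def lapp_step by simp

text \<open>The diagonal entries of the block for two exchanged tableaux add up to its trace
  \<open>q - inverse q\<close>, the sum of the two roots of the quadratic relation.\<close>

lemma sd_sum: "x \<noteq> y \<Longrightarrow> seminormal_diag y x = (q - inverse q) - seminormal_diag x y"
  unfolding seminormal_diag_def by (simp add: divide_simps) (simp add: algebra_simps)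

text \<open>The relation among three contents that remains of the braid relation once the
  off-diagonal coefficients are eliminated.\<close>

lemma sd_rel:
  assumes "x \<noteq> y" "y \<noteq> z" "x \<noteq> z"
  shows "seminormal_diag x y * seminormal_diag y z =
    seminormal_diag x z * (seminormal_diag x y + seminormal_diag y z - (q - inverse q))"
proof -
  have "(y / (y - x)) * (z / (z - y)) = (z / (z - x)) * (y / (y - x) + z / (z - y) - 1)"
    using assms by (simp add: divide_simps) (simp add: algebra_simps)
  moreover have "(c * a) * (c * b) = (c * d) * (c * a + c * b - c)" if "a * b = d * (a + b - 1)" for a b c d :: 'k
  proof -
    have "(c * a) * (c * b) = c * c * (a * b)" by (simp add: algebra_simps)
    also have "\<dots> = (c * d) * (c * a + c * b - c)" unfolding that by (simp add: algebra_simps)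
    finally show ?thesis .
  qed
  ultimately show ?thesis unfolding seminormal_diag_def times_divide_eq_right[symmetric] by blast
qed

lemma sd_weighted: "x \<noteq> y \<Longrightarrow> seminormal_diag x y * x + seminormal_diag y x * y = 0"
  unfolding seminormal_diag_def by (simp add: divide_simps) (simp add: algebra_simps)

context
  fixes i :: nat and X :: mtableau
  assumes X: "X \<in> standard_tableaux m n" and i: "1 \<le> i" "i < n"
begin

text \<open>The factor \<open>sn_b i X\<close> vanishes if the exchange is not standard, which makes
  the identity hold without a case distinction at its uses.\<close>

lemma sn_a_swap: "sn_b i X * sn_a i (swap_tableau i X) = sn_b i X * ((q - inverse q) - sn_a i X)"
proof -
  have "seminormal_diag (cat X (i + 1)) (cat X i) = (q - inverse q) - seminormal_diag (cat X i) (cat X (i + 1))"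
    by (rule sd_sum) (use cat_next_ne[OF X order_refl i] in simp)
  then show ?thesis
    using X cat_swap[OF X i, of i] cat_swap[OF X i, of "i + 1"] i by (simp add: sn_a_def sn_b_def)
qed

text \<open>If the exchange is not standard, the two nodes are neighbours, the diagonal coefficient
  is \<open>q\<close> or \<open>- inverse q\<close>, and the right-hand side vanishes because these
  are the roots of the quadratic relation.\<close>

lemma sn_b_swap: "sn_b i X * sn_b i (swap_tableau i X) = 1 + sn_a i X * ((q - inverse q) - sn_a i X)"
proof (cases "swap_tableau i X \<in> standard_tableaux m n")
  case True
  let ?a = "seminormal_diag (cat X i) (cat X (i + 1))"
  have "sn_b i (swap_tableau i X) = q - seminormal_diag (cat X (i + 1)) (cat X i)"
    using X True cat_swap[OF X i, of i] cat_swap[OF X i, of "i + 1"] i by (simp add: sn_b_def)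
  also have "\<dots> = inverse q + ?a" using sd_sum[of "cat X i" "cat X (i + 1)"] cat_next_ne[OF X order_refl i] by simp
  finally have b': "sn_b i (swap_tableau i X) = inverse q + ?a" .
  have "(q - a) * (inverse q + a) = 1 + a * ((q - inverse q) - a)" for a
    using q0 by (simp add: algebra_simps)
  then show ?thesis unfolding b' using X True by (simp only: sn_b_def sn_a_def if_True simp_thms)
next
  case False
  let ?x = "cat X i" and ?y = "cat X (i + 1)"
  have ne: "?x \<noteq> ?y" using cat_next_ne[OF X order_refl i] by simp
  have nz: "?x \<noteq> 0" "?y \<noteq> 0" using cat_nz[OF X] i by auto
  have "sn_a i X = q \<or> sn_a i X = - inverse q"
    using not_swap_q2[OF X i False]
  proof
    assume e: "?y = q\<^sup>2 * ?x"
    have "(q - inverse q) * ?y = q * (?y - ?x)" using q0 unfolding e by (simp add: power2_eq_square algebra_simps)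
    then have "seminormal_diag ?x ?y = q" unfolding seminormal_diag_def using ne by simp
    then show ?thesis using X by (simp add: sn_a_def)
  next
    assume e: "q\<^sup>2 * ?y = ?x"
    have "(q - inverse q) * ?y = - inverse q * (?y - ?x)" using q0 unfolding e[symmetric] by (simp add: power2_eq_square algebra_simps)
    then have "seminormal_diag ?x ?y = - inverse q" unfolding seminormal_diag_def using ne by simp
    then show ?thesis using X by (simp add: sn_a_def)
  qed
  then have "1 + sn_a i X * ((q - inverse q) - sn_a i X) = 0" using q0 by (auto simp: algebra_simps)
  then show ?thesis using False by (simp add: sn_b_def)
qed

end

lemma sn_quad: 
  assumes i: "1 \<le> i" "i < n"
  shows "sn_s i * sn_s i = lscale (q - inverse q) * sn_s i + 1"
proof (rule lop_eqI)
  fix f X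
  let ?p = "q - inverse q" and ?a = "sn_a i X" and ?b = "sn_b i X" and ?X = "swap_tableau i X"
  show "lapp (sn_s i * sn_s i) f X = lapp (lscale ?p * sn_s i + 1) f X"
  proof (cases "X \<in> standard_tableaux m n")
    case True
    have "lapp (sn_s i * sn_s i) f X = ?a * (?a * f X + ?b * f ?X) + (?b * sn_a i ?X * f ?X + ?b * sn_b i ?X * f X)"
      by (simp add: lapp_simps lapp_sn_s algebra_simps)
    also have "\<dots> = ?p * (?a * f X + ?b * f ?X) + f X"
      unfolding sn_a_swap[OF True i] sn_b_swap[OF True i] by (simp add: algebra_simps)
    finally show ?thesis by (simp add: lapp_simps lapp_sn_s lapp_scale)
  next
    case False
    have "q * (q * f X) = (q - inverse q) * (q * f X) + f X" using q0 by (simp add: algebra_simps)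
    then show ?thesis using False by (simp add: lapp_simps lapp_sn_s lapp_scale sn_a_def sn_b_def)
  qed
qed

lemma swap_commute: "i + 1 < j \<Longrightarrow> swap_tableau i (swap_tableau j X) = swap_tableau j (swap_tableau i X)"
  by (auto simp: swap_tableau_def transpose_def fun_eq_iff)

lemma swap_braid: "swap_tableau i (swap_tableau (i + 1) (swap_tableau i X)) =
    swap_tableau (i + 1) (swap_tableau i (swap_tableau (i + 1) X))"
  by (auto simp: swap_tableau_def transpose_def fun_eq_iff)

lemma sn_far:
  assumes i: "1 \<le> i" "i + 1 < j" "j < n"
  shows "sn_s i * sn_s j = sn_s j * sn_s i"
proof (rule lop_eqI)
  fix f X
  let ?I = "swap_tableau i X" and ?J = "swap_tableau j X" and ?S = "standard_tableaux m n"
  show "lapp (sn_s i * sn_s j) f X = lapp (sn_s j * sn_s i) f X"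
  proof (cases "X \<in> ?S")
    case False
    then show ?thesis by (simp add: lapp_simps lapp_sn_s sn_a_def sn_b_def)
  next
    case X: True
    have in': "i < n" and j1: "1 \<le> j" using i by auto
    have nI: "cat ?I j = cat X j" "cat ?I (j + 1) = cat X (j + 1)"
      using cat_swap[OF X i(1) in', of j] cat_swap[OF X i(1) in', of "j + 1"] i by (auto simp: transpose_def)
    have nJ: "cat ?J i = cat X i" "cat ?J (i + 1) = cat X (i + 1)"
      using cat_swap[OF X j1 i(3), of i] cat_swap[OF X j1 i(3), of "i + 1"] i by (auto simp: transpose_def)
    have sI: "swap_tableau j ?I \<in> ?S \<longleftrightarrow> ?J \<in> ?S" if "?I \<in> ?S"
      unfolding swap_std_iff[OF that j1 i(3)] swap_std_iff[OF X j1 i(3)]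
      using node_of_swap[OF X i(1) in', of "j + 1"] pre_swap[OF i(1), of "j - 1" X] i by (simp add: transpose_def)
    have sJ: "swap_tableau i ?J \<in> ?S \<longleftrightarrow> ?I \<in> ?S" if "?J \<in> ?S"
      unfolding swap_std_iff[OF that i(1) in'] swap_std_iff[OF X i(1) in']
      using node_of_swap[OF X j1 i(3), of "i + 1"] pre_swap[OF j1, of "i - 1" X] i by (simp add: transpose_def)
    have 1: "sn_b i X * sn_a j ?I = sn_b i X * sn_a j X" "sn_b j X * sn_a i ?J = sn_b j X * sn_a i X"
      using X nI nJ by (auto simp: sn_b_def sn_a_def)
    have 2: "sn_b i X * sn_b j ?I = sn_b j X * sn_b i ?J"
      using X nI nJ sI sJ by (auto simp: sn_b_def)
    have "lapp (sn_s i * sn_s j) f X = sn_a i X * (sn_a j X * f X + sn_b j X * f ?J) +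
        (sn_b i X * sn_a j ?I * f ?I + sn_b i X * sn_b j ?I * f (swap_tableau j ?I))"
      by (simp add: lapp_simps lapp_sn_s algebra_simps)
    moreover have "lapp (sn_s j * sn_s i) f X = sn_a j X * (sn_a i X * f X + sn_b i X * f ?I) +
        (sn_b j X * sn_a i ?J * f ?J + sn_b j X * sn_b i ?J * f (swap_tableau i ?J))"
      by (simp add: lapp_simps lapp_sn_s algebra_simps)
    ultimately show ?thesis unfolding 1 2 swap_commute[OF i(2)] by (simp add: algebra_simps)
  qed
qed

lemma sn_t_s:
  assumes i: "1 < i" "i < n"
  shows "sn_t * sn_s i = sn_s i * sn_t"
proof (rule lop_eqI)
  fix f X
  have "sn_b i X * sn_d (swap_tableau i X) = sn_b i X * sn_d X"
    using cat_swap[of X n i 1] i by (auto simp: sn_b_def sn_d_def transpose_def)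
  then have "sn_b i X * (sn_d (swap_tableau i X) * f (swap_tableau i X)) = sn_b i X * (sn_d X * f (swap_tableau i X))"
    by (metis mult.assoc)
  then show "lapp (sn_t * sn_s i) f X = lapp (sn_s i * sn_t) f X"
    unfolding lapp_simps lapp_sn_s lapp_sn_t by (simp only: distrib_left mult.left_commute[of "sn_d X"])
qed

lemma sn_t_braid:
  assumes n: "1 < n"
  shows "sn_t * sn_s 1 * sn_t * sn_s 1 = sn_s 1 * sn_t * sn_s 1 * sn_t"
proof (rule lop_eqI)
  fix f X
  let ?X = "swap_tableau 1 X"
  show "lapp (sn_t * sn_s 1 * sn_t * sn_s 1) f X = lapp (sn_s 1 * sn_t * sn_s 1 * sn_t) f X"
  proof (cases "X \<in> standard_tableaux m n")
    case False
    then show ?thesis by (simp add: lapp_simps lapp_sn_s lapp_sn_t sn_a_def sn_b_def)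
  next
    case X: True
    define a b x y a' b' F G where d: "a = sn_a 1 X" "b = sn_b 1 X" "x = cat X 1" "y = cat X 2"
      "a' = sn_a 1 ?X" "b' = sn_b 1 ?X" "F = f X" "G = f ?X"
    have i: "1 \<le> (1::nat)" "1 < n" using n by auto
    have xy: "x \<noteq> y" using cat_next_ne[OF X order_refl i] unfolding d by (simp add: numeral_2_eq_2)
    have 1: "b * a' = b * ((q - inverse q) - a)" using sn_a_swap[OF X i] d by simp
    have "seminormal_diag y x = (q - inverse q) - a" using sd_sum[OF xy] X by (simp add: d sn_a_def numeral_2_eq_2)
    \<comment> \<open>Both sides of the relation between \<open>\<tau>\<close> and the first
      generator will differ by a multiple of this weighted trace.\<close>
    then have 2: "a * x + ((q - inverse q) - a) * y = 0" using sd_weighted[OF xy] X by (simp add: d sn_a_def numeral_2_eq_2)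
    have 3: "b * sn_d ?X = b * y" using cat_swap[OF X i, of 1] n X by (auto simp: d sn_b_def sn_d_def numeral_2_eq_2)
    have dX: "sn_d X = x" using X by (simp add: sn_d_def d)
    have L: "lapp (sn_t * sn_s 1 * sn_t * sn_s 1) f X = x * (a * x * (a * F + b * G) + (b * sn_d ?X) * (a' * G + b' * F))"
      by (simp add: lapp_simps lapp_sn_s lapp_sn_t dX d[symmetric] algebra_simps del: One_nat_def)
    have R: "lapp (sn_s 1 * sn_t * sn_s 1 * sn_t) f X = a * x * (a * x * F + (b * sn_d ?X) * G) + (b * sn_d ?X) * (a' * sn_d ?X * G + b' * x * F)"
      by (simp add: lapp_simps lapp_sn_s lapp_sn_t dX d[symmetric] algebra_simps del: One_nat_def)
    have R': "(b * sn_d ?X) * (a' * sn_d ?X * G + b' * x * F) = (b * a') * y * y * G + b * y * b' * x * F"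
    proof -
      have "(b * sn_d ?X) * (a' * sn_d ?X * G + b' * x * F) = (b * sn_d ?X) * sn_d ?X * a' * G + (b * sn_d ?X) * b' * x * F"
        by (simp add: algebra_simps)
      also have "(b * sn_d ?X) * sn_d ?X = b * y * y" using 3 by (metis mult.assoc mult.commute)
      finally show ?thesis unfolding 3 by (simp add: algebra_simps)
    qed
    have "lapp (sn_t * sn_s 1 * sn_t * sn_s 1) f X - lapp (sn_s 1 * sn_t * sn_s 1 * sn_t) f X =
        a * b * x * (x - y) * G + (b * a') * (x * y - y * y) * G"
      unfolding L R R' unfolding 3 by (simp add: algebra_simps)
    also have "\<dots> = b * (x - y) * G * (a * x + ((q - inverse q) - a) * y)" unfolding 1 by (simp add: algebra_simps)
    finally show ?thesis using 2 by simp
  qed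
qed

text \<open>The entry 1 sits in the first node of some diagram \<open>j\<close>, so
  \<open>\<tau>\<close> acts at a standard tableau by \<open>v j\<close>; elsewhere it acts by
  \<open>v 1\<close>.\<close>

lemma sn_cyc:
  assumes m: "1 \<le> m" and n: "1 \<le> n"
  shows "Lop.pev (\<Prod>j\<in>{1..m}. [:- v j, 1:]) sn_t = 0"
proof (rule lop_eqI)
  fix f X
  have "\<exists>j\<in>{1..m}. sn_d X = v j"
  proof (cases "X \<in> standard_tableaux m n")
    case False
    then show ?thesis using m by (auto simp: sn_d_def)
  next
    case True
    have a: "node_of X 1 \<in> addable m (pre X 0)" using node_of_addable[OF True, of 0] n by simp
    have D: "is_diag m {}" by (simp add: is_diag_def)
    obtain j r s where e: "node_of X 1 = (j, r, s)" by (cases "node_of X 1")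
    have val: "j \<in> {1..m}" "1 \<le> r" "1 \<le> s" using addable_valid[OF D] a e by auto
    have "nle (j, 1, 1) (j, r, s)" using val by (simp add: nle_def)
    then have "(j, r, s) = (j, 1, 1)" using addable_below[OF D] a e by fastforce
    then have "cat X 1 = v j" using e by (simp add: content_at_def Defs.content_def)
    then show ?thesis using val True by (auto simp: sn_d_def)
  qed
  then have "poly (\<Prod>j\<in>{1..m}. [:- v j, 1:]) (sn_d X) = 0" by (auto simp: poly_prod)
  then show "lapp (Lop.pev (\<Prod>j\<in>{1..m}. [:- v j, 1:]) sn_t) f X = lapp 0 f X"
    using lapp_diag_pev[of sn_t X "sn_d X"] by (simp add: lapp_sn_t lapp_simps)
qed

end

section \<open>The braid relation in the seminormal representation\<close>

context hecke_params
begin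

text \<open>Equality of the first and third content would be expected only at a diagonal neighbour.
  That node needs both the right and the lower neighbour of \<alpha>, but only one node is inserted
  in between. All other positions differ by a nontrivial power of \<open>q\<close> or are separated
  by earlier lemmas.\<close>

lemma ct_third_ne:
  assumes D: "is_diag m D" "card D + 2 < n" and a: "\<alpha> \<in> addable m D" and b: "\<beta> \<in> addable m (insert \<alpha> D)"
    and g: "\<gamma> \<in> addable m (insert \<beta> (insert \<alpha> D))"
  shows "ct \<gamma> \<noteq> ct \<alpha>"
proof -
  have D1: "is_diag m (insert \<alpha> D)" "card (insert \<alpha> D) + 1 < n"
    using addable_diag[OF a] card_insert_addable[OF D(1) a] D(2) by auto
  have q2: "q\<^sup>2 \<noteq> 1" using q_pow[of 1] D(2) by simp
  have q4: "q\<^sup>2 * q\<^sup>2 \<noteq> 1" using q_pow[of 2] D(2) by (simp add: power_add[symmetric])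
  have nz: "ct \<alpha> \<noteq> 0" "ct \<gamma> \<noteq> 0" using ct_nz[OF D(1) a] ct_nz[OF addable_diag[OF b] g] by auto
  have next_ne: "ct \<gamma> \<noteq> ct \<alpha>" if "\<gamma> \<in> addable m (insert \<alpha> D)" using ct_next_ne[OF D(1) _ a that] D(2) by simp
  have rd: "ct (rt \<beta>) = q\<^sup>2 * ct \<beta>" "q\<^sup>2 * ct (dn \<beta>) = ct \<beta>" "ct (rt \<alpha>) = q\<^sup>2 * ct \<alpha>" "q\<^sup>2 * ct (dn \<alpha>) = ct \<alpha>"
    using ct_rt ct_dn by auto
  have aD: "\<alpha> \<notin> D" using addable_notin[OF a] .
  obtain k r s where e: "\<alpha> = (k, r, s)" by (cases \<alpha>)
  have c: "1 \<le> k" "k \<le> m" "1 \<le> r" "1 \<le> s" using addable_valid[OF D(1)] a e by auto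
  have no: "\<gamma> \<noteq> (k, Suc r, Suc s)" if "\<beta> = rt \<alpha> \<or> \<beta> = dn \<alpha>"
  proof
    assume ge: "\<gamma> = (k, Suc r, Suc s)"
    have "rt \<alpha> \<in> insert \<beta> (insert \<alpha> D)" "dn \<alpha> \<in> insert \<beta> (insert \<alpha> D)"
      using addable_below[OF addable_diag[OF b] g, of "rt \<alpha>"] addable_below[OF addable_diag[OF b] g, of "dn \<alpha>"] c
      unfolding ge e rt_def dn_def by (auto simp: nle_def)
    moreover have "rt \<alpha> \<noteq> dn \<alpha>" "rt \<alpha> \<noteq> \<alpha>" "dn \<alpha> \<noteq> \<alpha>" by (auto simp: e rt_def dn_def)
    ultimately have "rt \<alpha> \<in> D \<or> dn \<alpha> \<in> D" using that by auto
    moreover have "nle \<alpha> (rt \<alpha>)" "nle \<alpha> (dn \<alpha>)" using c by (auto simp: e rt_def dn_def nle_def)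
    ultimately show False using is_diag_down[OF D(1)] aD by blast
  qed
  from addable_insert_cases[OF D1(1) b g] consider "\<gamma> \<in> addable m (insert \<alpha> D)" | "\<gamma> = rt \<beta>" | "\<gamma> = dn \<beta>" by blast
  then show ?thesis
  proof cases
    case 1 then show ?thesis by (rule next_ne)
  next
    case 2
    from addable_insert_cases[OF D(1) a b] consider "\<beta> \<in> addable m D" | "\<beta> = rt \<alpha>" | "\<beta> = dn \<alpha>" by blast
    then show ?thesis
    proof cases
      case 1
      have "\<beta> \<noteq> \<alpha>" using addable_notin[OF b] by auto
      then show ?thesis using ct_addables_not_q2[OF D(1) _ 1 a] D(2) rd(1) \<open>\<gamma> = rt \<beta>\<close> by simp
    next
      case 2
      then show ?thesis using rd q4 nz \<open>\<gamma> = rt \<beta>\<close> by (metis mult.assoc mult_cancel_right1)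
    next
      case 3
      then show ?thesis using no \<open>\<gamma> = rt \<beta>\<close> by (simp add: e rt_def dn_def)
    qed
  next
    case 3
    from addable_insert_cases[OF D(1) a b] consider "\<beta> \<in> addable m D" | "\<beta> = rt \<alpha>" | "\<beta> = dn \<alpha>" by blast
    then show ?thesis
    proof cases
      case 1
      then show ?thesis using ct_addables_not_q2[OF D(1) _ a 1] D(2) rd(2) \<open>\<gamma> = dn \<beta>\<close> by auto
    next
      case 2
      then show ?thesis using no \<open>\<gamma> = dn \<beta>\<close> by (simp add: e rt_def dn_def)
    next
      case 3
      then show ?thesis using rd q4 nz \<open>\<gamma> = dn \<beta>\<close> by (metis mult.assoc mult_cancel_right1)
    qed
  qed
qed

text \<open>The braid relation at one tableau, with \<open>F\<close>, \<open>F1\<close>,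
  \<open>F2\<close>, ... the values of the function at its exchanges. Hypotheses carry the
  off-diagonal coefficients as factors since they hold only where the exchange is standard. The two
  sides differ by a multiple of the relation \<open>R\<close>.\<close>

lemma braid_scalars:
  fixes a b c b1 b2 :: 'k
  assumes R: "a * b = c * (a + b - p)"
    and b1: "b1 * a1 = b1 * c" "b1 * a1' = b1 * (p - a)" "b1 * b1' = 1 + a * (p - a)"
    and b2: "b2 * a2 = b2 * c" "b2 * a2' = b2 * (p - b)" "b2 * b2' = 1 + b * (p - b)"
    and c1: "(b1 * d1) * a12 = (b1 * d1) * b" and c2: "(b2 * d2) * a21 = (b2 * d2) * a"
    and w: "(b1 * d1) * e1 = (b2 * d2) * e2"
  shows "a * (b * (a * F + b1 * F1) + b2 * (a2 * F2 + d2 * F21)) + b1 * (a1 * (a1' * F1 + b1' * F) + d1 * (a12 * F12 + e1 * G))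
       = b * (a * (b * F + b2 * F2) + b1 * (a1 * F1 + d1 * F12)) + b2 * (a2 * (a2' * F2 + b2' * F) + d2 * (a21 * F21 + e2 * G))"
    (is "?L = ?R")
proof -
  have "(b1 * a1) * a1' = (b1 * a1') * c" "(b2 * a2) * a2' = (b2 * a2') * c" unfolding b1(1) b2(1) by (simp_all add: algebra_simps)
  then have q1: "(b1 * a1) * a1' = b1 * (p - a) * c" "(b2 * a2) * a2' = b2 * (p - b) * c" unfolding b1 b2 by auto
  have "(b1 * a1) * b1' = (b1 * b1') * c" "(b2 * a2) * b2' = (b2 * b2') * c" unfolding b1(1) b2(1) by (simp_all add: algebra_simps)
  then have q2: "(b1 * a1) * b1' = (1 + a * (p - a)) * c" "(b2 * a2) * b2' = (1 + b * (p - b)) * c" unfolding b1 b2 by auto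
  have "?L = a * b * a * F + a * b * b1 * F1 + a * (b2 * a2) * F2 + a * (b2 * d2) * F21 + (b1 * a1) * a1' * F1
      + (b1 * a1) * b1' * F + (b1 * d1) * a12 * F12 + (b1 * d1) * e1 * G" by (simp add: algebra_simps)
  also have "\<dots> = a * b * a * F + a * b * b1 * F1 + a * (b2 * c) * F2 + a * (b2 * d2) * F21 + b1 * (p - a) * c * F1
      + (1 + a * (p - a)) * c * F + (b1 * d1) * b * F12 + (b2 * d2) * e2 * G"
    by (simp only: q1 q2 c1 w b2(1))
  finally have L: "?L = \<dots>" .
  have "?R = b * a * b * F + b * a * b2 * F2 + b * (b1 * a1) * F1 + b * (b1 * d1) * F12 + (b2 * a2) * a2' * F2
      + (b2 * a2) * b2' * F + (b2 * d2) * a21 * F21 + (b2 * d2) * e2 * G" by (simp add: algebra_simps)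
  also have "\<dots> = b * a * b * F + b * a * b2 * F2 + b * (b1 * c) * F1 + b * (b1 * d1) * F12 + b2 * (p - b) * c * F2
      + (1 + b * (p - b)) * c * F + (b2 * d2) * a * F21 + (b2 * d2) * e2 * G"
    by (simp only: q1 q2 c2 b1(1))
  finally have "?L - ?R = (a * b - c * (a + b - p)) * ((a - b) * F + b1 * F1 - b2 * F2)"
    unfolding L by (simp add: algebra_simps)
  then show ?thesis using R by simp
qed

lemma sn_braid:
  assumes i: "1 \<le> i" "i + 1 < n"
  shows "sn_s i * sn_s (i + 1) * sn_s i = sn_s (i + 1) * sn_s i * sn_s (i + 1)"
proof (rule lop_eqI)
  fix f X
  let ?S = "standard_tableaux m n" and ?i = "swap_tableau i" and ?j = "swap_tableau (i + 1)"
  show "lapp (sn_s i * sn_s (i + 1) * sn_s i) f X = lapp (sn_s (i + 1) * sn_s i * sn_s (i + 1)) f X"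
  proof (cases "X \<in> ?S")
    case False
    then show ?thesis by (simp add: lapp_simps lapp_sn_s sn_a_def sn_b_def)
  next
    case X: True
    have i1: "1 \<le> i" "i < n" and i2: "1 \<le> i + 1" "i + 1 < n" using i by auto
    define \<nu> where "\<nu> = pre X (i - 1)"
    define \<alpha> \<beta> \<gamma> where n: "\<alpha> = node_of X i" "\<beta> = node_of X (i + 1)" "\<gamma> = node_of X (i + 2)"
    note T1 = two_nodes[OF X i1, folded \<nu>_def] and T2 = two_nodes[OF X i2]
    have D: "is_diag m \<nu>" using T1(1) .
    have a: "\<alpha> \<in> addable m \<nu>" and b: "\<beta> \<in> addable m (insert \<alpha> \<nu>)" and ab: "\<alpha> \<noteq> \<beta>" using T1 n by auto
    have g: "\<gamma> \<in> addable m (insert \<beta> (insert \<alpha> \<nu>))" using T2(3,4) T1(5) n by (simp add: numeral_2_eq_2)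
    have bg: "\<beta> \<noteq> \<gamma>" "\<alpha> \<noteq> \<gamma>" using addable_notin[OF g] by auto
    have D1: "is_diag m (insert \<alpha> \<nu>)" using addable_diag[OF a] .
    have card: "card \<nu> + 2 < n" using card_pre[OF X, of "i - 1"] i unfolding \<nu>_def by simp
    define x y z where xyz: "x = cat X i" "y = cat X (i + 1)" "z = cat X (i + 2)"
    have xy: "x \<noteq> y" using cat_next_ne[OF X order_refl i1] xyz by simp
    have yz: "y \<noteq> z" using cat_next_ne[OF X order_refl i2] xyz by (simp add: numeral_2_eq_2)
    have xz: "x \<noteq> z" using ct_third_ne[OF D card a b g] xyz n by (simp add: content_at_def)
    let ?X1 = "?i X" and ?X2 = "?j X"
    let ?X12 = "?j ?X1" and ?X21 = "?i ?X2"
    have s1: "?X1 \<in> ?S \<longleftrightarrow> \<beta> \<in> addable m \<nu>" using swap_std_iff[OF X i1] n \<nu>_def by simp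
    have s2: "?X2 \<in> ?S \<longleftrightarrow> \<gamma> \<in> addable m (insert \<alpha> \<nu>)" using swap_std_iff[OF X i2] n T1(5) by (simp add: numeral_2_eq_2)
    have N1: "node_of ?X1 i = \<beta>" "node_of ?X1 (i + 1) = \<alpha>" "node_of ?X1 (i + 2) = \<gamma>"
      using node_of_swap[OF X i1, of i] node_of_swap[OF X i1, of "i + 1"] node_of_swap[OF X i1, of "i + 2"] i n
      by (auto simp: transpose_def)
    have N2: "node_of ?X2 i = \<alpha>" "node_of ?X2 (i + 1) = \<gamma>" "node_of ?X2 (i + 2) = \<beta>"
      using node_of_swap[OF X i2, of i] node_of_swap[OF X i2, of "i + 1"] node_of_swap[OF X i2, of "i + 2"] i n
      by (auto simp: transpose_def numeral_2_eq_2)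
    have P: "pre ?X1 (i - 1) = \<nu>" "pre ?X2 (i - 1) = \<nu>" using pre_swap[of i "i - 1" X] pre_swap[of "i + 1" "i - 1" X] i \<nu>_def by auto
    have s12: "?X12 \<in> ?S \<longleftrightarrow> \<gamma> \<in> addable m (insert \<beta> \<nu>)" if "?X1 \<in> ?S"
      using swap_std_iff[OF that i2] N1 P two_nodes(5)[OF that i1] by (simp add: numeral_2_eq_2)
    have s21: "?X21 \<in> ?S \<longleftrightarrow> \<gamma> \<in> addable m \<nu>" if "?X2 \<in> ?S"
      using swap_std_iff[OF that i1] N2 P by simp
    have N12: "node_of ?X12 i = \<beta>" "node_of ?X12 (i + 1) = \<gamma>" "node_of ?X12 (i + 2) = \<alpha>" if "?X1 \<in> ?S"
      using node_of_swap[OF that i2, of i] node_of_swap[OF that i2, of "i + 1"] node_of_swap[OF that i2, of "i + 2"] i N1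
      by (auto simp: transpose_def numeral_2_eq_2)
    have N21: "node_of ?X21 i = \<gamma>" "node_of ?X21 (i + 1) = \<alpha>" "node_of ?X21 (i + 2) = \<beta>" if "?X2 \<in> ?S"
      using node_of_swap[OF that i1, of i] node_of_swap[OF that i1, of "i + 1"] node_of_swap[OF that i1, of "i + 2"] i N2
      by (auto simp: transpose_def)
    have P12: "pre ?X12 (i - 1) = \<nu>" using pre_swap[of "i + 1" "i - 1" ?X1] i P by simp
    have P21: "pre ?X21 (i - 1) = \<nu>" using pre_swap[of i "i - 1" ?X2] i P by simp
    have s121: "?i ?X12 \<in> ?S \<longleftrightarrow> \<gamma> \<in> addable m \<nu>" if "?X1 \<in> ?S" "?X12 \<in> ?S"
      using swap_std_iff[OF that(2) i1] N12[OF that(1)] P12 by simp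
    have s212: "?j ?X21 \<in> ?S \<longleftrightarrow> \<beta> \<in> addable m (insert \<gamma> \<nu>)" if "?X2 \<in> ?S" "?X21 \<in> ?S"
      using swap_std_iff[OF that(2) i2] N21[OF that(1)] P21 two_nodes(5)[OF that(2) i1] by (simp add: numeral_2_eq_2)
    have C: "ct \<alpha> = x" "ct \<beta> = y" "ct \<gamma> = z" using xyz n by (auto simp: content_at_def)
    let ?p = "q - inverse q" and ?d = seminormal_diag
    have sd: "?d y x = ?p - ?d x y" "?d z y = ?p - ?d y z" using sd_sum[OF xy] sd_sum[OF yz] by auto
    have A: "sn_a i X = ?d x y" "sn_a (i + 1) X = ?d y z" using X xyz by (auto simp: sn_a_def numeral_2_eq_2)
    have A1: "sn_a i ?X1 = ?d y x" "sn_a (i + 1) ?X1 = ?d x z" if "?X1 \<in> ?S"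
      using that N1 C by (auto simp: sn_a_def content_at_def numeral_2_eq_2)
    have A2: "sn_a i ?X2 = ?d x z" "sn_a (i + 1) ?X2 = ?d z y" if "?X2 \<in> ?S"
      using that N2 C by (auto simp: sn_a_def content_at_def numeral_2_eq_2)
    have z1: "sn_b i X = 0" if "?X1 \<notin> ?S" using that by (simp add: sn_b_def)
    have z2: "sn_b (i + 1) X = 0" if "?X2 \<notin> ?S" using that by (simp add: sn_b_def)
    have z12: "sn_b (i + 1) ?X1 = 0" if "?X12 \<notin> ?S" using that by (simp add: sn_b_def)
    have z21: "sn_b i ?X2 = 0" if "?X21 \<notin> ?S" using that by (simp add: sn_b_def)
    have L: "lapp (sn_s i * sn_s (i + 1) * sn_s i) f X = sn_a i X * (sn_a (i + 1) X * (sn_a i X * f X + sn_b i X * f ?X1)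
        + sn_b (i + 1) X * (sn_a i ?X2 * f ?X2 + sn_b i ?X2 * f ?X21))
        + sn_b i X * (sn_a (i + 1) ?X1 * (sn_a i ?X1 * f ?X1 + sn_b i ?X1 * f X)
        + sn_b (i + 1) ?X1 * (sn_a i ?X12 * f ?X12 + sn_b i ?X12 * f (?i ?X12)))"
      by (simp add: lapp_simps lapp_sn_s)
    have R: "lapp (sn_s (i + 1) * sn_s i * sn_s (i + 1)) f X = sn_a (i + 1) X * (sn_a i X * (sn_a (i + 1) X * f X + sn_b (i + 1) X * f ?X2)
        + sn_b i X * (sn_a (i + 1) ?X1 * f ?X1 + sn_b (i + 1) ?X1 * f ?X12))
        + sn_b (i + 1) X * (sn_a i ?X2 * (sn_a (i + 1) ?X2 * f ?X2 + sn_b (i + 1) ?X2 * f X)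
        + sn_b i ?X2 * (sn_a (i + 1) ?X21 * f ?X21 + sn_b (i + 1) ?X21 * f (?i ?X12)))"
      by (simp add: lapp_simps lapp_sn_s swap_braid[simplified])
    show ?thesis unfolding L R
    proof (rule braid_scalars[where c = "?d x z"])
      show "sn_a i X * sn_a (i + 1) X = ?d x z * (sn_a i X + sn_a (i + 1) X - ?p)"
        unfolding A by (rule sd_rel[OF xy yz xz])
      show "sn_b i X * sn_a (i + 1) ?X1 = sn_b i X * ?d x z" using A1(2) z1 by (cases "?X1 \<in> ?S") auto
      show "sn_b (i + 1) X * sn_a i ?X2 = sn_b (i + 1) X * ?d x z" using A2(1) z2 by (cases "?X2 \<in> ?S") auto
      show "sn_b i X * sn_a i ?X1 = sn_b i X * (?p - sn_a i X)" by (rule sn_a_swap[OF X i1])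
      show "sn_b (i + 1) X * sn_a (i + 1) ?X2 = sn_b (i + 1) X * (?p - sn_a (i + 1) X)" by (rule sn_a_swap[OF X i2])
      show "sn_b i X * sn_b i ?X1 = 1 + sn_a i X * (?p - sn_a i X)" by (rule sn_b_swap[OF X i1])
      show "sn_b (i + 1) X * sn_b (i + 1) ?X2 = 1 + sn_a (i + 1) X * (?p - sn_a (i + 1) X)" by (rule sn_b_swap[OF X i2])
      show "sn_b i X * sn_b (i + 1) ?X1 * sn_a i ?X12 = sn_b i X * sn_b (i + 1) ?X1 * sn_a (i + 1) X"
        using z1 z12 N12 C A by (cases "?X1 \<in> ?S"; cases "?X12 \<in> ?S") (auto simp: sn_a_def content_at_def)
      show "sn_b (i + 1) X * sn_b i ?X2 * sn_a (i + 1) ?X21 = sn_b (i + 1) X * sn_b i ?X2 * sn_a i X"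
        using z2 z21 N21 C A by (cases "?X2 \<in> ?S"; cases "?X21 \<in> ?S") (auto simp: sn_a_def content_at_def numeral_2_eq_2)
      \<comment> \<open>Either path of three exchanges reverses the order of \<alpha>, \<beta>,
        \<gamma>, and stays among standard tableaux under the same condition, that \<beta> and
        \<gamma> are both addable to the diagram below \<open>i\<close>.\<close>
      have all: "(?X1 \<in> ?S \<and> ?X12 \<in> ?S \<and> ?i ?X12 \<in> ?S) \<longleftrightarrow> \<beta> \<in> addable m \<nu> \<and> \<gamma> \<in> addable m \<nu>"
        using s1 s12 s121 addable_commute[OF D, of \<beta> \<gamma>] bg by blast
      \<comment> \<open>Every node strictly below \<beta> lies in both
        \<open>insert \<alpha> \<nu>\<close> and \<open>insert \<gamma> \<nu>\<close>, hence in
        \<nu>, as \<alpha> and \<gamma> differ.\<close>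
      have common: "\<beta> \<in> addable m \<nu>" if "\<gamma> \<in> addable m \<nu>" "\<beta> \<in> addable m (insert \<gamma> \<nu>)"
        using b that addable_iff[OF D1, of \<beta>] addable_iff[OF addable_diag[OF that(1)], of \<beta>] addable_iff[OF D, of \<beta>] bg by blast
      have all': "(?X2 \<in> ?S \<and> ?X21 \<in> ?S \<and> ?j ?X21 \<in> ?S) \<longleftrightarrow> \<beta> \<in> addable m \<nu> \<and> \<gamma> \<in> addable m \<nu>"
        using s2 s21 s212 common addable_commute[OF D, of \<alpha> \<gamma>] addable_commute[OF D, of \<gamma> \<beta>] a bg by blast
      show "sn_b i X * sn_b (i + 1) ?X1 * sn_b i ?X12 = sn_b (i + 1) X * sn_b i ?X2 * sn_b (i + 1) ?X21"
      proof (cases "\<beta> \<in> addable m \<nu> \<and> \<gamma> \<in> addable m \<nu>")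
        case True
        then have st: "?X1 \<in> ?S" "?X12 \<in> ?S" "?i ?X12 \<in> ?S" "?X2 \<in> ?S" "?X21 \<in> ?S" "?j ?X21 \<in> ?S" using all all' by auto
        have "sn_b i X = q - ?d x y" "sn_b (i + 1) ?X1 = q - ?d x z" "sn_b i ?X12 = q - ?d y z"
          "sn_b (i + 1) X = q - ?d y z" "sn_b i ?X2 = q - ?d x z" "sn_b (i + 1) ?X21 = q - ?d x y"
          using X st N1 N2 N12[OF st(1)] N21[OF st(4)] n C xyz by (simp_all add: sn_b_def content_at_def numeral_2_eq_2)
        then show ?thesis by (simp add: ac_simps)
      next
        case False
        then have "\<not> (?X1 \<in> ?S \<and> ?X12 \<in> ?S \<and> ?i ?X12 \<in> ?S)" "\<not> (?X2 \<in> ?S \<and> ?X21 \<in> ?S \<and> ?j ?X21 \<in> ?S)" using all all' by auto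
        then have z: "sn_b i X * sn_b (i + 1) ?X1 * sn_b i ?X12 = 0" "sn_b (i + 1) X * sn_b i ?X2 * sn_b (i + 1) ?X21 = 0"
          by (auto simp: sn_b_def)
        show ?thesis by (simp only: z)
      qed
    qed
  qed
qed

lemma sn_hecke_alg:
  assumes "1 \<le> m" "1 \<le> n"
  shows "hecke_alg lscale m n q v sn_t sn_s"
  by unfold_locales (use sn_braid sn_far sn_t_braid sn_t_s sn_quad sn_cyc[OF assms] in auto)

end

section \<open>The complete system of idempotents\<close>

locale hecke_main = hecke_params m n q v for m n :: nat and q :: "'k::field" and v :: "nat \<Rightarrow> 'k" +
  assumes m1: "1 \<le> m" and n1: "1 \<le> n"
begin

sublocale L: hecke_alg lscale m n q v sn_t sn_s
  by (rule sn_hecke_alg[OF m1 n1])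

sublocale U: hecke_alg "\<lambda>c. diag_quot (fconst c)" m n q v "uni (fgen Tau)" "\<lambda>i. uni (fgen (hgen.Sigma i))"
  by (rule uni_hecke_alg[OF m1])

sublocale UL: hecke_level "\<lambda>c. diag_quot (fconst c)" m n q v "uni (fgen Tau)" "\<lambda>i. uni (fgen (hgen.Sigma i))" n
  by (rule U.level_at) simp

text \<open>In the induction step the off-diagonal terms cancel by the weighted trace identity for
  the diagonal coefficients.\<close>

lemma lapp_J: "1 \<le> k \<Longrightarrow> k \<le> n \<Longrightarrow> X \<in> standard_tableaux m n \<Longrightarrow> lapp (L.J k) f X = cat X k * f X"
proof (induction k arbitrary: X f rule: L.J.induct)
  case 2
  then show ?case by (simp add: lapp_sn_t sn_d_def)
next
  case (3 i)
  have i: "1 \<le> Suc i" "Suc i < n" using 3 by auto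
  note X = 3(4)
  let ?X = "swap_tableau (Suc i) X" and ?a = "sn_a (Suc i) X" and ?b = "sn_b (Suc i) X" and ?p = "q - inverse q"
  let ?x = "cat X (Suc i)" and ?y = "cat X (Suc (Suc i))"
  have ne: "?x \<noteq> ?y" using cat_next_ne[OF X order_refl i] by (metis Suc_eq_plus1)
  have J1: "lapp (L.J (Suc i)) g X = ?x * g X" for g using 3 by simp
  have J2: "?b * lapp (L.J (Suc i)) g ?X = ?b * (?y * g ?X)" for g
  proof (cases "?X \<in> standard_tableaux m n")
    case True
    then show ?thesis using "3.IH"[of ?X g] i cat_swap[OF X i, of "Suc i"] by simp
  qed (simp add: sn_b_def)
  have "seminormal_diag ?y ?x = ?p - ?a" using sd_sum[OF ne] X by (simp add: sn_a_def)
  then have w: "?a * ?x + (?p - ?a) * ?y = 0" using sd_weighted[OF ne] X by (simp add: sn_a_def)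
  have "lapp (L.J (Suc (Suc i))) f X = ?a * (?x * (?a * f X + ?b * f ?X)) +
      ?b * (?y * (sn_a (Suc i) ?X * f ?X + sn_b (Suc i) ?X * f X))"
    by (simp add: lapp_simps lapp_sn_s J1 J2)
  also have "\<dots> = ?a * ?a * ?x * f X + ?a * ?b * ?x * f ?X + (?b * sn_a (Suc i) ?X) * ?y * f ?X + (?b * sn_b (Suc i) ?X) * ?y * f X"
    by (simp add: algebra_simps)
  also have "\<dots> = ?y * f X + (?a * ?x + (?p - ?a) * ?y) * (?a * f X + ?b * f ?X)"
    unfolding sn_a_swap[OF X i] sn_b_swap[OF X i] by (simp add: algebra_simps)
  finally show ?case using w by simp
qed simp

text \<open>At the point \<open>X\<close> every Jucys-Murphy element acts by the corresponding
  content, where each Lagrange factor takes the value 1; this shows that the idempotent is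
  nonzero.\<close>

lemma lapp_E:
  assumes X: "X \<in> standard_tableaux m n"
  shows "k \<le> n \<Longrightarrow> Y \<in> standard_tableaux m k \<Longrightarrow> (\<And>i. i \<in> {1..k} \<Longrightarrow> node_of Y i = node_of X i) \<Longrightarrow>
    lapp (L.E k Y) f X = f X"
proof (induction k arbitrary: Y f)
  case 0
  then show ?case by (simp add: L.E.simps lapp_simps)
next
  case (Suc k)
  note Y = Suc.prems(2)
  let ?r = "Lag (shape (remove_entry (Suc k) Y)) (node_of Y (Suc k))"
  have nd: "node_of (remove_entry (Suc k) Y) i = node_of X i" if "i \<in> {1..k}" for i
    using node_of_remove[OF Y that] Suc.prems(3)[of i] that by simp
  have D: "is_diag m (pre Y k)" "card (pre Y k) < n" using pre_diag[OF Y] card_pre[OF Y, of k] Suc.prems(1) by auto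
  have a: "node_of Y (Suc k) \<in> addable m (pre Y k)" using node_of_addable[OF Y, of k] by simp
  have "lapp (L.E (Suc k) Y) f X = lapp (Lop.pev ?r (L.J (Suc k))) f X"
    unfolding L.E.simps lapp_simps using Suc.IH[OF _ std_remove(1)[OF Y] nd] Suc.prems(1) by simp
  also have "\<dots> = poly ?r (cat X (Suc k)) * f X"
    by (rule lapp_diag_pev) (use lapp_J[OF _ _ X, of "Suc k"] Suc.prems(1) in simp)
  also have "cat X (Suc k) = ct (node_of Y (Suc k))" using Suc.prems(3)[of "Suc k"] by (simp add: content_at_def)
  also have "poly ?r (ct (node_of Y (Suc k))) = 1" unfolding std_remove(2)[OF Y] using Lag_at[OF D a a] by simp
  finally show ?case by simp
qed

lemma E_elt_nonzero:
  assumes X: "X \<in> standard_tableaux m n"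
  shows "E_elt m n q v X \<noteq> \<zero>\<^bsub>hecke m n q v\<^esub>"
proof
  assume "E_elt m n q v X = \<zero>\<^bsub>hecke m n q v\<^esub>"
  then have "L.E n X = 0" using L.hmap_E[OF X] L.hmap_0 by simp
  then have "lapp 0 (\<lambda>_. 1 :: 'k) X = 1" using lapp_E[OF X order_refl X, of "\<lambda>_. 1"] by simp
  then show False by (simp add: lapp_simps)
qed

abbreviation "H \<equiv> hecke m n q v"
abbreviation "h \<equiv> U.hmap"
abbreviation "\<kappa> \<equiv> \<lambda>c. diag_quot (fconst c :: hgen fword \<Rightarrow>\<^sub>0 'k)"
abbreviation "stdn \<equiv> standard_tableaux m n"

lemma ev_uni: "U.ev P = uni P"
proof -
  have "hgen_val (uni (fgen Tau)) (\<lambda>i. uni (fgen (hgen.Sigma i))) = (\<lambda>g. uni (fgen g))"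
  proof
    fix g show "hgen_val (uni (fgen Tau)) (\<lambda>i. uni (fgen (hgen.Sigma i))) g = uni (fgen g)" by (cases g) auto
  qed
  then show ?thesis using uni_fev[of P] by simp
qed

text \<open>Identities between elements of the quotient can henceforth be verified in the ring
  type.\<close>

lemma h_inj: "inj_on h (carrier H)"
proof (rule inj_onI)
  interpret R: ring H by (rule hecke_ring)
  fix x y assume x: "x \<in> carrier H" and y: "y \<in> carrier H" and e: "h x = h y"
  then have z: "x \<ominus>\<^bsub>H\<^esub> y \<in> carrier H" "h (x \<ominus>\<^bsub>H\<^esub> y) = 0" by (auto simp: U.hmap_simps)
  then obtain P where P: "P \<in> carrier (free_algebra (hecke_gens n))" "x \<ominus>\<^bsub>H\<^esub> y = hecke_class m n q v P"
    unfolding hecke_carrier by blast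
  have "P \<in> hecke_ideal m n q v" using uni_eq_0[OF P(1)] z(2) by (simp add: P U.hmap_class ev_uni)
  then have "hecke_class m n q v P = hecke_ideal m n q v" unfolding hecke_class_def
    using P(1) by (intro abelian_subgroup.a_rcos_const[OF abelian_subgroupI3[OF ideal.axioms(1)[OF hecke_is_ideal] ring.is_abelian_group[OF free_algebra_ring]]])
  then have "x \<ominus>\<^bsub>H\<^esub> y = \<zero>\<^bsub>H\<^esub>" unfolding P(2) by (simp add: hecke_def FactRing_def)
  moreover have "x = (x \<ominus>\<^bsub>H\<^esub> y) \<oplus>\<^bsub>H\<^esub> y" using x y by (simp add: R.minus_eq R.a_assoc R.l_neg)
  ultimately show "x = y" using y by simp
qed

lemmas h_eqI = inj_onD[OF h_inj]

lemma h_finsum: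
  assumes "finite A" "\<And>a. a \<in> A \<Longrightarrow> f a \<in> carrier H"
  shows "finsum H f A \<in> carrier H \<and> h (finsum H f A) = (\<Sum>a\<in>A. h (f a))"
proof -
  interpret R: ring H by (rule hecke_ring)
  show ?thesis using assms
    by (induction A rule: finite_induct) (auto simp: U.hmap_0 U.hmap_simps R.finsum_insert Pi_def)
qed

text \<open>In an orthogonal decomposition the summand \<open>f\<close> equals its own compression
  to the corner ring, hence is a scalar multiple of the idempotent; idempotency leaves the scalars 0
  and 1.\<close>

lemma E_elt_primitive:
  assumes X: "X \<in> stdn"
  shows "primitive_idempotent H (E_elt m n q v X)"
  unfolding primitive_idempotent_def
proof (intro conjI allI impI)
  interpret R: ring H by (rule hecke_ring)
  let ?e = "E_elt m n q v X" and ?E = "U.E n X"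
  have ec: "?e \<in> carrier H" by (rule U.E_elt_carrier[OF X])
  have he: "h ?e = ?E" by (rule U.hmap_E[OF X])
  have idem: "?E * ?E = ?E" by (rule UL.E_idem[OF X])
  show "idempotent_in H ?e" unfolding idempotent_in_def
    using ec h_eqI[OF _ R.m_closed[OF ec ec] ec] he idem by (simp add: U.hmap_simps(2)[OF ec ec])
  show nz: "?e \<noteq> \<zero>\<^bsub>H\<^esub>" by (rule E_elt_nonzero[OF X])
  then have Enz: "?E \<noteq> 0" using h_eqI[of ?e "\<zero>\<^bsub>H\<^esub>"] ec he U.hmap_0 by auto
  fix f g assume f: "idempotent_in H f" and g: "idempotent_in H g" and fg: "f \<otimes>\<^bsub>H\<^esub> g = \<zero>\<^bsub>H\<^esub>" "g \<otimes>\<^bsub>H\<^esub> f = \<zero>\<^bsub>H\<^esub>"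
    and e: "?e = f \<oplus>\<^bsub>H\<^esub> g"
  have fc: "f \<in> carrier H" and gc: "g \<in> carrier H" using f g by (auto simp: idempotent_in_def)
  have ff: "h f * h f = h f" using f fc U.hmap_simps(2)[OF fc fc] by (simp add: idempotent_in_def)
  have hfg: "h f * h g = 0" "h g * h f = 0" using U.hmap_simps(2)[OF fc gc] U.hmap_simps(2)[OF gc fc] fg U.hmap_0 by auto
  have hE: "?E = h f + h g" using he e U.hmap_simps(1)[OF fc gc] by simp
  have "?E * h f * ?E = h f" unfolding hE by (simp add: distrib_left distrib_right ff hfg mult.assoc)
  moreover obtain c where "?E * h f * ?E = \<kappa> c * ?E"
    using U.corner(2)[OF order_refl X U.hmap_Alg[OF fc n1]] by blast
  ultimately have c: "h f = \<kappa> c * ?E" by simp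
  have "(\<kappa> c * ?E) * (\<kappa> c * ?E) = \<kappa> (c * c) * ?E"
    by (simp only: mult.assoc Uni.\<kappa>_left[of ?E] Uni.\<kappa>_mult idem)
  then have "\<kappa> (c * c) * ?E = \<kappa> c * ?E" using ff unfolding c by simp
  then have "c * c = c" using UL.eq_of_scaled Enz by blast
  then have "c = 0 \<or> c = 1" by (metis mult_cancel_left1)
  then show "f = \<zero>\<^bsub>H\<^esub> \<or> g = \<zero>\<^bsub>H\<^esub>"
  proof
    assume "c = 0"
    then have "h f = h \<zero>\<^bsub>H\<^esub>" using c U.hmap_0 Uni.\<kappa>_0 by simp
    then show ?thesis using h_eqI fc R.zero_closed by blast
  next
    assume "c = 1"
    then have "h f = ?E" using c Uni.\<kappa>_1 by simp
    then have "h g = h \<zero>\<^bsub>H\<^esub>" using hE U.hmap_0 by simp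
    then show ?thesis using h_eqI gc R.zero_closed by blast
  qed
qed

theorem complete_system: "complete_orthogonal_primitive_idempotents H stdn (E_elt m n q v)"
  unfolding complete_orthogonal_primitive_idempotents_def
proof (intro conjI ballI impI)
  interpret R: ring H by (rule hecke_ring)
  show "finite stdn" by (rule finite_std)
  show "primitive_idempotent H (E_elt m n q v X)" if "X \<in> stdn" for X using E_elt_primitive[OF that] .
  show "E_elt m n q v X \<otimes>\<^bsub>H\<^esub> E_elt m n q v Y = \<zero>\<^bsub>H\<^esub>" if "X \<in> stdn" "Y \<in> stdn" "X \<noteq> Y" for X Y
    using that by (intro h_eqI) (auto simp: U.E_elt_carrier U.hmap_simps U.hmap_E UL.E_orth U.hmap_0)
  have "finsum H (E_elt m n q v) stdn \<in> carrier H \<and> h (finsum H (E_elt m n q v) stdn) = (\<Sum>X\<in>stdn. h (E_elt m n q v X))"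
    by (rule h_finsum[OF finite_std U.E_elt_carrier])
  moreover have "(\<Sum>X\<in>stdn. h (E_elt m n q v X)) = 1" using UL.E_sum by (simp add: U.hmap_E)
  ultimately show "finsum H (E_elt m n q v) stdn = \<one>\<^bsub>H\<^esub>" by (intro h_eqI) (auto simp: U.hmap_1)
qed

end

section \<open>The homomorphism from the tensor algebra\<close>

locale frakT = hecke_main m n q v for m n :: nat and q :: "'k::field" and v :: "nat \<Rightarrow> 'k" +
  fixes T :: "(mtableau fword \<Rightarrow> (hgen fword \<Rightarrow>\<^sub>0 'k) set) ring"
  assumes T: "is_frakT m n q v T"
begin

abbreviation "tn \<equiv> tens m n q v"
abbreviation "sm \<equiv> tensor_smult m n q v"
abbreviation "KX \<equiv> (free_algebra stdn :: (mtableau fword \<Rightarrow>\<^sub>0 'k) ring)"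

lemma T_ring: "ring T"
  and T_carrier: "carrier T = tensor_space m n q v"
  and T_add: "\<And>f g. f \<in> carrier T \<Longrightarrow> g \<in> carrier T \<Longrightarrow> f \<oplus>\<^bsub>T\<^esub> g = (\<lambda>w. f w \<oplus>\<^bsub>H\<^esub> g w)"
  and T_smult: "\<And>c f g. f \<in> carrier T \<Longrightarrow> g \<in> carrier T \<Longrightarrow> sm c f \<otimes>\<^bsub>T\<^esub> g = sm c (f \<otimes>\<^bsub>T\<^esub> g)"
  and T_homX: "(\<lambda>x. tn x \<one>\<^bsub>H\<^esub>) \<in> ring_hom KX T"
  and T_homH: "(\<lambda>\<phi>. tn 1 \<phi>) \<in> ring_hom H T"
  and T_tens: "\<And>x \<phi>. x \<in> carrier KX \<Longrightarrow> \<phi> \<in> carrier H \<Longrightarrow> tn x \<one>\<^bsub>H\<^esub> \<otimes>\<^bsub>T\<^esub> tn 1 \<phi> = tn x \<phi>"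
  and T_sigma: "\<And>X i. X \<in> stdn \<Longrightarrow> i \<in> {1..<n} \<Longrightarrow>
     tn 1 (hsigma m n q v i \<oplus>\<^bsub>H\<^esub> hconst m n q v ((q - inverse q) * cat X (i + 1) / (cat X i - cat X (i + 1)))) \<otimes>\<^bsub>T\<^esub> tn (fgen X) \<one>\<^bsub>H\<^esub> =
     tn (swapped_gen m n i X) \<one>\<^bsub>H\<^esub> \<otimes>\<^bsub>T\<^esub> tn 1 (hsigma m n q v i \<oplus>\<^bsub>H\<^esub> hconst m n q v ((q - inverse q) * cat X i / (cat X (i + 1) - cat X i)))"
  and T_tau: "\<And>X. X \<in> stdn \<Longrightarrow> tn 1 (htau m n q v \<ominus>\<^bsub>H\<^esub> hconst m n q v (cat X 1)) \<otimes>\<^bsub>T\<^esub> tn (fgen X) \<one>\<^bsub>H\<^esub> = \<zero>\<^bsub>T\<^esub>"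
  using T unfolding is_frakT_def Let_def by blast+

lemma tn_carrier:
  assumes "x \<in> carrier KX" "\<phi> \<in> carrier H"
  shows "tn x \<phi> \<in> carrier T" "tn x \<one>\<^bsub>H\<^esub> \<in> carrier T" "tn 1 \<phi> \<in> carrier T"
proof -
  interpret R: ring T by (rule T_ring)
  show 1: "tn x \<one>\<^bsub>H\<^esub> \<in> carrier T" using ring_hom_closed[OF T_homX assms(1)] .
  show 2: "tn 1 \<phi> \<in> carrier T" using ring_hom_closed[OF T_homH assms(2)] .
  show "tn x \<phi> \<in> carrier T" using R.m_closed[OF 1 2] T_tens[OF assms] by simp
qed

text \<open>The map is determined on the tensor space by
  \<open>x \<otimes> \<phi> \<mapsto> eps x * h \<phi>\<close> and is well defined as a linear map;
  the content of the theorem is its multiplicativity. Values are taken in the ring type and pulled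
  back along \<open>h\<close> at the end.\<close>

definition rho :: "(mtableau fword \<Rightarrow> (hgen fword \<Rightarrow>\<^sub>0 'k) set) \<Rightarrow> (hgen fword \<Rightarrow>\<^sub>0 'k) quots" where
  "rho f = (\<Sum>w\<in>{w. f w \<noteq> \<zero>\<^bsub>H\<^esub>}. prod_list (map (U.E n) (letters w)) * h (f w))"

abbreviation "eps \<equiv> Uni.fev (U.E n)"

lemma T_mem:
  assumes "f \<in> carrier T"
  shows "f w \<in> carrier H" "finite {w. f w \<noteq> \<zero>\<^bsub>H\<^esub>}" "f w \<noteq> \<zero>\<^bsub>H\<^esub> \<Longrightarrow> set (letters w) \<subseteq> stdn"
  using assms unfolding T_carrier tensor_space_def by auto

lemma rho_superset:
  assumes "finite S" "{w. f w \<noteq> \<zero>\<^bsub>H\<^esub>} \<subseteq> S"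
  shows "rho f = (\<Sum>w\<in>S. prod_list (map (U.E n) (letters w)) * h (f w))"
  unfolding rho_def using assms by (intro sum.mono_neutral_left) (auto simp: U.hmap_0)

lemma rho_add:
  assumes f: "f \<in> carrier T" and g: "g \<in> carrier T"
  shows "rho (f \<oplus>\<^bsub>T\<^esub> g) = rho f + rho g"
proof -
  interpret RH: ring H by (rule hecke_ring)
  let ?S = "{w. f w \<noteq> \<zero>\<^bsub>H\<^esub>} \<union> {w. g w \<noteq> \<zero>\<^bsub>H\<^esub>}"
  have fin: "finite ?S" using T_mem(2)[OF f] T_mem(2)[OF g] by simp
  have "rho (f \<oplus>\<^bsub>T\<^esub> g) = (\<Sum>w\<in>?S. prod_list (map (U.E n) (letters w)) * h (f w \<oplus>\<^bsub>H\<^esub> g w))"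
    unfolding T_add[OF f g] by (rule rho_superset[OF fin]) auto
  also have "\<dots> = (\<Sum>w\<in>?S. prod_list (map (U.E n) (letters w)) * h (f w)) + (\<Sum>w\<in>?S. prod_list (map (U.E n) (letters w)) * h (g w))"
    using T_mem(1)[OF f] T_mem(1)[OF g] by (simp add: U.hmap_simps distrib_left sum.distrib)
  also have "\<dots> = rho f + rho g" using rho_superset[OF fin, of f] rho_superset[OF fin, of g] by simp
  finally show ?thesis .
qed

lemma rho_tens:
  assumes x: "x \<in> carrier KX" and p: "\<phi> \<in> carrier H"
  shows "rho (tn x \<phi>) = eps x * h \<phi>"
proof -
  interpret RH: ring H by (rule hecke_ring)
  have h: "h (tn x \<phi> w) = \<kappa> (Poly_Mapping.lookup x w) * h \<phi>" for w
    unfolding tens_def using p by (simp add: U.hmap_simps hconst_carrier U.hmap_const)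
  have "rho (tn x \<phi>) = (\<Sum>w\<in>Poly_Mapping.keys x. prod_list (map (U.E n) (letters w)) * h (tn x \<phi> w))"
  proof (rule rho_superset)
    show "{w. tn x \<phi> w \<noteq> \<zero>\<^bsub>H\<^esub>} \<subseteq> Poly_Mapping.keys x"
    proof
      fix w assume w: "w \<in> {w. tn x \<phi> w \<noteq> \<zero>\<^bsub>H\<^esub>}"
      have "hconst m n q v 0 = \<zero>\<^bsub>H\<^esub>" by (simp add: hconst_def fconst_def hecke_class_0)
      moreover have "Poly_Mapping.lookup x w = 0" if "w \<notin> Poly_Mapping.keys x" using that by (simp add: in_keys_iff)
      ultimately have "tn x \<phi> w = \<zero>\<^bsub>H\<^esub>" if "w \<notin> Poly_Mapping.keys x"
        using that RH.l_null[OF p] unfolding tens_def by metis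
      then show "w \<in> Poly_Mapping.keys x" using w by blast
    qed
  qed simp
  also have "\<dots> = (\<Sum>w\<in>Poly_Mapping.keys x. (\<kappa> (Poly_Mapping.lookup x w) * prod_list (map (U.E n) (letters w))) * h \<phi>)"
    unfolding h by (intro sum.cong refl) (simp only: Uni.\<kappa>_left[of "prod_list _"] mult.assoc)
  finally show ?thesis unfolding Uni.fev_def sum_distrib_right .
qed

lemma KX_single: "set (letters w) \<subseteq> stdn \<Longrightarrow> Poly_Mapping.single w 1 \<in> carrier KX"
  by (simp add: free_algebra_mem)

lemma KX_gen: "X \<in> stdn \<Longrightarrow> fgen X \<in> carrier KX"
  by simp

text \<open>An element with finite support is a sum of its components, and the component at
  \<open>w\<close> is a tensor with the word \<open>w\<close>.\<close>

lemma T_induct [consumes 1, case_names zero add tens]: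
  assumes f: "f \<in> carrier T" and z: "P \<zero>\<^bsub>T\<^esub>"
    and a: "\<And>f g. f \<in> carrier T \<Longrightarrow> g \<in> carrier T \<Longrightarrow> P f \<Longrightarrow> P g \<Longrightarrow> P (f \<oplus>\<^bsub>T\<^esub> g)"
    and t: "\<And>w \<phi>. set (letters w) \<subseteq> stdn \<Longrightarrow> \<phi> \<in> carrier H \<Longrightarrow> P (tn (Poly_Mapping.single w 1) \<phi>)"
  shows "P f"
proof -
  interpret R: ring T by (rule T_ring)
  interpret RH: ring H by (rule hecke_ring)
  have c0: "hconst m n q v 0 = \<zero>\<^bsub>H\<^esub>" by (simp add: hconst_def fconst_def hecke_class_0)
  have c1: "hconst m n q v 1 = \<one>\<^bsub>H\<^esub>" by (simp add: hconst_def fconst_def hecke_class_1)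
  have ts: "tn (Poly_Mapping.single w 1) \<phi> = (\<lambda>u. if u = w then \<phi> else \<zero>\<^bsub>H\<^esub>)" if "\<phi> \<in> carrier H" for w \<phi>
    using that by (auto simp: tens_def lookup_single when_def c0 c1 fun_eq_iff)
  have z0: "\<zero>\<^bsub>T\<^esub> = (\<lambda>w. \<zero>\<^bsub>H\<^esub>)"
  proof -
    have "\<zero>\<^bsub>T\<^esub> = tn 1 \<zero>\<^bsub>H\<^esub>" using ring_hom_zero[OF T_homH hecke_ring T_ring] by simp
    then show ?thesis by (auto simp: tens_def hconst_carrier)
  qed
  have "finite S \<Longrightarrow> \<forall>f\<in>carrier T. {w. f w \<noteq> \<zero>\<^bsub>H\<^esub>} = S \<longrightarrow> P f" for S
  proof (induction S rule: finite_induct)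
    case empty
    show ?case
    proof (intro ballI impI)
      fix f assume "f \<in> carrier T" "{w. f w \<noteq> \<zero>\<^bsub>H\<^esub>} = {}"
      then have "f = \<zero>\<^bsub>T\<^esub>" unfolding z0 by auto
      then show "P f" using z by simp
    qed
  next
    case (insert w S)
    show ?case
    proof (intro ballI impI)
      fix f assume f: "f \<in> carrier T" and S: "{w. f w \<noteq> \<zero>\<^bsub>H\<^esub>} = insert w S"
      define g where "g = f(w := \<zero>\<^bsub>H\<^esub>)"
      have gS: "{w. g w \<noteq> \<zero>\<^bsub>H\<^esub>} = S" using S insert.hyps by (auto simp: g_def)
      have "\<And>u. g u \<in> carrier H" using T_mem(1)[OF f] by (simp add: g_def)
      moreover have "\<And>u. g u \<noteq> \<zero>\<^bsub>H\<^esub> \<Longrightarrow> set (letters u) \<subseteq> stdn" using T_mem(3)[OF f] by (auto simp: g_def split: if_splits)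
      ultimately have g: "g \<in> carrier T" using gS insert.hyps unfolding T_carrier tensor_space_def by simp
      have w: "set (letters w) \<subseteq> stdn" using T_mem(3)[OF f, of w] S by blast
      have fw: "f w \<in> carrier H" by (rule T_mem(1)[OF f])
      have tw: "tn (Poly_Mapping.single w 1) (f w) \<in> carrier T" by (rule tn_carrier(1)[OF KX_single[OF w] fw])
      have "f = tn (Poly_Mapping.single w 1) (f w) \<oplus>\<^bsub>T\<^esub> g"
        unfolding T_add[OF tw g] unfolding ts[OF fw] g_def using T_mem(1)[OF f] by (intro ext) simp
      then show "P f" using a[OF tw g t[OF w fw]] insert.IH g gS by metis
    qed
  qed
  then show ?thesis using f T_mem(2)[OF f] by blast
qed

lemma rho_zero: "rho \<zero>\<^bsub>T\<^esub> = 0"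
proof -
  interpret R: ring T by (rule T_ring)
  have "rho (\<zero>\<^bsub>T\<^esub> \<oplus>\<^bsub>T\<^esub> \<zero>\<^bsub>T\<^esub>) = rho \<zero>\<^bsub>T\<^esub> + rho \<zero>\<^bsub>T\<^esub>" by (rule rho_add) auto
  then show ?thesis by simp
qed

lemma KX_simps: "x \<in> carrier KX \<Longrightarrow> y \<in> carrier KX \<Longrightarrow> tn (x * y) \<one>\<^bsub>H\<^esub> = tn x \<one>\<^bsub>H\<^esub> \<otimes>\<^bsub>T\<^esub> tn y \<one>\<^bsub>H\<^esub>"
  using ring_hom_mult[OF T_homX, of x y] by (simp add: free_algebra_simps)

lemma T_one: "\<one>\<^bsub>T\<^esub> = tn 1 \<one>\<^bsub>H\<^esub>"
  using ring_hom_one[OF T_homH] by simp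

lemma rho_left_KX:
  assumes x: "x \<in> carrier KX" and g: "g \<in> carrier T"
  shows "rho (tn x \<one>\<^bsub>H\<^esub> \<otimes>\<^bsub>T\<^esub> g) = eps x * rho g"
proof -
  interpret R: ring T by (rule T_ring)
  interpret RH: ring H by (rule hecke_ring)
  have xc: "tn x \<one>\<^bsub>H\<^esub> \<in> carrier T" by (rule tn_carrier(2)[OF x RH.one_closed])
  show ?thesis using g
  proof (induction rule: T_induct)
    case zero
    then show ?case using xc by (simp add: rho_zero)
  next
    case (add f g)
    then show ?case using xc by (simp add: R.r_distr rho_add distrib_left)
  next
    case (tens w \<phi>)
    let ?w = "Poly_Mapping.single w 1 :: mtableau fword \<Rightarrow>\<^sub>0 'k"
    have w: "?w \<in> carrier KX" by (rule KX_single[OF tens(1)])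
    have xw: "x * ?w \<in> carrier KX" using x w by blast
    have "tn x \<one>\<^bsub>H\<^esub> \<otimes>\<^bsub>T\<^esub> tn ?w \<phi> = tn x \<one>\<^bsub>H\<^esub> \<otimes>\<^bsub>T\<^esub> (tn ?w \<one>\<^bsub>H\<^esub> \<otimes>\<^bsub>T\<^esub> tn 1 \<phi>)"
      unfolding T_tens[OF w tens(2)] ..
    also have "\<dots> = tn (x * ?w) \<one>\<^bsub>H\<^esub> \<otimes>\<^bsub>T\<^esub> tn 1 \<phi>"
      unfolding KX_simps[OF x w] using xc tn_carrier(2,3)[OF w tens(2)] by (simp add: R.m_assoc)
    also have "\<dots> = tn (x * ?w) \<phi>" by (rule T_tens[OF xw tens(2)])
    finally show ?case using rho_tens[OF xw tens(2)] rho_tens[OF w tens(2)] by (simp add: Uni.fev_mult mult.assoc)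
  qed
qed

text \<open>Multiplicativity when the left factor is \<phi>. The good elements are closed under sums
  and products and contain scalars, so only the generators have to be examined.\<close>

definition good :: "(hgen fword \<Rightarrow>\<^sub>0 'k) set \<Rightarrow> bool" where
  "good \<phi> \<longleftrightarrow> \<phi> \<in> carrier H \<and> (\<forall>g\<in>carrier T. rho (tn 1 \<phi> \<otimes>\<^bsub>T\<^esub> g) = h \<phi> * rho g)"

lemma one_KX: "1 \<in> carrier KX" by blast

lemma tn1: "\<phi> \<in> carrier H \<Longrightarrow> tn 1 \<phi> \<in> carrier T"
  using tn_carrier(3)[OF one_KX] .

lemma good_mult:
  assumes "good \<phi>" "good \<psi>"
  shows "good (\<phi> \<otimes>\<^bsub>H\<^esub> \<psi>)"
proof -
  interpret R: ring T by (rule T_ring)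
  interpret RH: ring H by (rule hecke_ring)
  have c: "\<phi> \<in> carrier H" "\<psi> \<in> carrier H" using assms by (auto simp: good_def)
  have "tn 1 (\<phi> \<otimes>\<^bsub>H\<^esub> \<psi>) = tn 1 \<phi> \<otimes>\<^bsub>T\<^esub> tn 1 \<psi>" using ring_hom_mult[OF T_homH c] .
  then show ?thesis using assms c tn1[OF c(1)] tn1[OF c(2)]
    by (simp add: good_def R.m_assoc U.hmap_simps mult.assoc)
qed

lemma good_add:
  assumes "good \<phi>" "good \<psi>"
  shows "good (\<phi> \<oplus>\<^bsub>H\<^esub> \<psi>)"
proof -
  interpret R: ring T by (rule T_ring)
  interpret RH: ring H by (rule hecke_ring)
  have c: "\<phi> \<in> carrier H" "\<psi> \<in> carrier H" using assms by (auto simp: good_def)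
  have "tn 1 (\<phi> \<oplus>\<^bsub>H\<^esub> \<psi>) = tn 1 \<phi> \<oplus>\<^bsub>T\<^esub> tn 1 \<psi>" using ring_hom_add[OF T_homH c] .
  then show ?thesis using assms c tn1[OF c(1)] tn1[OF c(2)]
    by (simp add: good_def R.l_distr U.hmap_simps rho_add distrib_right)
qed

lemma sm_zero: "f w = \<zero>\<^bsub>H\<^esub> \<Longrightarrow> sm c f w = \<zero>\<^bsub>H\<^esub>"
proof -
  interpret RH: ring H by (rule hecke_ring)
  show "f w = \<zero>\<^bsub>H\<^esub> \<Longrightarrow> sm c f w = \<zero>\<^bsub>H\<^esub>"
    unfolding tensor_smult_def using RH.r_null[OF hconst_carrier] by simp
qed

lemma sm_carrier: "f \<in> carrier T \<Longrightarrow> sm c f \<in> carrier T"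
proof -
  assume f: "f \<in> carrier T"
  interpret RH: ring H by (rule hecke_ring)
  have sub: "{w. sm c f w \<noteq> \<zero>\<^bsub>H\<^esub>} \<subseteq> {w. f w \<noteq> \<zero>\<^bsub>H\<^esub>}" using sm_zero by blast
  have "finite {w. sm c f w \<noteq> \<zero>\<^bsub>H\<^esub>}" by (rule finite_subset[OF sub T_mem(2)[OF f]])
  moreover have "sm c f w \<in> carrier H" for w
    unfolding tensor_smult_def by (rule RH.m_closed[OF hconst_carrier T_mem(1)[OF f]])
  moreover have "set (letters w) \<subseteq> stdn" if "sm c f w \<noteq> \<zero>\<^bsub>H\<^esub>" for w using T_mem(3)[OF f] sub that by blast
  ultimately show ?thesis unfolding T_carrier tensor_space_def by blast
qed

lemma rho_smult:
  assumes f: "f \<in> carrier T"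
  shows "rho (sm c f) = \<kappa> c * rho f"
proof -
  interpret RH: ring H by (rule hecke_ring)
  let ?S = "{w. f w \<noteq> \<zero>\<^bsub>H\<^esub>}"
  have "rho (sm c f) = (\<Sum>w\<in>?S. prod_list (map (U.E n) (letters w)) * h (sm c f w))"
    by (rule rho_superset[OF T_mem(2)[OF f]]) (use sm_zero in blast)
  also have "\<dots> = (\<Sum>w\<in>?S. \<kappa> c * (prod_list (map (U.E n) (letters w)) * h (f w)))"
    using T_mem(1)[OF f] by (intro sum.cong refl)
      (simp add: tensor_smult_def U.hmap_simps hconst_carrier U.hmap_const Uni.\<kappa>_left[of "prod_list _"])
  finally show ?thesis unfolding rho_def sum_distrib_left .
qed

lemma good_const: "good (hconst m n q v c)"
  unfolding good_def
proof (intro conjI ballI)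
  interpret R: ring T by (rule T_ring)
  interpret RH: ring H by (rule hecke_ring)
  show "hconst m n q v c \<in> carrier H" by (rule hconst_carrier)
  fix g assume g: "g \<in> carrier T"
  \<comment> \<open>Scalars are multiples of the unit of \<open>T\<close>, so bilinearity of the
    product suffices.\<close>
  have "tn 1 (hconst m n q v c) = sm c \<one>\<^bsub>T\<^esub>"
  proof
    fix w
    have l: "hconst m n q v a \<otimes>\<^bsub>H\<^esub> hconst m n q v b = hconst m n q v (a * b)" for a b
      unfolding hconst_def by (simp add: hecke_class_simps(2)[symmetric] Free.\<kappa>_mult)
    show "tn 1 (hconst m n q v c) w = sm c \<one>\<^bsub>T\<^esub> w"
      unfolding T_one tens_def tensor_smult_def by (simp add: hconst_carrier l mult.commute)
  qed
  then have "tn 1 (hconst m n q v c) \<otimes>\<^bsub>T\<^esub> g = sm c g" using T_smult[OF R.one_closed g, of c] g by simp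
  then show "rho (tn 1 (hconst m n q v c) \<otimes>\<^bsub>T\<^esub> g) = h (hconst m n q v c) * rho g"
    by (simp add: rho_smult[OF g] U.hmap_const)
qed

text \<open>The defining relations move \<phi> past the first letter of a word. The step may use the
  claim for the rest \<open>g\<close> of the word, since a generator \<open>\<sigma>\<^sub>i\<close>
  reappears in front of \<open>g\<close>.\<close>

lemma good_by_words:
  assumes p: "\<phi> \<in> carrier H"
    and step: "\<And>X g. X \<in> stdn \<Longrightarrow> g \<in> carrier T \<Longrightarrow> rho (tn 1 \<phi> \<otimes>\<^bsub>T\<^esub> g) = h \<phi> * rho g \<Longrightarrow>
      rho (tn 1 \<phi> \<otimes>\<^bsub>T\<^esub> (tn (fgen X) \<one>\<^bsub>H\<^esub> \<otimes>\<^bsub>T\<^esub> g)) = h \<phi> * (U.E n X * rho g)"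
  shows "good \<phi>"
  unfolding good_def
proof (intro conjI ballI)
  interpret R: ring T by (rule T_ring)
  interpret RH: ring H by (rule hecke_ring)
  show "\<phi> \<in> carrier H" by fact
  have pc: "tn 1 \<phi> \<in> carrier T" by (rule tn1[OF p])
  fix g assume "g \<in> carrier T"
  then show "rho (tn 1 \<phi> \<otimes>\<^bsub>T\<^esub> g) = h \<phi> * rho g"
  proof (induction rule: T_induct)
    case zero
    then show ?case using pc by (simp add: rho_zero)
  next
    case (add f g)
    then show ?case using pc by (simp add: R.r_distr rho_add distrib_left)
  next
    case (tens w \<psi>)
    have "set ws \<subseteq> stdn \<Longrightarrow> rho (tn 1 \<phi> \<otimes>\<^bsub>T\<^esub> tn (Poly_Mapping.single (FWord ws) 1) \<psi>) = h \<phi> * rho (tn (Poly_Mapping.single (FWord ws) 1) \<psi>)" for ws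
    proof (induction ws)
      case Nil
      have o: "Poly_Mapping.single (FWord []) 1 = (1 :: mtableau fword \<Rightarrow>\<^sub>0 'k)" by (simp add: zero_fword_def[symmetric])
      have "tn 1 \<phi> \<otimes>\<^bsub>T\<^esub> tn 1 \<psi> = tn 1 (\<phi> \<otimes>\<^bsub>H\<^esub> \<psi>)" using ring_hom_mult[OF T_homH p tens(2)] by simp
      then show ?case unfolding o using rho_tens[OF one_KX] p tens(2) by (simp add: U.hmap_simps)
    next
      case (Cons X ws)
      let ?w = "Poly_Mapping.single (FWord ws) 1 :: mtableau fword \<Rightarrow>\<^sub>0 'k"
      have X: "X \<in> stdn" and ws: "?w \<in> carrier KX" using Cons.prems KX_single[of "FWord ws"] by simp_all
      have e: "Poly_Mapping.single (FWord (X # ws)) 1 = fgen X * ?w"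
        by (simp add: fgen_def mult_single plus_fword_def)
      have gX: "fgen X \<in> carrier KX" using X by (rule KX_gen)
      have wc: "tn ?w \<psi> \<in> carrier T" by (rule tn_carrier(1)[OF ws tens(2)])
      have Xc: "tn (fgen X) \<one>\<^bsub>H\<^esub> \<in> carrier T" by (rule tn_carrier(2)[OF gX tens(2)])
      have "tn (fgen X * ?w) \<psi> = tn (fgen X * ?w) \<one>\<^bsub>H\<^esub> \<otimes>\<^bsub>T\<^esub> tn 1 \<psi>" by (rule T_tens[symmetric]) (use gX ws tens(2) in auto)
      also have "\<dots> = tn (fgen X) \<one>\<^bsub>H\<^esub> \<otimes>\<^bsub>T\<^esub> (tn ?w \<one>\<^bsub>H\<^esub> \<otimes>\<^bsub>T\<^esub> tn 1 \<psi>)"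
        unfolding KX_simps[OF gX ws] using Xc tn_carrier(2,3)[OF ws tens(2)] by (simp add: R.m_assoc)
      also have "\<dots> = tn (fgen X) \<one>\<^bsub>H\<^esub> \<otimes>\<^bsub>T\<^esub> tn ?w \<psi>" unfolding T_tens[OF ws tens(2)] ..
      finally have s: "tn (fgen X * ?w) \<psi> = tn (fgen X) \<one>\<^bsub>H\<^esub> \<otimes>\<^bsub>T\<^esub> tn ?w \<psi>" .
      have "rho (tn 1 \<phi> \<otimes>\<^bsub>T\<^esub> tn ?w \<psi>) = h \<phi> * rho (tn ?w \<psi>)" using Cons by simp
      from step[OF X wc this] show ?case unfolding e s using rho_left_KX[OF gX wc] by simp
    qed
    from this[of "letters w"] tens(1) show ?case by simp
  qed
qed

lemma good_tau: "good (htau m n q v)"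
proof (rule good_by_words[OF htau_carrier])
  interpret R: ring T by (rule T_ring)
  interpret RH: ring H by (rule hecke_ring)
  let ?t = "htau m n q v"
  fix X g assume X: "X \<in> stdn" and g: "g \<in> carrier T"
  let ?c = "hconst m n q v (cat X 1)" and ?X = "tn (fgen X) \<one>\<^bsub>H\<^esub>"
  have tc: "tn 1 ?t \<in> carrier T" and cc: "tn 1 ?c \<in> carrier T" by (auto intro: tn1 htau_carrier hconst_carrier)
  have Xc: "?X \<in> carrier T" by (rule tn_carrier(2)[OF KX_gen[OF X] RH.one_closed])
  have dc: "?t \<ominus>\<^bsub>H\<^esub> ?c \<in> carrier H" by (rule RH.minus_closed[OF htau_carrier hconst_carrier])
  have "(?t \<ominus>\<^bsub>H\<^esub> ?c) \<oplus>\<^bsub>H\<^esub> ?c = ?t" using htau_carrier[of m n q v] hconst_carrier[of m n q v "cat X 1"]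
    by (simp add: RH.minus_eq RH.a_assoc RH.l_neg)
  then have "tn 1 ?t = tn 1 (?t \<ominus>\<^bsub>H\<^esub> ?c) \<oplus>\<^bsub>T\<^esub> tn 1 ?c"
    using ring_hom_add[OF T_homH dc hconst_carrier[of m n q v "cat X 1"]] by simp
  then have "tn 1 ?t \<otimes>\<^bsub>T\<^esub> (?X \<otimes>\<^bsub>T\<^esub> g) = (tn 1 (?t \<ominus>\<^bsub>H\<^esub> ?c) \<otimes>\<^bsub>T\<^esub> ?X) \<otimes>\<^bsub>T\<^esub> g \<oplus>\<^bsub>T\<^esub> tn 1 ?c \<otimes>\<^bsub>T\<^esub> (?X \<otimes>\<^bsub>T\<^esub> g)"
    using tn1[OF dc] cc Xc g by (simp add: R.l_distr R.m_assoc)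
  also have "\<dots> = tn 1 ?c \<otimes>\<^bsub>T\<^esub> (?X \<otimes>\<^bsub>T\<^esub> g)" unfolding T_tau[OF X] using cc Xc g by simp
  finally have "rho (tn 1 ?t \<otimes>\<^bsub>T\<^esub> (?X \<otimes>\<^bsub>T\<^esub> g)) = \<kappa> (cat X 1) * (U.E n X * rho g)"
    using good_const[of "cat X 1"] Xc g rho_left_KX[OF KX_gen[OF X] g] by (simp add: good_def U.hmap_const)
  also have "\<dots> = uni (fgen Tau) * (U.E n X * rho g)"
    using UL.E_eigen[OF X, of 1] n1 by (simp add: mult.assoc[symmetric])
  finally show "rho (tn 1 ?t \<otimes>\<^bsub>T\<^esub> (?X \<otimes>\<^bsub>T\<^esub> g)) = h ?t * (U.E n X * rho g)" by (simp add: U.hmap_tau)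
qed

lemma swapped_KX: "X \<in> stdn \<Longrightarrow> swapped_gen m n i X \<in> carrier KX"
  by (auto simp: swapped_gen_def)

text \<open>The relation of \<open>T\<close> and \<open>intertwine\<close> have the same form,
  including the zero for nonstandard exchanges, so the two computations run in parallel.\<close>

lemma good_sigma:
  assumes i: "i \<in> {1..<n}"
  shows "good (hsigma m n q v i)"
proof (rule good_by_words[OF hsigma_carrier[OF i]])
  interpret R: ring T by (rule T_ring)
  interpret RH: ring H by (rule hecke_ring)
  let ?s = "hsigma m n q v i"
  have sc: "?s \<in> carrier H" by (rule hsigma_carrier[OF i])
  fix X g assume X: "X \<in> stdn" and g: "g \<in> carrier T" and IH: "rho (tn 1 ?s \<otimes>\<^bsub>T\<^esub> g) = h ?s * rho g"
  define b b' where b: "b = (q - inverse q) * cat X (i + 1) / (cat X i - cat X (i + 1))"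
    "b' = (q - inverse q) * cat X i / (cat X (i + 1) - cat X i)"
  let ?k = "hconst m n q v" and ?X = "tn (fgen X) \<one>\<^bsub>H\<^esub>" and ?sw = "swapped_gen m n i X"
  have Xc: "?X \<in> carrier T" by (rule tn_carrier(2)[OF KX_gen[OF X] RH.one_closed])
  have swc: "tn ?sw \<one>\<^bsub>H\<^esub> \<in> carrier T" by (rule tn_carrier(2)[OF swapped_KX[OF X] RH.one_closed])
  have kc: "tn 1 (?k c) \<in> carrier T" for c by (intro tn1 hconst_carrier)
  have sT: "tn 1 ?s \<in> carrier T" by (rule tn1[OF sc])
  have add: "tn 1 (?s \<oplus>\<^bsub>H\<^esub> ?k c) = tn 1 ?s \<oplus>\<^bsub>T\<^esub> tn 1 (?k c)" for c
    using ring_hom_add[OF T_homH sc hconst_carrier[of m n q v c]] .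
  have kg: "rho (tn 1 (?k c) \<otimes>\<^bsub>T\<^esub> f) = \<kappa> c * rho f" if "f \<in> carrier T" for c f
    using good_const[of c] that by (simp add: good_def U.hmap_const)
  have Xg: "?X \<otimes>\<^bsub>T\<^esub> g \<in> carrier T" using Xc g by simp
  have "(tn 1 ?s \<oplus>\<^bsub>T\<^esub> tn 1 (?k b)) \<otimes>\<^bsub>T\<^esub> (?X \<otimes>\<^bsub>T\<^esub> g) = ((tn 1 ?s \<oplus>\<^bsub>T\<^esub> tn 1 (?k b)) \<otimes>\<^bsub>T\<^esub> ?X) \<otimes>\<^bsub>T\<^esub> g"
    using sT kc Xc g by (simp add: R.m_assoc)
  also have "\<dots> = tn ?sw \<one>\<^bsub>H\<^esub> \<otimes>\<^bsub>T\<^esub> ((tn 1 ?s \<oplus>\<^bsub>T\<^esub> tn 1 (?k b')) \<otimes>\<^bsub>T\<^esub> g)"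
    using T_sigma[OF X i, folded b] sT kc swc g unfolding add by (simp add: R.m_assoc)
  finally have "rho ((tn 1 ?s \<oplus>\<^bsub>T\<^esub> tn 1 (?k b)) \<otimes>\<^bsub>T\<^esub> (?X \<otimes>\<^bsub>T\<^esub> g)) = eps ?sw * rho ((tn 1 ?s \<oplus>\<^bsub>T\<^esub> tn 1 (?k b')) \<otimes>\<^bsub>T\<^esub> g)"
    using rho_left_KX[OF swapped_KX[OF X]] sT kc g by simp
  moreover have "rho ((tn 1 ?s \<oplus>\<^bsub>T\<^esub> tn 1 (?k c)) \<otimes>\<^bsub>T\<^esub> f) = rho (tn 1 ?s \<otimes>\<^bsub>T\<^esub> f) + \<kappa> c * rho f" if "f \<in> carrier T" for c f
    using sT kc that by (simp add: R.l_distr rho_add kg)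
  ultimately have 1: "rho (tn 1 ?s \<otimes>\<^bsub>T\<^esub> (?X \<otimes>\<^bsub>T\<^esub> g)) + \<kappa> b * rho (?X \<otimes>\<^bsub>T\<^esub> g) = eps ?sw * (h ?s * rho g + \<kappa> b' * rho g)"
    using g Xg IH by simp
  have es: "eps ?sw = (if swap_tableau i X \<in> stdn then U.E n (swap_tableau i X) else 0)"
    by (simp add: swapped_gen_def Uni.fev_0)
  have hs: "h ?s = uni (fgen (hgen.Sigma i))" by (rule U.hmap_sigma[OF i])
  have "(h ?s + \<kappa> b) * U.E n X = eps ?sw * (h ?s + \<kappa> b')"
    using UL.intertwine[OF X, of i] i unfolding es hs b by simp
  then have "(h ?s + \<kappa> b) * U.E n X * rho g = eps ?sw * (h ?s + \<kappa> b') * rho g" by simp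
  then have 2: "h ?s * (U.E n X * rho g) + \<kappa> b * (U.E n X * rho g) = eps ?sw * (h ?s * rho g + \<kappa> b' * rho g)"
    by (simp only: distrib_right distrib_left mult.assoc)
  have eX: "rho (?X \<otimes>\<^bsub>T\<^esub> g) = U.E n X * rho g" using rho_left_KX[OF KX_gen[OF X] g] by simp
  have "rho (tn 1 ?s \<otimes>\<^bsub>T\<^esub> (?X \<otimes>\<^bsub>T\<^esub> g)) + \<kappa> b * (U.E n X * rho g) = h ?s * (U.E n X * rho g) + \<kappa> b * (U.E n X * rho g)"
    unfolding 2 using 1 unfolding eX .
  then show "rho (tn 1 ?s \<otimes>\<^bsub>T\<^esub> (?X \<otimes>\<^bsub>T\<^esub> g)) = h ?s * (U.E n X * rho g)" by (simp only: add_right_cancel)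
qed

lemma good_all:
  assumes "\<phi> \<in> carrier H"
  shows "good \<phi>"
proof -
  obtain P where P: "P \<in> carrier (free_algebra (hecke_gens n))" "\<phi> = hecke_class m n q v P"
    using assms unfolding hecke_carrier by blast
  let ?S = "{P \<in> carrier (free_algebra (hecke_gens n)). good (hecke_class m n q v P)}"
  have g: "fgen x \<in> ?S" if "x \<in> hecke_gens n" for x
    using that good_tau good_sigma unfolding htau_def hsigma_def by (auto simp: hecke_gens_def)
  have "Free.fev fgen P \<in> ?S"
  proof (rule Free.fev_closed[OF g _ _ _ P(1)])
    show "fconst c \<in> ?S" for c using good_const[of c] by (simp add: hconst_def)
  qed (auto simp: hecke_class_simps intro: good_add good_mult)
  then show ?thesis by (simp add: Free_fev_fgen P)
qed

lemma rho_mult: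
  assumes f: "f \<in> carrier T" and g: "g \<in> carrier T"
  shows "rho (f \<otimes>\<^bsub>T\<^esub> g) = rho f * rho g"
proof -
  interpret R: ring T by (rule T_ring)
  interpret RH: ring H by (rule hecke_ring)
  show ?thesis using f
  proof (induction rule: T_induct)
    case zero
    then show ?case using g by (simp add: rho_zero)
  next
    case (add e f)
    then show ?case using g by (simp add: R.l_distr rho_add distrib_right)
  next
    case (tens w \<phi>)
    let ?w = "Poly_Mapping.single w 1 :: mtableau fword \<Rightarrow>\<^sub>0 'k"
    have w: "?w \<in> carrier KX" by (rule KX_single[OF tens(1)])
    have c: "tn ?w \<one>\<^bsub>H\<^esub> \<in> carrier T" "tn 1 \<phi> \<in> carrier T" using tn_carrier(2,3)[OF w tens(2)] by auto
    have "tn ?w \<phi> \<otimes>\<^bsub>T\<^esub> g = tn ?w \<one>\<^bsub>H\<^esub> \<otimes>\<^bsub>T\<^esub> (tn 1 \<phi> \<otimes>\<^bsub>T\<^esub> g)"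
      unfolding T_tens[OF w tens(2), symmetric] using c g by (simp add: R.m_assoc)
    then have "rho (tn ?w \<phi> \<otimes>\<^bsub>T\<^esub> g) = eps ?w * (h \<phi> * rho g)"
      using rho_left_KX[OF w] c g good_all[OF tens(2)] by (simp add: good_def)
    then show ?case using rho_tens[OF w tens(2)] by (simp add: mult.assoc)
  qed
qed

text \<open>Needed to pull the values back along \<open>h\<close>, which is injective but not onto
  the ring type by construction.\<close>

lemma rho_image:
  assumes "f \<in> carrier T"
  shows "rho f \<in> h ` carrier H"
proof -
  interpret RH: ring H by (rule hecke_ring)
  have sum_in: "x + y \<in> h ` carrier H" if xy: "x \<in> h ` carrier H" "y \<in> h ` carrier H" for x y
  proof -
    obtain a b where "a \<in> carrier H" "x = h a" "b \<in> carrier H" "y = h b" using xy by blast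
    then show ?thesis by (intro image_eqI[of _ _ "a \<oplus>\<^bsub>H\<^esub> b"]) (simp_all add: U.hmap_simps)
  qed
  have mult: "x * y \<in> h ` carrier H" if xy: "x \<in> h ` carrier H" "y \<in> h ` carrier H" for x y
  proof -
    obtain a b where "a \<in> carrier H" "x = h a" "b \<in> carrier H" "y = h b" using xy by blast
    then show ?thesis by (intro image_eqI[of _ _ "a \<otimes>\<^bsub>H\<^esub> b"]) (simp_all add: U.hmap_simps)
  qed
  have one: "1 \<in> h ` carrier H" using imageI[OF RH.one_closed, of h] unfolding U.hmap_1 .
  have zero: "0 \<in> h ` carrier H" using imageI[OF RH.zero_closed, of h] unfolding U.hmap_0 .
  show ?thesis using assms
  proof (induction rule: T_induct)
    case zero
    show ?case unfolding rho_zero by (rule \<open>0 \<in> h ` carrier H\<close>)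
  next
    case (add f g)
    show ?case unfolding rho_add[OF add(1,2)] by (rule sum_in[OF add(3,4)])
  next
    case (tens w \<phi>)
    have e: "U.E n X \<in> h ` carrier H" if "X \<in> stdn" for X
      using imageI[OF U.E_elt_carrier[OF that], of h] unfolding U.hmap_E[OF that] .
    have "prod_list (map (U.E n) ws) \<in> h ` carrier H" if "set ws \<subseteq> stdn" for ws
      using that by (induction ws) (simp_all add: one mult e)
    then have "eps (Poly_Mapping.single w 1) * h \<phi> \<in> h ` carrier H"
      using tens by (intro mult imageI) (simp_all add: Uni.fev_single Uni.\<kappa>_1)
    then show ?case using rho_tens[OF KX_single[OF tens(1)] tens(2)] by simp
  qed
qed

theorem exists_hom:
  "\<exists>\<rho>. frakT_hom m n q v T \<rho> \<and> \<rho> (tn 1 (htau m n q v)) = htau m n q v \<and>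
     (\<forall>i\<in>{1..<n}. \<rho> (tn 1 (hsigma m n q v i)) = hsigma m n q v i) \<and>
     (\<forall>X\<in>stdn. \<rho> (tn (fgen X) \<one>\<^bsub>H\<^esub>) = E_elt m n q v X)"
proof -
  interpret R: ring T by (rule T_ring)
  interpret RH: ring H by (rule hecke_ring)
  define \<rho> where "\<rho> = (\<lambda>f. inv_into (carrier H) h (rho f))"
  have rc: "\<rho> f \<in> carrier H" "h (\<rho> f) = rho f" if "f \<in> carrier T" for f
    unfolding \<rho>_def using inv_into_into[OF rho_image[OF that]] f_inv_into_f[OF rho_image[OF that]] by auto
  have eqI: "\<rho> f = x" if "f \<in> carrier T" "x \<in> carrier H" "rho f = h x" for f x
    using h_eqI[of "\<rho> f" x] rc[OF that(1)] that by simp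
  have "frakT_hom m n q v T \<rho>" unfolding frakT_hom_def
  proof (intro conjI allI ballI)
    show "\<rho> \<in> ring_hom T H"
    proof (rule ring_hom_memI)
      show "\<rho> \<one>\<^bsub>T\<^esub> = \<one>\<^bsub>H\<^esub>"
        by (rule eqI) (use rho_tens[OF one_KX RH.one_closed] in \<open>auto simp: T_one[symmetric] U.hmap_1\<close>)
    next
      fix f g assume "f \<in> carrier T" "g \<in> carrier T"
      then show "\<rho> (f \<otimes>\<^bsub>T\<^esub> g) = \<rho> f \<otimes>\<^bsub>H\<^esub> \<rho> g" "\<rho> (f \<oplus>\<^bsub>T\<^esub> g) = \<rho> f \<oplus>\<^bsub>H\<^esub> \<rho> g"
        by (intro eqI; simp add: rc U.hmap_simps rho_mult rho_add)+
    qed (rule rc)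
    show "\<rho> (sm c f) = hconst m n q v c \<otimes>\<^bsub>H\<^esub> \<rho> f" if "f \<in> carrier T" for c f
      using that by (intro eqI) (auto simp: sm_carrier rc hconst_carrier U.hmap_simps rho_smult U.hmap_const)
  qed
  moreover have t1: "\<rho> (tn 1 \<phi>) = \<phi>" if "\<phi> \<in> carrier H" for \<phi>
    using rho_tens[OF one_KX that] by (intro eqI tn1 that) simp
  moreover have "\<rho> (tn (fgen X) \<one>\<^bsub>H\<^esub>) = E_elt m n q v X" if "X \<in> stdn" for X
    using rho_tens[OF KX_gen[OF that] RH.one_closed] tn_carrier(2)[OF KX_gen[OF that] RH.one_closed] that
    by (intro eqI) (auto simp: U.E_elt_carrier U.hmap_E U.hmap_1)
  ultimately show ?thesis using t1[OF htau_carrier] t1[OF hsigma_carrier] by blast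
qed

end

section \<open>Admissible parameters and indeterminates\<close>

text \<open>The geometric sum times \<open>q\<^sup>2 - 1\<close> is \<open>q ^ (2 * j) - 1\<close>.
  The condition on \<open>q\<^sup>2\<close> excludes a case that the sums admit: for
  \<open>q\<^sup>2 = 1\<close> they are positive integers, but the two nodes addable to a one-node
  diagram in its own component have equal content, and the denominators vanish.\<close>

lemma admissible_params:
  assumes a: "admissible m n q v" and q2: "n \<ge> 2 \<longrightarrow> q\<^sup>2 \<noteq> 1"
  shows "hecke_params m n q v"
proof
  show "q \<noteq> 0" "\<And>j. j \<in> {1..m} \<Longrightarrow> v j \<noteq> 0" using a by (auto simp: admissible_def)
  show "q powi (2 * i) * v j \<noteq> v k" if "j \<in> {1..m}" "k \<in> {1..m}" "j \<noteq> k" "\<bar>i\<bar> < int n" for i j k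
  proof -
    have "- int n < i" "i < int n" using that(4) by auto
    then have "q powi (2 * i) * v j - v k \<noteq> 0" using a that(1-3) unfolding admissible_def by blast
    then show ?thesis by simp
  qed
  show "q ^ (2 * j) \<noteq> 1" if "2 \<le> n" "1 \<le> j" "j \<le> n" for j
  proof
    assume "q ^ (2 * j) = 1"
    then have "(q\<^sup>2) ^ j = 1" by (simp add: power_mult)
    moreover have "(q\<^sup>2 - 1) * (\<Sum>i<j. (q\<^sup>2) ^ i) = (q\<^sup>2) ^ j - 1" by (rule power_diff_1_eq[symmetric])
    ultimately have "(\<Sum>i<j. (q\<^sup>2) ^ i) = 0" using q2 that(1) by simp
    moreover have "{..<j} = {..j - 1}" using that by auto
    ultimately have "(\<Sum>i\<le>j - 1. q ^ (2 * i)) = 0" by (simp add: power_mult)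
    moreover have "j - 1 < n" using that by simp
    ultimately show False using a unfolding admissible_def by blast
  qed
qed

definition xmonom :: "('x \<Rightarrow>\<^sub>0 nat) \<Rightarrow> 'x::{finite,linorder} ratfun" where
  "xmonom a = Fract (Poly_Mapping.single a 1) 1"

lemma single_inj: "Poly_Mapping.single a (1::'k::zero_neq_one) = Poly_Mapping.single b 1 \<longleftrightarrow> a = b"
proof
  assume "Poly_Mapping.single a (1::'k) = Poly_Mapping.single b 1"
  then have "Poly_Mapping.keys (Poly_Mapping.single a (1::'k)) = Poly_Mapping.keys (Poly_Mapping.single b (1::'k))"
    by (rule arg_cong)
  then show "a = b" by simp
qed simp

lemma single_neq_0: "c \<noteq> 0 \<Longrightarrow> Poly_Mapping.single a c \<noteq> 0"
  by (metis keys_single keys_zero insert_not_empty)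

lemma xmonom_inj: "xmonom a = xmonom b \<longleftrightarrow> a = b"
  by (simp add: xmonom_def eq_fract single_inj)

lemma xmonom_mult: "xmonom a * xmonom b = xmonom (a + b)"
  by (simp add: xmonom_def mult_single)

lemma xmonom_0: "xmonom 0 = 1"
  by (simp add: xmonom_def One_fract_def)

lemma xmonom_neq_0: "xmonom a \<noteq> 0"
  by (simp add: xmonom_def Zero_fract_def eq_fract single_neq_0)

lemma indeterminate_power: "indeterminate x ^ j = xmonom (Poly_Mapping.single x j)"
  by (induction j) (simp_all add: xmonom_0 indeterminate_def xmonom_def[symmetric] xmonom_mult single_add[symmetric])

text \<open>All conditions assert that two Laurent monomials differ. Negative powers of
  \<open>q\<close> are cleared first, and the monomials are then told apart by the exponent of the
  variable \<open>x j\<close>.\<close>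

lemma indeterminate_params:
  fixes x :: "nat \<Rightarrow> 'x::{finite,linorder}"
  assumes x: "bij_betw x {0..m} (UNIV :: 'x set)"
  shows "hecke_params m n (indeterminate (x 0)) (\<lambda>j. indeterminate (x j))"
proof
  have i1: "indeterminate y = xmonom (Poly_Mapping.single y 1)" for y :: 'x
    using indeterminate_power[of y 1] by simp
  let ?q = "indeterminate (x 0)"
  show q0: "?q \<noteq> 0" by (simp only: i1 xmonom_neq_0 not_False_eq_True)
  show "\<And>j. j \<in> {1..m} \<Longrightarrow> indeterminate (x j) \<noteq> 0" by (simp only: i1 xmonom_neq_0 not_False_eq_True)
  show "?q ^ (2 * j) \<noteq> 1" if "1 \<le> j" for j
    unfolding indeterminate_power xmonom_0[symmetric] xmonom_inj using that by (simp add: single_neq_0)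
  have inj: "x j = x k \<longleftrightarrow> j = k" if "j \<in> {0..m}" "k \<in> {0..m}" for j k
    using x that by (auto simp: bij_betw_def inj_on_def)
  have ne: "?q ^ a * indeterminate (x j) \<noteq> ?q ^ b * indeterminate (x k)"
    if jk: "j \<in> {1..m}" "k \<in> {1..m}" "j \<noteq> k" for a b j k
  proof
    assume "?q ^ a * indeterminate (x j) = ?q ^ b * indeterminate (x k)"
    then have "Poly_Mapping.single (x 0) a + Poly_Mapping.single (x j) 1 = Poly_Mapping.single (x 0) b + Poly_Mapping.single (x k) 1"
      unfolding indeterminate_power unfolding i1 xmonom_mult xmonom_inj .
    then have "Poly_Mapping.lookup (Poly_Mapping.single (x 0) a + Poly_Mapping.single (x j) 1) (x j) =
        Poly_Mapping.lookup (Poly_Mapping.single (x 0) b + Poly_Mapping.single (x k) 1) (x j)" by simp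
    then show False using jk inj[of 0 j] inj[of k j] by (auto simp: lookup_add lookup_single when_def)
  qed
  show "?q powi (2 * i) * indeterminate (x j) \<noteq> indeterminate (x k)"
    if jk: "j \<in> {1..m}" "k \<in> {1..m}" "j \<noteq> k" for i j k
  proof (cases "i \<ge> 0")
    case True
    then have "?q powi (2 * i) = ?q ^ nat (2 * i)" by (simp add: power_int_def)
    then show ?thesis using ne[OF jk, of "nat (2 * i)" 0] by simp
  next
    case False
    then have "?q powi (2 * i) = inverse (?q ^ nat (- (2 * i)))" by (simp add: power_int_def power_inverse)
    moreover have "inverse P * a \<noteq> b" if "P \<noteq> 0" "a \<noteq> P * b" for a b P :: "'x ratfun"
      using that by (auto simp: mult.assoc[symmetric])
    moreover have "?q ^ nat (- (2 * i)) \<noteq> 0" using q0 by simp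
    moreover have "indeterminate (x j) \<noteq> ?q ^ nat (- (2 * i)) * indeterminate (x k)"
      using ne[OF jk, of 0 "nat (- (2 * i))"] by simp
    ultimately show ?thesis by metis
  qed
qed

lemma hecke_params_main:
  fixes q :: "'k::field"
  assumes "hecke_params m n q v" "1 \<le> m" "1 \<le> n"
  shows "complete_orthogonal_primitive_idempotents (hecke m n q v) (standard_tableaux m n) (E_elt m n q v) \<and>
    (\<forall>T. is_frakT m n q v T \<longrightarrow>
      (\<exists>\<rho>. frakT_hom m n q v T \<rho> \<and>
         \<rho> (tens m n q v 1 (htau m n q v)) = htau m n q v \<and>
         (\<forall>i\<in>{1..<n}. \<rho> (tens m n q v 1 (hsigma m n q v i)) = hsigma m n q v i) \<and>
         (\<forall>X\<in>standard_tableaux m n.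
            \<rho> (tens m n q v (fgen X) \<one>\<^bsub>hecke m n q v\<^esub>) = E_elt m n q v X)))"
proof (intro conjI allI impI)
  have M: "hecke_main m n q v" using assms by (simp add: hecke_main_def hecke_main_axioms_def)
  show "complete_orthogonal_primitive_idempotents (hecke m n q v) (standard_tableaux m n) (E_elt m n q v)"
    by (rule hecke_main.complete_system[OF M])
  fix T assume "is_frakT m n q v T"
  then show "\<exists>\<rho>. frakT_hom m n q v T \<rho> \<and>
         \<rho> (tens m n q v 1 (htau m n q v)) = htau m n q v \<and>
         (\<forall>i\<in>{1..<n}. \<rho> (tens m n q v 1 (hsigma m n q v i)) = hsigma m n q v i) \<and>
         (\<forall>X\<in>standard_tableaux m n.
            \<rho> (tens m n q v (fgen X) \<one>\<^bsub>hecke m n q v\<^esub>) = E_elt m n q v X)"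
    by (rule frakT.exists_hom[OF frakT.intro[OF M frakT_axioms.intro]])
qed

theorem mainTheorem6:
  fixes m n :: nat
  assumes "m \<ge> 1" and "n \<ge> 1"
  shows
    "(\<forall>(q::complex) v. admissible m n q v \<longrightarrow> (n \<ge> 2 \<longrightarrow> q\<^sup>2 \<noteq> 1) \<longrightarrow>
        complete_orthogonal_primitive_idempotents
          (hecke m n q v) (standard_tableaux m n) (E_elt m n q v) \<and>
        (\<forall>T. is_frakT m n q v T \<longrightarrow>
          (\<exists>\<rho>. frakT_hom m n q v T \<rho> \<and>
             \<rho> (tens m n q v 1 (htau m n q v)) = htau m n q v \<and>
             (\<forall>i\<in>{1..<n}. \<rho> (tens m n q v 1 (hsigma m n q v i)) = hsigma m n q v i) \<and>
             (\<forall>X\<in>standard_tableaux m n.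
                \<rho> (tens m n q v (fgen X) \<one>\<^bsub>hecke m n q v\<^esub>) = E_elt m n q v X)))) \<and>
     (\<forall>(x :: nat \<Rightarrow> 'x::{finite,linorder}) q v.
        bij_betw x {0..m} (UNIV :: 'x set) \<longrightarrow>
        q = indeterminate (x 0) \<longrightarrow> v = (\<lambda>j. indeterminate (x j)) \<longrightarrow>
        complete_orthogonal_primitive_idempotents
          (hecke m n q v) (standard_tableaux m n) (E_elt m n q v) \<and>
        (\<forall>T. is_frakT m n q v T \<longrightarrow>
          (\<exists>\<rho>. frakT_hom m n q v T \<rho> \<and>
             \<rho> (tens m n q v 1 (htau m n q v)) = htau m n q v \<and>
             (\<forall>i\<in>{1..<n}. \<rho> (tens m n q v 1 (hsigma m n q v i)) = hsigma m n q v i) \<and>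
             (\<forall>X\<in>standard_tableaux m n.
                \<rho> (tens m n q v (fgen X) \<one>\<^bsub>hecke m n q v\<^esub>) = E_elt m n q v X))))"
proof (rule conjI; intro allI impI)
  fix q :: complex and v
  assume "admissible m n q v" "n \<ge> 2 \<longrightarrow> q\<^sup>2 \<noteq> 1"
  then show "complete_orthogonal_primitive_idempotents (hecke m n q v) (standard_tableaux m n) (E_elt m n q v) \<and>
        (\<forall>T. is_frakT m n q v T \<longrightarrow>
          (\<exists>\<rho>. frakT_hom m n q v T \<rho> \<and>
             \<rho> (tens m n q v 1 (htau m n q v)) = htau m n q v \<and>
             (\<forall>i\<in>{1..<n}. \<rho> (tens m n q v 1 (hsigma m n q v i)) = hsigma m n q v i) \<and>
             (\<forall>X\<in>standard_tableaux m n.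
                \<rho> (tens m n q v (fgen X) \<one>\<^bsub>hecke m n q v\<^esub>) = E_elt m n q v X)))"
    by (intro hecke_params_main admissible_params assms)
next
  fix x :: "nat \<Rightarrow> 'x" and q v
  assume x: "bij_betw x {0..m} (UNIV :: 'x set)" and qv: "q = indeterminate (x 0)" "v = (\<lambda>j. indeterminate (x j))"
  show "complete_orthogonal_primitive_idempotents (hecke m n q v) (standard_tableaux m n) (E_elt m n q v) \<and>
        (\<forall>T. is_frakT m n q v T \<longrightarrow>
          (\<exists>\<rho>. frakT_hom m n q v T \<rho> \<and>
             \<rho> (tens m n q v 1 (htau m n q v)) = htau m n q v \<and>
             (\<forall>i\<in>{1..<n}. \<rho> (tens m n q v 1 (hsigma m n q v i)) = hsigma m n q v i) \<and>
             (\<forall>X\<in>standard_tableaux m n.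
                \<rho> (tens m n q v (fgen X) \<one>\<^bsub>hecke m n q v\<^esub>) = E_elt m n q v X)))"
    unfolding qv by (rule hecke_params_main[OF indeterminate_params[OF x] assms])
qed

end
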